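(* Let $\Omega_X,\Omega_Y\subset\mathbb R^d$ be bounded Lipschitz domains and let $A:\Omega_X\to\Omega_Y$ be a $C^1$-diffeomorphism with $\inf_{x\in\Omega_X}|\det DA(x)|>0$. Assume in addition that $A\in C_b^m(\Omega_X,\mathbb R^d)$ for some $m\in\mathbb N$ with $m>d/2$. Then for all real $\sigma$ with $0\le\sigma\le m$ the linear Koopman operator $$\mathcal K_A:H^\sigma(\Omega_Y)\to H^\sigma(\Omega_X),\qquad \mathcal K_Af=f\circ A,$$ is well defined and bounded.
   Context: A domain is a non-empty connected open set. A bounded domain $\Omega\subset\mathbb R^d$ is Lipschitz (has a Lipschitz boundary) if for every $x\in\partial\Omega$ there are a neighborhood $U_x$ of $x$, a Lipschitz function $\varphi:\mathbb R^{d-1}\to\mathbb R$ and a rigid motion $T:\mathbb R^d\to\mathbb R^d$ such that $U_x\cap\Omega=U_x\cap\{T(y):y\in\mathbb R^d,\ y_d<\varphi(y_1,\dots,y_{d-1})\}$. $C_b^k(\Omega,\mathbb R^d)$ is the space of all $C^k$-maps $\Omega\to\mathbb R^d$ with bounded derivatives up to order $k$. For $\sigma=\lfloor\sigma\rfloor+r\ge0$, $H^\sigma(\Omega)$ is the $L^2$-Sobolev space of order $\sigma$ with norm $$\|f\|_{H^\sigma(\Omega)}^2=\sum_{|\alpha|\le\lfloor\sigma\rfloor}\|D^\alpha f\|_{L^2(\Omega)}^2+\chi_{(0,1)}(r)\sum_{|\alpha|=\lfloor\sigma\rfloor}\int_\Omega\int_\Omega\frac{|D^\alpha f(x)-D^\alpha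 f(y)|^2}{\|x-y\|_2^{d+2r}}\,dx\,dy,$$ where $D^\alpha$ are weak derivatives and $\chi_{(0,1)}$ is the indicator function of $(0,1)$. *)

theory Defs
  imports "HOL-Analysis.Analysis"
begin

section \<open>Domains\<close>

definition domain_set :: "'a::topological_space set \<Rightarrow> bool" where
  "domain_set \<Omega> \<longleftrightarrow> \<Omega> \<noteq> {} \<and> open \<Omega> \<and> connected \<Omega>"

text \<open>
  The index \<open>k\<close> plays the role of the last coordinate \<open>d\<close>; the choice is immaterial because a
  rigid motion may permute coordinates. The space of the remaining \<open>d - 1\<close> coordinates is
  identified isometrically with the hyperplane \<open>{y. y $ k = 0}\<close>.
  Rigid motions are the Euclidean isometries \<open>y \<mapsto> b + Q y\<close> with \<open>Q\<close> orthogonal; reflections are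
  included (without them no bounded interval would be Lipschitz for \<open>d = 1\<close>).
\<close>

definition lipschitz_boundary :: "(real ^ 'd) set \<Rightarrow> bool" where
  "lipschitz_boundary \<Omega> \<longleftrightarrow>
    (\<forall>x \<in> frontier \<Omega>. \<exists>U k (\<phi> :: real ^ 'd \<Rightarrow> real) L Q b.
       open U \<and> x \<in> U \<and>
       L-lipschitz_on {y. y $ k = 0} \<phi> \<and>
       orthogonal_transformation Q \<and>
       U \<inter> \<Omega> = U \<inter> (\<lambda>y. b + Q y) ` {y. y $ k < \<phi> (\<chi> j. if j = k then 0 else y $ j)})"

definition bounded_lipschitz_domain :: "(real ^ 'd) set \<Rightarrow> bool" where
  "bounded_lipschitz_domain \<Omega> \<longleftrightarrow> domain_set \<Omega> \<and> bounded \<Omega> \<and> lipschitz_boundary \<Omega>"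

section \<open>Classical derivatives\<close>

definition partial_deriv :: "'d \<Rightarrow> (real ^ 'd \<Rightarrow> 'b::real_normed_vector) \<Rightarrow> real ^ 'd \<Rightarrow> 'b" where
  "partial_deriv i f x = frechet_derivative f (at x) (axis i 1)"

text \<open>Only meant for open \<open>S\<close>: the derivatives are taken in the whole space.\<close>

primrec Ck_on :: "nat \<Rightarrow> (real ^ 'd) set \<Rightarrow> (real ^ 'd \<Rightarrow> 'b::real_normed_vector) \<Rightarrow> bool" where
  "Ck_on 0 S f \<longleftrightarrow> continuous_on S f"
| "Ck_on (Suc k) S f \<longleftrightarrow> f differentiable_on S \<and> (\<forall>i. Ck_on k S (partial_deriv i f))"

definition mi_order :: "('d::finite \<Rightarrow> nat) \<Rightarrow> nat" where
  "mi_order \<alpha> = (\<Sum>i\<in>UNIV. \<alpha> i)"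

lemma finite_mi_order_le: "finite {\<alpha> :: 'd::finite \<Rightarrow> nat. mi_order \<alpha> \<le> k}"
proof (rule finite_subset)
  show "{\<alpha> :: 'd \<Rightarrow> nat. mi_order \<alpha> \<le> k} \<subseteq> PiE UNIV (\<lambda>_. {..k})"
  proof
    fix \<alpha> :: "'d \<Rightarrow> nat" assume a: "\<alpha> \<in> {\<alpha>. mi_order \<alpha> \<le> k}"
    have "\<alpha> i \<le> (\<Sum>i\<in>UNIV. \<alpha> i)" for i
      by (rule member_le_sum) auto
    with a show "\<alpha> \<in> PiE UNIV (\<lambda>_. {..k})"
      by (auto simp: mi_order_def intro: order_trans)
  qed
qed (auto intro!: finite_PiE)

text \<open>
  The index type \<open>'d\<close> carries no order, so the order in which the partial derivatives are taken
  is fixed by an arbitrary enumeration of the coordinates. It is irrelevant on functions of class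
  \<open>C\<^sup>k\<close> with \<open>k\<close> at least the order of the multi-index, the only ones \<open>mderiv\<close> is applied to.
\<close>

definition coords :: "'d::finite list" where
  "coords = (SOME js. distinct js \<and> set js = UNIV)"

definition mderiv ::
  "('d::finite \<Rightarrow> nat) \<Rightarrow> (real ^ 'd \<Rightarrow> 'b::real_normed_vector) \<Rightarrow> real ^ 'd \<Rightarrow> 'b" where
  "mderiv \<alpha> = foldr (\<lambda>i. partial_deriv i ^^ \<alpha> i) coords"

definition Cb_on :: "nat \<Rightarrow> (real ^ 'd) set \<Rightarrow> (real ^ 'd \<Rightarrow> 'b::real_normed_vector) \<Rightarrow> bool" where
  "Cb_on k S f \<longleftrightarrow> Ck_on k S f \<and> (\<forall>\<alpha>. mi_order \<alpha> \<le> k \<longrightarrow> bounded (mderiv \<alpha> f ` S))"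

definition C1_diffeomorphism ::
  "(real ^ 'd) set \<Rightarrow> (real ^ 'd) set \<Rightarrow> (real ^ 'd \<Rightarrow> real ^ 'd) \<Rightarrow> bool" where
  "C1_diffeomorphism X Y A \<longleftrightarrow>
     bij_betw A X Y \<and> Ck_on 1 X A \<and> Ck_on 1 Y (inv_into X A)"

section \<open>Weak derivatives and Sobolev spaces\<close>

definition test_functions :: "(real ^ 'd) set \<Rightarrow> (real ^ 'd \<Rightarrow> real) set" where
  "test_functions \<Omega> =
    {\<phi>. (\<forall>k. Ck_on k UNIV \<phi>) \<and> compact (closure {x. \<phi> x \<noteq> 0}) \<and> closure {x. \<phi> x \<noteq> 0} \<subseteq> \<Omega>}"

definition locally_integrable_on :: "(real ^ 'd \<Rightarrow> real) \<Rightarrow> (real ^ 'd) set \<Rightarrow> bool" where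
  "locally_integrable_on f \<Omega> \<longleftrightarrow> (\<forall>K. compact K \<and> K \<subseteq> \<Omega> \<longrightarrow> f absolutely_integrable_on K)"

definition has_weak_deriv ::
  "(real ^ 'd) set \<Rightarrow> ('d \<Rightarrow> nat) \<Rightarrow> (real ^ 'd \<Rightarrow> real) \<Rightarrow> (real ^ 'd \<Rightarrow> real) \<Rightarrow> bool" where
  "has_weak_deriv \<Omega> \<alpha> f g \<longleftrightarrow>
     locally_integrable_on f \<Omega> \<and> locally_integrable_on g \<Omega> \<and>
     (\<forall>\<phi> \<in> test_functions \<Omega>.
        (LINT x|lebesgue_on \<Omega>. f x * mderiv \<alpha> \<phi> x) =
        (-1) ^ mi_order \<alpha> * (LINT x|lebesgue_on \<Omega>. g x * \<phi> x))"

text \<open>A representative of the weak derivative, which is unique up to null sets.\<close>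

definition weak_deriv ::
  "(real ^ 'd) set \<Rightarrow> ('d \<Rightarrow> nat) \<Rightarrow> (real ^ 'd \<Rightarrow> real) \<Rightarrow> real ^ 'd \<Rightarrow> real" where
  "weak_deriv \<Omega> \<alpha> f = (SOME g. has_weak_deriv \<Omega> \<alpha> f g)"

definition L2_norm_sq :: "(real ^ 'd) set \<Rightarrow> (real ^ 'd \<Rightarrow> real) \<Rightarrow> ennreal" where
  "L2_norm_sq \<Omega> g = (\<integral>\<^sup>+ x. ennreal (\<bar>g x\<bar>\<^sup>2) \<partial>lebesgue_on \<Omega>)"

text \<open>On the diagonal \<open>x = y\<close>, a null set, the integrand is \<open>0 / 0 = 0\<close>.\<close>

definition gagliardo_sq :: "(real ^ 'd) set \<Rightarrow> real \<Rightarrow> (real ^ 'd \<Rightarrow> real) \<Rightarrow> ennreal" where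
  "gagliardo_sq \<Omega> r g =
     (\<integral>\<^sup>+ x. (\<integral>\<^sup>+ y. ennreal (\<bar>g x - g y\<bar>\<^sup>2 / norm (x - y) powr (real CARD('d) + 2 * r))
        \<partial>lebesgue_on \<Omega>) \<partial>lebesgue_on \<Omega>)"

text \<open>Only meant for \<open>\<sigma> \<ge> 0\<close> and \<open>f\<close> with all weak derivatives up to order \<open>\<lfloor>\<sigma>\<rfloor>\<close>.\<close>

definition sobolev_norm_sq :: "(real ^ 'd) set \<Rightarrow> real \<Rightarrow> (real ^ 'd \<Rightarrow> real) \<Rightarrow> ennreal" where
  "sobolev_norm_sq \<Omega> \<sigma> f =
     (\<Sum>\<alpha> | mi_order \<alpha> \<le> nat \<lfloor>\<sigma>\<rfloor>. L2_norm_sq \<Omega> (weak_deriv \<Omega> \<alpha> f)) +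
     indicator {0<..<1} (frac \<sigma>) *
       (\<Sum>\<alpha> | mi_order \<alpha> = nat \<lfloor>\<sigma>\<rfloor>. gagliardo_sq \<Omega> (frac \<sigma>) (weak_deriv \<Omega> \<alpha> f))"

text \<open>
  As usual for function spaces over \<open>lebesgue_on\<close>, the elements of \<open>H\<^sup>\<sigma>\<close> are represented by
  functions (whose values outside \<open>\<Omega>\<close> play no role); elements of the space proper are the classes
  of these modulo equality almost everywhere on \<open>\<Omega>\<close>.
\<close>

definition sobolev_space :: "(real ^ 'd) set \<Rightarrow> real \<Rightarrow> (real ^ 'd \<Rightarrow> real) set" where
  "sobolev_space \<Omega> \<sigma> =
    {f. (\<forall>\<alpha>. mi_order \<alpha> \<le> nat \<lfloor>\<sigma>\<rfloor> \<longrightarrow> (\<exists>g. has_weak_deriv \<Omega> \<alpha> f g)) \<and>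
        sobolev_norm_sq \<Omega> \<sigma> f < \<infinity>}"

definition sobolev_norm :: "(real ^ 'd) set \<Rightarrow> real \<Rightarrow> (real ^ 'd \<Rightarrow> real) \<Rightarrow> real" where
  "sobolev_norm \<Omega> \<sigma> f = sqrt (enn2real (sobolev_norm_sq \<Omega> \<sigma> f))"

definition koopman :: "(real ^ 'd \<Rightarrow> real ^ 'd) \<Rightarrow> (real ^ 'd \<Rightarrow> real) \<Rightarrow> real ^ 'd \<Rightarrow> real" where
  "koopman A f = f \<circ> A"

end

theory Submission
  imports Defs
begin

text \<open>
  For smooth \<open>F\<close> the chain rule expresses a derivative of order \<open>n\<close> of \<open>F \<circ> A\<close> as a finite sum
  \<open>\<Sum> P\<^bsub>w\<^esub> \<cdot> (D\<^bsub>w\<^esub> F \<circ> A)\<close> over derivatives \<open>D\<^bsub>w\<^esub> F\<close> of order at most \<open>n\<close>, whose coefficients are polynomials in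
  derivatives of \<open>A\<close> of order at most \<open>n\<close> and therefore bounded (\<open>chain_rule_pd\<close>). The same formula
  holds weakly for a Sobolev function \<open>f\<close>: on a compact set \<open>f\<close> is the \<open>L\<^sup>1\<close>-limit, together with its
  weak derivatives, of smooth functions (\<open>smooth_approximation\<close>), a classical integration by parts
  moves the derivatives of \<open>F \<circ> A\<close> onto the test function, and the change of variables carries the
  \<open>L\<^sup>1\<close>-convergence over to the compositions (\<open>weak_chain_rule\<close>).

  Integer orders. The determinant is bounded below and \<open>DA\<close> is bounded, so by Cramer's rule the
  inverse of \<open>A\<close> has a bounded derivative and enlarges volumes at most by a constant factor \<open>c\<close>
  (\<open>emeasure_image_le\<close>); hence \<open>\<integral> u \<circ> A \<le> c \<integral> u\<close> for \<open>u \<ge> 0\<close>, which bounds every term of the chain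
  rule in \<open>L\<^sup>2\<close>. Weak derivatives are unique almost everywhere (\<open>weak_deriv_unique\<close>), so it is
  irrelevant which representatives enter the Sobolev norm.

  Fractional orders. Let \<open>\<sigma> = k + r\<close> with \<open>0 < r < 1\<close>; then \<open>k < m\<close>, so \<open>A\<close> and the coefficients of the
  chain rule up to order \<open>k\<close> have bounded first derivatives. Two points of a Lipschitz domain at small distance
  \<open>t\<close> are joined inside the domain by three segments: move both points by \<open>t v\<close> away from the
  boundary, and go straight in between; finitely many directions \<open>v\<close> suffice (\<open>uniform_detours\<close>).
  This has two consequences. Functions with bounded first derivatives are Lipschitz
  (\<open>Ckb_1_lipschitz\<close>), so that composing with \<open>A\<close> and multiplying by a coefficient is harmless for
  the Gagliardo seminorm (\<open>gagliardo_compose\<close>). And the difference of a function of class \<open>H\<^sup>1\<close> and its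
  translate by \<open>z\<close> is \<open>O(|z|)\<close> in \<open>L\<^sup>2\<close>, hence \<open>H\<^sup>1 \<subseteq> H\<^sup>r\<close> (\<open>gagliardo_embedding\<close>); this controls the
  terms of the chain rule in which fewer than \<open>k\<close> derivatives fall on \<open>f\<close>.
\<close>

section \<open>Iterated partial derivatives\<close>

text \<open>
  Iterated partial derivatives are indexed by lists of coordinates. Lists suit the inductive proofs
  better than multi-indices, which prescribe an order of differentiation; that the order is
  irrelevant is needed only when the two are compared.
\<close>

definition pd :: "'d list \<Rightarrow> (real ^ 'd \<Rightarrow> 'b::real_normed_vector) \<Rightarrow> real ^ 'd \<Rightarrow> 'b" where
  "pd js f = foldr partial_deriv js f"

lemma pd_Nil [simp]: "pd [] f = f" by (simp add: pd_def)
lemma pd_Cons [simp]: "pd (i # js) f = partial_deriv i (pd js f)" by (simp add: pd_def)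
lemma pd_append: "pd (js @ ks) f = pd js (pd ks f)" by (simp add: pd_def)

lemma partial_deriv_eq:
  assumes "(f has_derivative f') (at x)"
  shows "partial_deriv i f x = f' (axis i 1)"
  using frechet_derivative_at[OF assms] by (simp add: partial_deriv_def)

lemma differentiable_on_open_at:
  assumes "f differentiable_on S" "open S" "x \<in> S"
  shows "f differentiable (at x)"
  using assms by (metis at_within_open differentiable_on_def)

lemma partial_deriv_cong_open:
  assumes "open S" "x \<in> S" "\<And>y. y \<in> S \<Longrightarrow> f y = g y"
  shows "partial_deriv i f x = partial_deriv i g x"
proof -
  have "(f has_derivative D) (at x) \<longleftrightarrow> (g has_derivative D) (at x)" for D
    using has_derivative_transform_within_open[of f D x UNIV S g]
      has_derivative_transform_within_open[of g D x UNIV S f] assms by auto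
  then show ?thesis by (simp add: partial_deriv_def frechet_derivative_def)
qed

lemma pd_cong_open:
  assumes "open S" "x \<in> S" "\<And>y. y \<in> S \<Longrightarrow> f y = g y"
  shows "pd js f x = pd js g x"
  using assms(2)
proof (induction js arbitrary: x)
  case (Cons i js)
  then show ?case using partial_deriv_cong_open[OF assms(1), of x "pd js f" "pd js g"] by simp
qed (use assms in auto)

text \<open>
  Used whenever a derivative is to be estimated or computed from the partial derivatives.
\<close>

lemma has_derivative_partial_sum:
  assumes "f differentiable (at x)"
  shows "(f has_derivative (\<lambda>h. \<Sum>i\<in>UNIV. (h $ i) *\<^sub>R partial_deriv i f x)) (at x)"
proof -
  let ?D = "frechet_derivative f (at x)"
  have D: "(f has_derivative ?D) (at x)" using assms frechet_derivative_works by blast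
  interpret linear ?D using D has_derivative_linear by blast
  have "?D h = (\<Sum>i\<in>UNIV. (h $ i) *\<^sub>R partial_deriv i f x)" for h
  proof -
    have "h = (\<Sum>i\<in>UNIV. (h $ i) *\<^sub>R axis i 1)"
      using basis_expansion[of h] by (simp add: scalar_mult_eq_scaleR)
    then have "?D h = ?D (\<Sum>i\<in>UNIV. (h $ i) *\<^sub>R axis i 1)" by simp
    also have "\<dots> = (\<Sum>i\<in>UNIV. (h $ i) *\<^sub>R ?D (axis i 1))" by (simp add: sum scaleR)
    finally show ?thesis by (simp add: partial_deriv_def)
  qed
  then show ?thesis using D by presburger
qed

text \<open>
  The classes \<open>C\<^sup>k\<close> (flag \<open>False\<close>) and \<open>C\<^sup>k\<^sub>b\<close> (flag \<open>True\<close>) are treated together, because sums and products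
  are handled by the same inductions for both. The bounds are stated along the recursion, so that they are
  available for all partial derivatives in any order.
\<close>

primrec Ckb :: "bool \<Rightarrow> nat \<Rightarrow> (real ^ 'd) set \<Rightarrow> (real ^ 'd \<Rightarrow> 'b::real_normed_vector) \<Rightarrow> bool" where
  "Ckb b 0 S f \<longleftrightarrow> continuous_on S f \<and> (b \<longrightarrow> bounded (f ` S))"
| "Ckb b (Suc k) S f \<longleftrightarrow> f differentiable_on S \<and> (b \<longrightarrow> bounded (f ` S)) \<and> (\<forall>i. Ckb b k S (partial_deriv i f))"

lemma Ckb_False: "Ckb False k S f \<longleftrightarrow> Ck_on k S f"
  by (induction k arbitrary: f) auto

lemma Ckb_imp_Ck_on: "Ckb b k S f \<Longrightarrow> Ck_on k S f"
  by (induction k arbitrary: f) auto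

lemma Ckb_bounded: "Ckb True k S f \<Longrightarrow> bounded (f ` S)"
  by (cases k) auto

lemma Ckb_continuous: "Ckb b k S f \<Longrightarrow> continuous_on S f"
  by (cases k) (auto simp: differentiable_imp_continuous_on)

lemma Ckb_cong:
  assumes "open S" "\<And>y. y \<in> S \<Longrightarrow> f y = g y" "Ckb b k S f"
  shows "Ckb b k S g"
  using assms(2,3)
proof (induction k arbitrary: f g)
  case 0
  have "f ` S = g ` S" using 0 by (auto intro!: image_cong)
  then show ?case using 0 continuous_on_cong[of S S f g] by auto
next
  case (Suc k)
  have *: "f ` S = g ` S" using Suc by (auto intro!: image_cong)
  have "g differentiable_on S"
    using Suc.prems by (auto simp: differentiable_on_def intro: differentiable_transform_within[OF _ zero_less_one])
  moreover have "Ckb b k S (partial_deriv i g)" for i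
    using Suc.IH[of "partial_deriv i f" "partial_deriv i g"] Suc.prems
      partial_deriv_cong_open[OF assms(1), of _ f g] by auto
  ultimately show ?case using Suc.prems * by auto
qed

lemma Ckb_SucD: "Ckb b (Suc k) S f \<Longrightarrow> Ckb b k S f"
proof (induction k arbitrary: f)
  case (Suc k) then show ?case by auto
qed (auto simp: differentiable_imp_continuous_on)

lemma Ck_on_SucD: "Ck_on (Suc k) S f \<Longrightarrow> Ck_on k S f"
  using Ckb_SucD[of False] unfolding Ckb_False by blast

lemma Ckb_mono: "Ckb b n S f \<Longrightarrow> k \<le> n \<Longrightarrow> Ckb b k S f"
proof (induction n)
  case (Suc n)
  then show ?case using Ckb_SucD[of b n S f] by (cases "k = Suc n") auto
qed auto

lemma Ckb_const [simp]:
  fixes c :: "'b::real_normed_vector" and S :: "(real ^ 'd) set"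
  shows "Ckb b k S (\<lambda>x. c)"
proof (induction k arbitrary: c)
  case 0
  have "bounded ((\<lambda>x. c) ` S)" by (rule bounded_subset[of "{c}"]) auto
  then show ?case by simp
next
  case (Suc k)
  have "bounded ((\<lambda>x. c) ` S)" by (rule bounded_subset[of "{c}"]) auto
  moreover have "partial_deriv i (\<lambda>x :: real ^ 'd. c) = (\<lambda>x. 0)" for i
    by (rule ext, subst partial_deriv_eq[OF has_derivative_const]) simp
  ultimately show ?case using Suc by simp
qed

lemma partial_deriv_add:
  assumes "f differentiable at x" "g differentiable at x"
  shows "partial_deriv i (\<lambda>x. f x + g x) x = partial_deriv i f x + partial_deriv i g x"
proof -
  obtain f' g' where "(f has_derivative f') (at x)" "(g has_derivative g') (at x)"
    using assms by (auto simp: differentiable_def)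
  then show ?thesis by (simp add: partial_deriv_eq partial_deriv_eq[OF has_derivative_add])
qed

lemma partial_deriv_mult:
  fixes f g :: "real ^ 'd \<Rightarrow> real"
  assumes "f differentiable at x" "g differentiable at x"
  shows "partial_deriv i (\<lambda>x. f x * g x) x = f x * partial_deriv i g x + partial_deriv i f x * g x"
proof -
  obtain f' g' where "(f has_derivative f') (at x)" "(g has_derivative g') (at x)"
    using assms by (auto simp: differentiable_def)
  then show ?thesis by (simp add: partial_deriv_eq partial_deriv_eq[OF has_derivative_mult])
qed

lemma Ckb_add:
  assumes "open S" "Ckb b k S f" "Ckb b k S g"
  shows "Ckb b k S (\<lambda>x. f x + g x)"
  using assms(2,3)
proof (induction k arbitrary: f g)
  case 0
  then show ?case by (auto intro!: continuous_intros bounded_plus_comp)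
next
  case (Suc k)
  have "Ckb b k S (partial_deriv i (\<lambda>x. f x + g x))" for i
  proof (rule Ckb_cong[OF assms(1)])
    show "Ckb b k S (\<lambda>x. partial_deriv i f x + partial_deriv i g x)" using Suc by auto
  qed (use Suc.prems assms(1) in \<open>auto intro!: partial_deriv_add[symmetric] differentiable_on_open_at\<close>)
  then show ?case using Suc.prems by (auto intro!: differentiable_on_add bounded_plus_comp)
qed

lemma Ckb_sum:
  assumes "open S" "\<And>a. a \<in> I \<Longrightarrow> Ckb b k S (f a)"
  shows "Ckb b k S (\<lambda>x. \<Sum>a\<in>I. f a x)"
  using assms(2) by (induction I rule: infinite_finite_induct) (auto intro!: Ckb_add assms(1))

lemma bounded_mult_image:
  fixes f g :: "'a \<Rightarrow> real"
  assumes "bounded (f ` S)" "bounded (g ` S)"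
  shows "bounded ((\<lambda>x. f x * g x) ` S)"
proof -
  obtain a b where ab: "\<And>x. x \<in> S \<Longrightarrow> \<bar>f x\<bar> \<le> a" "\<And>x. x \<in> S \<Longrightarrow> \<bar>g x\<bar> \<le> b"
    using assms by (auto simp: bounded_iff)
  have "\<bar>f x * g x\<bar> \<le> a * b" if "x \<in> S" for x
  proof -
    have "0 \<le> a" using ab(1)[OF that] by linarith
    then show ?thesis unfolding abs_mult using ab that by (intro mult_mono) auto
  qed
  then show ?thesis by (auto simp: bounded_iff)
qed

lemma Ckb_mult:
  fixes f g :: "real ^ 'd \<Rightarrow> real"
  assumes "open S" "Ckb b k S f" "Ckb b k S g"
  shows "Ckb b k S (\<lambda>x. f x * g x)"
  using assms(2,3)
proof (induction k arbitrary: f g)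
  case 0
  then show ?case by (auto intro!: continuous_intros bounded_mult_image)
next
  case (Suc k)
  have "Ckb b k S (partial_deriv i (\<lambda>x. f x * g x))" for i
  proof (rule Ckb_cong[OF assms(1)])
    show "Ckb b k S (\<lambda>x. f x * partial_deriv i g x + partial_deriv i f x * g x)"
      using Suc.prems by (intro Ckb_add assms(1) Suc.IH) (auto intro!: Ckb_SucD[of b k] Suc.prems)
  qed (use Suc.prems assms(1) in \<open>auto intro!: partial_deriv_mult[symmetric] differentiable_on_open_at\<close>)
  then show ?case using Suc.prems by (auto intro!: differentiable_on_mult bounded_mult_image)
qed

lemma Ckb_pd: "Ckb b (length js + k) S f \<Longrightarrow> Ckb b k S (pd js f)"
proof (induction js arbitrary: k)
  case (Cons i js)
  then show ?case using Cons.IH[of "Suc k"] by auto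
qed auto

lemma Ckb_True_iff:
  "Ckb True k S f \<longleftrightarrow> Ck_on k S f \<and> (\<forall>js. length js \<le> k \<longrightarrow> bounded (pd js f ` S))"
proof (intro iffI conjI allI impI)
  fix js :: "'a list" assume "Ckb True k S f" "length js \<le> k"
  then show "bounded (pd js f ` S)"
    using Ckb_bounded[OF Ckb_pd[of True js "k - length js" S f]] by auto
next
  show "Ck_on k S f \<and> (\<forall>js. length js \<le> k \<longrightarrow> bounded (pd js f ` S)) \<Longrightarrow> Ckb True k S f"
  proof (induction k arbitrary: f)
    case (Suc k)
    have "bounded (pd js (partial_deriv i f) ` S)" if "length js \<le> k" for i js
      using Suc.prems that pd_append[of js "[i]" f] by (metis One_nat_def Suc_le_mono length_append_singleton pd_Cons pd_Nil)
    moreover have "bounded (f ` S)" using Suc.prems[THEN conjunct2, rule_format, of "[]"] by simp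
    ultimately show ?case using Suc by auto
  qed auto
qed (auto intro: Ckb_imp_Ck_on)

lemma line_deriv:
  fixes f :: "real ^ 'd \<Rightarrow> real"
  assumes "f differentiable at (p + t *\<^sub>R axis i 1)"
  shows "((\<lambda>t. f (p + t *\<^sub>R axis i 1)) has_real_derivative partial_deriv i f (p + t *\<^sub>R axis i 1)) (at t)"
proof -
  have f: "(f has_derivative (\<lambda>h. \<Sum>j\<in>UNIV. (h $ j) *\<^sub>R partial_deriv j f (p + t *\<^sub>R axis i 1))) (at (p + t *\<^sub>R axis i 1))"
    by (rule has_derivative_partial_sum[OF assms])
  have "((\<lambda>t. p + t *\<^sub>R axis i 1) has_derivative (\<lambda>h. h *\<^sub>R axis i 1)) (at t)"
    by (auto intro!: derivative_eq_intros)
  from diff_chain_at[OF this f]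
  have "((\<lambda>t. f (p + t *\<^sub>R axis i 1)) has_derivative (\<lambda>h. h * partial_deriv i f (p + t *\<^sub>R axis i 1))) (at t)"
    by (simp add: o_def axis_def if_distrib[of "\<lambda>x. _ * x"] if_distrib[of "\<lambda>x. x * _"] cong: if_cong)
  then show ?thesis by (simp add: has_field_derivative_def mult.commute[of _ "partial_deriv i f _"])
qed

text \<open>
  Two applications of the mean value theorem. The second difference on the left is symmetric in \<open>i\<close>
  and \<open>j\<close>, which gives the symmetry of second derivatives below.
\<close>

lemma second_difference:
  fixes f :: "real ^ 'd \<Rightarrow> real"
  assumes S: "open S" and C: "Ck_on 2 S f" and h: "0 < h" and sub: "ball x (3 * h) \<subseteq> S"
  shows "\<exists>p \<in> ball x (3 * h). f (x + h *\<^sub>R axis i 1 + h *\<^sub>R axis j 1) - f (x + h *\<^sub>R axis i 1)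
     - f (x + h *\<^sub>R axis j 1) + f x = h * h * partial_deriv j (partial_deriv i f) p"
proof -
  have df: "f differentiable at y" "partial_deriv i f differentiable at y" if "y \<in> S" for y
    using C S that by (auto simp: numeral_2_eq_2 intro: differentiable_on_open_at)
  have inb: "x + s *\<^sub>R axis i 1 + t *\<^sub>R axis j 1 \<in> ball x (3 * h)" if "0 \<le> s" "s \<le> h" "0 \<le> t" "t \<le> h" for s t
  proof -
    have "norm (s *\<^sub>R axis i (1::real) + t *\<^sub>R axis j 1) \<le> norm (s *\<^sub>R axis i (1::real) :: real^'d) + norm (t *\<^sub>R axis j (1::real) :: real^'d)"
      by (rule norm_triangle_ineq)
    also have "\<dots> < 3 * h" using that h by (simp add: norm_axis_1)
    finally have "dist (x + (s *\<^sub>R axis i 1 + t *\<^sub>R axis j 1)) x < 3 * h" by (simp add: dist_norm)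
    then show ?thesis by (simp add: add.assoc dist_commute)
  qed
  have inS: "x + s *\<^sub>R axis i 1 + t *\<^sub>R axis j 1 \<in> S" if "0 \<le> s" "s \<le> h" "0 \<le> t" "t \<le> h" for s t
    using inb[OF that] sub by auto
  let ?u = "\<lambda>s. f (x + h *\<^sub>R axis j 1 + s *\<^sub>R axis i 1) - f (x + s *\<^sub>R axis i 1)"
  have "\<exists>s. 0 < s \<and> s < h \<and> ?u h - ?u 0 = (h - 0) * (partial_deriv i f (x + h *\<^sub>R axis j 1 + s *\<^sub>R axis i 1) - partial_deriv i f (x + s *\<^sub>R axis i 1))"
  proof (rule MVT2[OF h])
    fix s assume s: "0 \<le> s" "s \<le> h"
    have "x + h *\<^sub>R axis j 1 + s *\<^sub>R axis i 1 \<in> S" "x + s *\<^sub>R axis i 1 \<in> S"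
      using inS[of s h] inS[of s 0] s h by (auto simp: algebra_simps)
    then show "(?u has_real_derivative partial_deriv i f (x + h *\<^sub>R axis j 1 + s *\<^sub>R axis i 1) - partial_deriv i f (x + s *\<^sub>R axis i 1)) (at s)"
      by (intro DERIV_diff line_deriv df)
  qed
  then obtain s where s: "0 < s" "s < h" and u: "?u h - ?u 0 = h * (partial_deriv i f (x + h *\<^sub>R axis j 1 + s *\<^sub>R axis i 1) - partial_deriv i f (x + s *\<^sub>R axis i 1))"
    by auto
  let ?w = "\<lambda>t. partial_deriv i f (x + s *\<^sub>R axis i 1 + t *\<^sub>R axis j 1)"
  have "\<exists>t. 0 < t \<and> t < h \<and> ?w h - ?w 0 = (h - 0) * partial_deriv j (partial_deriv i f) (x + s *\<^sub>R axis i 1 + t *\<^sub>R axis j 1)"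
    by (rule MVT2[OF h], rule line_deriv, rule df, rule inS) (use s in auto)
  then obtain t where t: "0 < t" "t < h" and w: "?w h - ?w 0 = h * partial_deriv j (partial_deriv i f) (x + s *\<^sub>R axis i 1 + t *\<^sub>R axis j 1)"
    by auto
  have "?u h - ?u 0 = h * (?w h - ?w 0)" using u by (simp add: algebra_simps)
  also have "\<dots> = h * h * partial_deriv j (partial_deriv i f) (x + s *\<^sub>R axis i 1 + t *\<^sub>R axis j 1)" using w by simp
  finally show ?thesis
    by (intro bexI[of _ "x + s *\<^sub>R axis i 1 + t *\<^sub>R axis j 1"] inb) (use s t in \<open>auto simp: algebra_simps\<close>)
qed

lemma partial_deriv_commute:
  fixes f :: "real ^ 'd \<Rightarrow> real"
  assumes S: "open S" and C: "Ck_on 2 S f" and x: "x \<in> S"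
  shows "partial_deriv i (partial_deriv j f) x = partial_deriv j (partial_deriv i f) x"
proof (rule ccontr)
  let ?a = "partial_deriv i (partial_deriv j f)" and ?b = "partial_deriv j (partial_deriv i f)"
  assume ne: "?a x \<noteq> ?b x"
  define e where "e = \<bar>?a x - ?b x\<bar> / 2"
  have e: "e > 0" using ne by (simp add: e_def)
  have ca: "continuous_on S ?a" "continuous_on S ?b" using C by (auto simp: numeral_2_eq_2)
  then have "isCont ?a x" "isCont ?b x" using S x continuous_on_eq_continuous_at by blast+
  then obtain d1 d2 where d: "d1 > 0" "d2 > 0" "\<And>y. dist y x < d1 \<Longrightarrow> dist (?a y) (?a x) < e"
      "\<And>y. dist y x < d2 \<Longrightarrow> dist (?b y) (?b x) < e"
    using e unfolding continuous_at_eps_delta by metis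
  obtain d3 where d3: "d3 > 0" "ball x d3 \<subseteq> S" using S x open_contains_ball by blast
  define h where "h = min d1 (min d2 d3) / 3"
  have h: "h > 0" "3 * h \<le> d1" "3 * h \<le> d2" "3 * h \<le> d3" using d d3 by (auto simp: h_def)
  have sub: "ball x (3 * h) \<subseteq> S" using d3 h by auto
  \<comment> \<open>both mixed derivatives are values of the same difference quotient, at points near \<open>x\<close>\<close>
  obtain p where p: "p \<in> ball x (3 * h)" "f (x + h *\<^sub>R axis i 1 + h *\<^sub>R axis j 1) - f (x + h *\<^sub>R axis i 1)
     - f (x + h *\<^sub>R axis j 1) + f x = h * h * ?b p" using second_difference[OF S C h(1) sub] by blast
  obtain q where q: "q \<in> ball x (3 * h)" "f (x + h *\<^sub>R axis j 1 + h *\<^sub>R axis i 1) - f (x + h *\<^sub>R axis j 1)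
     - f (x + h *\<^sub>R axis i 1) + f x = h * h * ?a q" using second_difference[OF S C h(1) sub] by blast
  have "h * h * ?b p = h * h * ?a q" using p q by (simp add: algebra_simps)
  then have "?b p = ?a q" using h by simp
  moreover have "dist (?b p) (?b x) < e" "dist (?a q) (?a x) < e" using d p q h by (auto simp: dist_commute)
  ultimately show False by (auto simp: e_def dist_real_def abs_if split: if_splits)
qed

lemma pd_move_front:
  fixes f :: "real ^ 'd \<Rightarrow> real"
  assumes S: "open S" and C: "Ck_on (Suc (length as + length bs)) S f" and x: "x \<in> S"
  shows "pd (as @ i # bs) f x = pd (i # as @ bs) f x"
  using C x
proof (induction as arbitrary: x)
  case (Cons a as)
  have C': "Ck_on (Suc (length as + length bs)) S f"
    using Ck_on_SucD[of "Suc (length as + length bs)" S f] Cons.prems(1) by (simp del: Ck_on.simps)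
  have "pd ((a # as) @ i # bs) f x = partial_deriv a (partial_deriv i (pd (as @ bs) f)) x"
    using partial_deriv_cong_open[OF S Cons.prems(2), of "pd (as @ i # bs) f"] Cons.IH[OF C'] by simp
  also have "\<dots> = partial_deriv i (partial_deriv a (pd (as @ bs) f)) x"
  proof (rule partial_deriv_commute[OF S _ Cons.prems(2)])
    show "Ck_on 2 S (pd (as @ bs) f)"
      using Ckb_pd[of False "as @ bs" 2 S f] Cons.prems(1) by (simp add: Ckb_False)
  qed
  finally show ?case by simp
qed auto

text \<open>
  Every permutation arises by moving single entries to the front, and an entry is moved past its
  left neighbour by the symmetry of second derivatives.
\<close>

lemma pd_perm:
  fixes f :: "real ^ 'd \<Rightarrow> real"
  assumes S: "open S" and C: "Ck_on (length js) S f" and x: "x \<in> S" and p: "mset js = mset ks"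
  shows "pd js f x = pd ks f x"
  using C x p
proof (induction js arbitrary: ks x)
  case (Cons i js)
  have "i \<in> set ks" using Cons.prems(3) by (metis list.set_intros(1) set_mset_mset)
  then obtain as bs where ks: "ks = as @ i # bs" by (meson split_list)
  have m: "mset js = mset (as @ bs)" using Cons.prems(3) ks by simp
  then have l: "length js = length as + length bs" by (metis length_append size_mset)
  have C': "Ck_on (length js) S f" using Cons.prems(1) Ck_on_SucD by simp
  have "pd (i # js) f x = pd (i # as @ bs) f x"
    using partial_deriv_cong_open[OF S Cons.prems(2), of "pd js f"] Cons.IH[OF C' _ m] by simp
  also have "\<dots> = pd ks f x"
    using pd_move_front[OF S, of as bs f x i] Cons.prems l ks by simp
  finally show ?case .
qed auto

lemma pd_nth:
  fixes f :: "real ^ 'd \<Rightarrow> real ^ 'n"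
  assumes S: "open S" and C: "Ck_on (length js) S f" and x: "x \<in> S"
  shows "pd js (\<lambda>x. f x $ l) x = pd js f x $ l"
  using C x
proof (induction js arbitrary: x)
  case (Cons i js)
  have C': "Ck_on (length js) S f" using Cons.prems(1) Ck_on_SucD by simp
  have "pd (i # js) (\<lambda>x. f x $ l) x = partial_deriv i (\<lambda>x. pd js f x $ l) x"
    using partial_deriv_cong_open[OF S Cons.prems(2), of "pd js (\<lambda>x. f x $ l)"] Cons.IH[OF C'] by simp
  also have "\<dots> = partial_deriv i (pd js f) x $ l"
  proof -
    have "Ck_on 1 S (pd js f)" using Ckb_pd[of False js 1 S f] Cons.prems(1) by (simp add: Ckb_False)
    then have "pd js f differentiable (at x)" using S Cons.prems(2) differentiable_on_open_at by auto
    then have "(pd js f has_derivative frechet_derivative (pd js f) (at x)) (at x)"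
      using frechet_derivative_works by blast
    then have "((\<lambda>x. pd js f x $ l) has_derivative (\<lambda>h. frechet_derivative (pd js f) (at x) h $ l)) (at x)"
      by (rule bounded_linear.has_derivative[OF bounded_linear_vec_nth])
    then show ?thesis by (simp only: partial_deriv_eq) (simp add: partial_deriv_def)
  qed
  finally show ?case by simp
qed auto

lemma Ckb_nth:
  fixes f :: "real ^ 'd \<Rightarrow> real ^ 'n"
  assumes S: "open S" and C: "Ckb b k S f"
  shows "Ckb b k S (\<lambda>x. f x $ l)"
  using C
proof (induction k arbitrary: f)
  case 0
  then show ?case
    using bounded_linear_image[OF _ bounded_linear_vec_nth, of "f ` S" l] by (auto intro!: continuous_intros simp: image_image)
next
  case (Suc k)
  have "Ckb b k S (partial_deriv i (\<lambda>x. f x $ l))" for i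
  proof (rule Ckb_cong[OF S])
    show "Ckb b k S (\<lambda>x. partial_deriv i f x $ l)" using Suc by auto
    show "partial_deriv i f y $ l = partial_deriv i (\<lambda>x. f x $ l) y" if "y \<in> S" for y
    proof -
      have "\<forall>i. continuous_on S (partial_deriv i f)" using Suc.prems by (auto intro: Ckb_continuous)
      then show ?thesis using pd_nth[OF S, of "[i]" f y l] Suc.prems that by simp
    qed
  qed
  moreover have "(\<lambda>x. f x $ l) differentiable_on S"
    using Suc.prems bounded_linear.has_derivative[OF bounded_linear_vec_nth]
    unfolding differentiable_on_def differentiable_def Ckb.simps by blast
  ultimately show ?case using Suc.prems
    bounded_linear_image[OF _ bounded_linear_vec_nth, of "f ` S" l] by (auto simp: image_image)
qed

text \<open>
  The list in which \<open>mderiv\<close> differentiates, that is, the nondecreasing list with multiplicities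
  \<open>\<alpha>\<close> in the enumeration \<open>coords\<close>.
\<close>

definition canon :: "('d::finite \<Rightarrow> nat) \<Rightarrow> 'd list" where
  "canon \<alpha> = concat (map (\<lambda>i. replicate (\<alpha> i) i) coords)"

lemma coords: "distinct (coords :: 'd::finite list)" "set (coords :: 'd list) = UNIV"
proof -
  have "\<exists>js :: 'd list. distinct js \<and> set js = UNIV" using finite_distinct_list[of "UNIV::'d set"] by auto
  from someI_ex[OF this] show "distinct (coords :: 'd::finite list)" "set (coords :: 'd list) = UNIV"
    by (auto simp: coords_def)
qed

lemma mderiv_eq_pd: "mderiv \<alpha> f = pd (canon \<alpha>) f"
proof -
  have r: "(partial_deriv i ^^ n) g = pd (replicate n i) g" for i n and g :: "real^'a \<Rightarrow> 'b"
    by (induction n) auto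
  have "foldr (\<lambda>i. partial_deriv i ^^ \<alpha> i) js f = pd (concat (map (\<lambda>i. replicate (\<alpha> i) i) js)) f" for js
    by (induction js) (auto simp: r pd_append)
  then show ?thesis by (simp add: mderiv_def canon_def)
qed

lemma length_canon: "length (canon \<alpha>) = mi_order \<alpha>"
proof -
  have "length (canon \<alpha>) = sum_list (map \<alpha> coords)" by (simp add: canon_def length_concat o_def)
  also have "\<dots> = sum \<alpha> (set coords)" by (simp add: coords sum_list_distinct_conv_sum_set)
  finally show ?thesis by (simp add: coords mi_order_def)
qed

lemma canon_perm: "mset js = mset (canon \<alpha>) \<longleftrightarrow> count (mset js) = \<alpha>"
proof -
  have "count (mset (canon \<alpha>)) = \<alpha>"
  proof (rule ext)
    fix i
    have "distinct is \<Longrightarrow> count (mset (concat (map (\<lambda>i. replicate (\<alpha> i) i) is))) i = (if i \<in> set is then \<alpha> i else 0)" for "is"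
      by (induction "is") auto
    from this[of coords] show "count (mset (canon \<alpha>)) i = \<alpha> i" by (simp add: canon_def coords)
  qed
  then show ?thesis by (metis multiset_eqI)
qed

lemma mset_canon: "mset (canon (count (mset js))) = mset js"
  using canon_perm by metis

text \<open>
  Boundedness is assumed for the derivatives in the order of \<open>coords\<close> only; by symmetry it holds for
  the derivatives in any order.
\<close>

lemma Cb_on_imp_Ckb:
  fixes A :: "real ^ 'd \<Rightarrow> real ^ 'n"
  assumes S: "open S" and A: "Cb_on m S A"
  shows "Ckb True m S (\<lambda>x. A x $ l)"
proof -
  have C: "Ck_on m S A" using A by (simp add: Cb_on_def)
  have Cl: "Ck_on m S (\<lambda>x. A x $ l)" using Ckb_nth[OF S, of False m A l] C by (simp add: Ckb_False)
  have "bounded (pd js (\<lambda>x. A x $ l) ` S)" if js: "length js \<le> m" for js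
  proof -
    let ?c = "canon (count (mset js))"
    have lc: "length ?c = length js" by (metis mset_canon size_mset)
    have Cj: "Ck_on (length js) S (\<lambda>x. A x $ l)" "Ck_on (length js) S A"
      using Cl C Ckb_mono[of False m] js unfolding Ckb_False by blast+
    have "pd js (\<lambda>x. A x $ l) x = mderiv (count (mset js)) A x $ l" if "x \<in> S" for x
      using pd_perm[OF S Cj(1) that mset_canon[symmetric]] pd_nth[OF S, of ?c A x l] Cj lc that
      by (simp add: mderiv_eq_pd)
    then have "pd js (\<lambda>x. A x $ l) ` S = (\<lambda>v. v $ l) ` (mderiv (count (mset js)) A ` S)"
      by (auto simp: image_iff)
    moreover have "bounded (mderiv (count (mset js)) A ` S)"
      using A js lc length_canon by (metis Cb_on_def)
    ultimately show ?thesis by (simp add: bounded_linear_image[OF _ bounded_linear_vec_nth])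
  qed
  then show ?thesis using Cl by (simp add: Ckb_True_iff)
qed

section \<open>The chain rule for iterated partial derivatives\<close>

definition smooth :: "(real ^ 'd \<Rightarrow> 'b::real_normed_vector) \<Rightarrow> bool" where
  "smooth F \<longleftrightarrow> (\<forall>k. Ck_on k UNIV F)"

lemma smooth_pd: "smooth F \<Longrightarrow> smooth (pd js F)"
  using Ckb_pd[of False js _ UNIV F] by (auto simp: smooth_def Ckb_False)

lemma smooth_partial_deriv: "smooth F \<Longrightarrow> smooth (partial_deriv i F)"
  using smooth_pd[of F "[i]"] by simp

lemma smooth_differentiable: "smooth F \<Longrightarrow> F differentiable (at x)"
  using smooth_def[of F] differentiable_on_open_at[of F UNIV x] by (metis Ck_on.simps(2) UNIV_I open_UNIV)

lemma smooth_continuous: "smooth F \<Longrightarrow> continuous_on S F"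
  using smooth_def[of F] by (metis Ck_on.simps(1) continuous_on_subset subset_UNIV)

lemma smooth_mult:
  fixes f g :: "real ^ 'd \<Rightarrow> real"
  shows "smooth f \<Longrightarrow> smooth g \<Longrightarrow> smooth (\<lambda>x. f x * g x)"
  using Ckb_mult[of UNIV False _ f g] by (auto simp: smooth_def Ckb_False)

lemma smooth_const: "smooth (\<lambda>x. c)"
  by (simp add: smooth_def flip: Ckb_False)

lemma pd_smooth_perm:
  fixes F :: "real ^ 'd \<Rightarrow> real"
  assumes "smooth F" "mset js = mset ks"
  shows "pd js F = pd ks F"
  using pd_perm[of UNIV js F _ ks] assms by (auto simp: smooth_def)

lemma partial_deriv_sum:
  assumes "\<And>a. a \<in> I \<Longrightarrow> f a differentiable at x"
  shows "partial_deriv i (\<lambda>x. \<Sum>a\<in>I. f a x) x = (\<Sum>a\<in>I. partial_deriv i (f a) x)"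
proof -
  have "((\<lambda>x. \<Sum>a\<in>I. f a x) has_derivative (\<lambda>h. \<Sum>a\<in>I. frechet_derivative (f a) (at x) h)) (at x)"
    using assms frechet_derivative_works by (intro has_derivative_sum) blast
  from partial_deriv_eq[OF this] show ?thesis by (simp add: partial_deriv_def)
qed

lemma partial_deriv_compose:
  fixes F :: "real ^ 'n \<Rightarrow> real" and A :: "real ^ 'd \<Rightarrow> real ^ 'n"
  assumes "A differentiable (at x)" "F differentiable (at (A x))"
  shows "(\<lambda>x. F (A x)) differentiable (at x)"
    "partial_deriv i (\<lambda>x. F (A x)) x = (\<Sum>l\<in>UNIV. partial_deriv i (\<lambda>x. A x $ l) x * partial_deriv l F (A x))"
proof -
  obtain A' where A': "(A has_derivative A') (at x)" using assms by (auto simp: differentiable_def)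
  have *: "((\<lambda>x. F (A x)) has_derivative (\<lambda>h. \<Sum>l\<in>UNIV. (A' h $ l) *\<^sub>R partial_deriv l F (A x))) (at x)"
    using diff_chain_at[OF A' has_derivative_partial_sum[OF assms(2)]] by (simp add: o_def)
  then show "(\<lambda>x. F (A x)) differentiable (at x)" by (auto simp: differentiable_def)
  have "partial_deriv i (\<lambda>x. A x $ l) x = A' (axis i 1) $ l" for l
    by (rule partial_deriv_eq) (rule bounded_linear.has_derivative[OF bounded_linear_vec_nth A'])
  then show "partial_deriv i (\<lambda>x. F (A x)) x = (\<Sum>l\<in>UNIV. partial_deriv i (\<lambda>x. A x $ l) x * partial_deriv l F (A x))"
    using partial_deriv_eq[OF *] by simp
qed

lemma Ck_on_compose:
  fixes F :: "real ^ 'n \<Rightarrow> real" and A :: "real ^ 'd \<Rightarrow> real ^ 'n"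
  assumes S: "open S" and dA: "A differentiable_on S" and A: "\<And>l. Ck_on k S (\<lambda>x. A x $ l)" and F: "smooth F"
  shows "Ck_on k S (\<lambda>x. F (A x))"
  using A F
proof (induction k arbitrary: F)
  case 0
  then show ?case using differentiable_imp_continuous_on[OF dA]
    by (auto intro!: continuous_on_compose2[OF smooth_continuous[of F UNIV]])
next
  case (Suc k)
  have d: "A differentiable (at x)" if "x \<in> S" for x using dA S that differentiable_on_open_at by blast
  have "Ck_on k S (partial_deriv i (\<lambda>x. F (A x)))" for i
    unfolding Ckb_False[symmetric]
  proof (rule Ckb_cong[OF S])
    show "Ckb False k S (\<lambda>x. \<Sum>l\<in>UNIV. partial_deriv i (\<lambda>x. A x $ l) x * partial_deriv l F (A x))"
    proof (intro Ckb_sum S Ckb_mult)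
      fix l
      show "Ckb False k S (partial_deriv i (\<lambda>x. A x $ l))" using Suc.prems by (auto simp: Ckb_False)
      have "Ck_on k S (\<lambda>x. A x $ l)" for l using Suc.prems(1) Ck_on_SucD by blast
      then show "Ckb False k S (\<lambda>x. partial_deriv l F (A x))"
        unfolding Ckb_False using Suc.IH[of "partial_deriv l F"] Suc.prems(2) smooth_partial_deriv by blast
    qed
  qed (use d smooth_differentiable[OF Suc.prems(2)] in \<open>auto intro!: partial_deriv_compose(2)[symmetric]\<close>)
  moreover have "(\<lambda>x. F (A x)) differentiable_on S"
    unfolding differentiable_on_def
    using partial_deriv_compose(1)[OF d smooth_differentiable[OF Suc.prems(2)]] differentiable_at_withinI by blast
  ultimately show ?case by simp
qed

abbreviation lists_upto :: "nat \<Rightarrow> 'd::finite list set" where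
  "lists_upto n \<equiv> {is. length is \<le> n}"

lemma finite_lists_upto [simp]: "finite (lists_upto n :: 'd::finite list set)"
  using finite_lists_length_le[of "UNIV :: 'd set" n] by simp

lemma sum_lists_upto_Suc:
  fixes h :: "'d::finite list \<Rightarrow> 'b::comm_monoid_add"
  shows "(\<Sum>is\<in>lists_upto (Suc n). h is) = h [] + (\<Sum>is\<in>lists_upto n. \<Sum>l\<in>UNIV. h (l # is))"
proof -
  have eq: "lists_upto (Suc n) = insert [] ((\<lambda>(is, l). l # is) ` (lists_upto n \<times> (UNIV :: 'd set)))"
  proof (intro set_eqI)
    fix "is" :: "'d list"
    show "is \<in> lists_upto (Suc n) \<longleftrightarrow> is \<in> insert [] ((\<lambda>(is, l). l # is) ` (lists_upto n \<times> UNIV))"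
      by (cases "is") auto
  qed
  have inj: "inj_on (\<lambda>(is, l). l # is) (lists_upto n \<times> (UNIV :: 'd set))" by (auto simp: inj_on_def)
  have "(\<Sum>is\<in>lists_upto (Suc n). h is) = h [] + sum h ((\<lambda>(is, l). l # is) ` (lists_upto n \<times> (UNIV :: 'd set)))"
    unfolding eq by (rule sum.insert) auto
  also have "sum h ((\<lambda>(is, l). l # is) ` (lists_upto n \<times> (UNIV :: 'd set))) = (\<Sum>is\<in>lists_upto n. \<Sum>l\<in>UNIV. h (l # is))"
    unfolding sum.reindex[OF inj] sum.cartesian_product by (simp add: o_def split_def)
  finally show ?thesis .
qed

text \<open>
  The coefficients \<open>P\<close> depend on \<open>A\<close> but not on \<open>F\<close>, so that the formula survives a limit in \<open>F\<close>. They are of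
  class \<open>C\<^sub>b\<close> of the remaining order because they are built from derivatives of \<open>A\<close> of order at most \<open>length js\<close>.
\<close>

lemma chain_rule_pd:
  fixes A :: "real ^ 'd \<Rightarrow> real ^ 'n"
  assumes S: "open S" and dA: "A differentiable_on S" and A: "\<And>l. Ckb True m S (\<lambda>x. A x $ l)"
    and "length js \<le> m"
  shows "\<exists>P. (\<forall>is \<in> lists_upto (length js). Ckb True (m - length js) S (P is)) \<and>
     (\<forall>F :: real ^ 'n \<Rightarrow> real. smooth F \<longrightarrow> (\<forall>x\<in>S. pd js (\<lambda>x. F (A x)) x = (\<Sum>is\<in>lists_upto (length js). P is x * pd is F (A x))))"
  using assms(4)
proof (induction js)
  case Nil
  have "lists_upto 0 = {[] :: 'n list}" by auto
  then show ?case by (intro exI[of _ "\<lambda>_ _. 1"]) simp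
next
  case (Cons i js)
  define n where "n = length js"
  define k where "k = m - Suc n"
  have k: "m - length js = Suc k" "Suc k \<le> m" using Cons.prems by (auto simp: k_def n_def)
  obtain P where P: "\<And>is. length is \<le> n \<Longrightarrow> Ckb True (Suc k) S (P is)"
    and PF: "\<And>(F :: real ^ 'n \<Rightarrow> real) x. smooth F \<Longrightarrow> x \<in> S \<Longrightarrow> pd js (\<lambda>x. F (A x)) x = (\<Sum>is\<in>lists_upto n. P is x * pd is F (A x))"
  proof -
    have "length js \<le> m" using Cons.prems by simp
    from Cons.IH[OF this] obtain P
      where "\<forall>is\<in>lists_upto (length js). Ckb True (m - length js) S (P is)"
        "\<forall>F :: real ^ 'n \<Rightarrow> real. smooth F \<longrightarrow> (\<forall>x\<in>S. pd js (\<lambda>x. F (A x)) x = (\<Sum>is\<in>lists_upto (length js). P is x * pd is F (A x)))"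
      by (elim exE conjE)
    then show ?thesis by (intro that[of P]) (simp_all only: k(1) n_def mem_Collect_eq)
  qed
  \<comment> \<open>padded by zero, so that the terms \<open>Q\<close> can be summed over all lists of length at most \<open>Suc n\<close>\<close>
  define Q where "Q is = (if length is \<le> n then partial_deriv i (P is) else (\<lambda>x. 0))" for "is"
  \<comment> \<open>in \<open>\<partial>\<^sub>i (P \<cdot> (D F \<circ> A))\<close> the derivative falls on \<open>P\<close> (term \<open>Q\<close>) or, through \<open>A\<^sub>l\<close>, on \<open>D F\<close>, which prepends \<open>l\<close> to the list\<close>
  define P' where "P' is = (case is of [] \<Rightarrow> Q [] | l # ls \<Rightarrow> (\<lambda>x. Q (l # ls) x + P ls x * partial_deriv i (\<lambda>x. A x $ l) x))" for "is"
  have Q: "Ckb True k S (Q is)" for "is" using P[of "is"] by (auto simp: Q_def)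
  have dAl: "Ckb True k S (partial_deriv i (\<lambda>x. A x $ l))" for l
    using Ckb_mono[OF A k(2)] by simp
  have "Ckb True k S (P' is)" if "length is \<le> Suc n" for "is"
  proof (cases "is")
    case (Cons l ls)
    then have "Ckb True k S (P ls)" using P[of ls, THEN Ckb_SucD] that by auto
    then show ?thesis using Cons by (auto simp: P'_def intro!: Ckb_add Ckb_mult S Q dAl)
  qed (auto simp: P'_def Q)
  moreover have "pd (i # js) (\<lambda>x. F (A x)) x = (\<Sum>is\<in>lists_upto (Suc n). P' is x * pd is F (A x))"
    if F: "smooth F" and x: "x \<in> S" for F :: "real ^ 'n \<Rightarrow> real" and x
  proof -
    have d: "A differentiable (at x)" using dA S x differentiable_on_open_at by blast
    have dF: "pd is F differentiable (at (A x))" for "is" using F smooth_pd smooth_differentiable by blast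
    have dP: "P is differentiable (at x)" if "length is \<le> n" for "is"
      using P[OF that] S x by (auto intro: differentiable_on_open_at)
    have "pd (i # js) (\<lambda>x. F (A x)) x = partial_deriv i (\<lambda>x. \<Sum>is\<in>lists_upto n. P is x * pd is F (A x)) x"
      using partial_deriv_cong_open[OF S x, of "pd js (\<lambda>x. F (A x))"] PF[OF F] by simp
    also have "\<dots> = (\<Sum>is\<in>lists_upto n. partial_deriv i (\<lambda>x. P is x * pd is F (A x)) x)"
      by (intro partial_deriv_sum) (auto intro!: differentiable_mult dP partial_deriv_compose(1)[OF d dF])
    also have "\<dots> = (\<Sum>is\<in>lists_upto n. P is x * (\<Sum>l\<in>UNIV. partial_deriv i (\<lambda>x. A x $ l) x * pd (l # is) F (A x))
         + partial_deriv i (P is) x * pd is F (A x))"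
      by (intro sum.cong refl, subst partial_deriv_mult)
        (auto intro!: dP partial_deriv_compose(1)[OF d dF] simp: partial_deriv_compose(2)[OF d dF])
    also have "\<dots> = (\<Sum>is\<in>lists_upto n. \<Sum>l\<in>UNIV. P is x * partial_deriv i (\<lambda>x. A x $ l) x * pd (l # is) F (A x))
         + (\<Sum>is\<in>lists_upto n. Q is x * pd is F (A x))"
      by (auto simp: sum.distrib sum_distrib_left mult.assoc Q_def intro!: sum.cong)
    also have "(\<Sum>is\<in>lists_upto n. Q is x * pd is F (A x)) = (\<Sum>is\<in>lists_upto (Suc n). Q is x * pd is F (A x))"
      by (rule sum.mono_neutral_left) (auto simp: Q_def)
    also have "\<dots> = Q [] x * pd [] F (A x) + (\<Sum>is\<in>lists_upto n. \<Sum>l\<in>UNIV. Q (l # is) x * pd (l # is) F (A x))"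
      by (rule sum_lists_upto_Suc)
    also have "(\<Sum>is\<in>lists_upto n. \<Sum>l\<in>UNIV. P is x * partial_deriv i (\<lambda>x. A x $ l) x * pd (l # is) F (A x)) + \<dots>
       = P' [] x * pd [] F (A x) + (\<Sum>is\<in>lists_upto n. \<Sum>l\<in>UNIV. P' (l # is) x * pd (l # is) F (A x))"
      by (simp add: P'_def algebra_simps sum.distrib)
    also have "\<dots> = (\<Sum>is\<in>lists_upto (Suc n). P' is x * pd is F (A x))"
      by (rule sum_lists_upto_Suc[symmetric])
    finally show ?thesis .
  qed
  ultimately show ?case by (intro exI[of _ P']) (simp add: n_def k_def)
qed

section \<open>Smooth bump functions\<close>

text \<open>
  The functions \<open>p(1/t) exp(-1/t)\<close>, continued by zero for \<open>t \<le> 0\<close>. The family is closed under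
  differentiation, so each member is smooth.
\<close>

definition flat_exp :: "real poly \<Rightarrow> real \<Rightarrow> real" where
  "flat_exp p t = (if t > 0 then poly p (1 / t) * exp (- (1 / t)) else 0)"

lemma poly_times_exp_minus: "((\<lambda>x::real. poly p x * exp (- x)) \<longlongrightarrow> 0) at_top"
proof -
  have "((\<lambda>x::real. \<Sum>i\<le>degree p. coeff p i * (x ^ i / exp x)) \<longlongrightarrow> (\<Sum>i\<le>degree p. coeff p i * 0)) at_top"
    by (intro tendsto_intros tendsto_power_div_exp_0)
  then show ?thesis by (simp add: poly_altdef exp_minus divide_inverse sum_distrib_right mult.assoc)
qed

lemma flat_exp_deriv:
  "(flat_exp p has_real_derivative flat_exp ([:0, 0, 1:] * (p - pderiv p)) t) (at t)"
proof -
  consider "t > 0" | "t < 0" | "t = 0" by linarith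
  then show ?thesis
  proof cases
    case 1
    have "((\<lambda>t. poly p (1 / t) * exp (- (1 / t))) has_real_derivative
        flat_exp ([:0, 0, 1:] * (p - pderiv p)) t) (at t)"
      using 1 by (auto intro!: derivative_eq_intros DERIV_chain2[OF poly_DERIV] simp: flat_exp_def field_simps power2_eq_square)
    then show ?thesis
      by (rule has_field_derivative_transform_within_open[where S = "{0<..}"]) (use 1 in \<open>auto simp: flat_exp_def\<close>)
  next
    case 2
    have "((\<lambda>t. 0) has_real_derivative flat_exp ([:0, 0, 1:] * (p - pderiv p)) t) (at t)"
      using 2 by (auto simp: flat_exp_def)
    then show ?thesis
      by (rule has_field_derivative_transform_within_open[where S = "{..<0}"]) (use 2 in \<open>auto simp: flat_exp_def\<close>)
  next
    case 3
    \<comment> \<open>with \<open>s = 1/h\<close> the difference quotient is \<open>s p(s) exp(-s)\<close>\<close>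
    have "((\<lambda>h. (flat_exp p (0 + h) - flat_exp p 0) / h) \<longlongrightarrow> 0) (at_right 0)"
    proof -
      have "((\<lambda>x. poly (pCons 0 p) x * exp (- x)) \<longlongrightarrow> 0) at_top" by (rule poly_times_exp_minus)
      moreover have "\<forall>\<^sub>F x in at_top. poly (pCons 0 p) x * exp (- x) = (flat_exp p (0 + inverse x) - flat_exp p 0) / inverse x"
        using eventually_gt_at_top[of "0::real"] by eventually_elim (auto simp: flat_exp_def field_simps)
      ultimately show ?thesis
        unfolding filterlim_at_right_to_top by (rule Lim_transform_eventually)
    qed
    moreover have "((\<lambda>h. (flat_exp p (0 + h) - flat_exp p 0) / h) \<longlongrightarrow> 0) (at_left 0)"
      by (rule tendsto_eventually) (auto simp: flat_exp_def eventually_at_filter)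
    ultimately have "((\<lambda>h. (flat_exp p (0 + h) - flat_exp p 0) / h) \<longlongrightarrow> 0) (at 0)"
      by (rule filterlim_split_at[rotated])
    then show ?thesis using 3 by (simp add: DERIV_def flat_exp_def)
  qed
qed

lemma smooth_nth: "smooth (\<lambda>x :: real ^ 'd. x $ j)"
proof -
  have "(\<lambda>x :: real ^ 'd. x $ j) differentiable_on UNIV"
    by (auto simp: differentiable_on_def intro!: bounded_linear_imp_differentiable bounded_linear_vec_nth)
  moreover have "partial_deriv i (\<lambda>x :: real ^ 'd. x $ j) = (\<lambda>x. axis i 1 $ j)" for i
    by (rule ext, rule partial_deriv_eq) (auto intro!: bounded_linear_imp_has_derivative bounded_linear_vec_nth)
  ultimately have "Ck_on (Suc k) UNIV (\<lambda>x :: real ^ 'd. x $ j)" for k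
    by (simp flip: Ckb_False)
  then show ?thesis using Ck_on_SucD unfolding smooth_def by blast
qed

lemma flat_exp_radial_deriv:
  fixes x :: "real ^ 'd"
  shows "((\<lambda>x. flat_exp p (c - x \<bullet> x)) has_derivative
     (\<lambda>h. flat_exp ([:0, 0, 1:] * (p - pderiv p)) (c - x \<bullet> x) * (- 2 * (x \<bullet> h)))) (at x)"
proof -
  have "((\<lambda>x. c - x \<bullet> x) has_derivative (\<lambda>h. - 2 * (x \<bullet> h))) (at x)"
    by (auto intro!: derivative_eq_intros simp: inner_commute)
  from diff_chain_at[OF this flat_exp_deriv[unfolded has_field_derivative_def]]
  show ?thesis by (simp add: o_def)
qed

text \<open>
  The partial derivative in direction \<open>i\<close> is again a function of this form times \<open>- 2 x\<^sub>i\<close>.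
\<close>

lemma smooth_flat_exp_radial: "smooth (\<lambda>x :: real ^ 'd. flat_exp p (c - x \<bullet> x))"
proof -
  have d: "(\<lambda>x :: real ^ 'd. flat_exp p (c - x \<bullet> x)) differentiable_on S" for S p
    unfolding differentiable_on_def using flat_exp_radial_deriv differentiable_at_withinI differentiable_def by blast
  have "Ckb False k UNIV (\<lambda>x :: real ^ 'd. flat_exp p (c - x \<bullet> x))" for k
  proof (induction k arbitrary: p)
    case 0
    then show ?case using differentiable_imp_continuous_on[OF d] by simp
  next
    case (Suc k)
    have eq: "partial_deriv i (\<lambda>x :: real ^ 'd. flat_exp p (c - x \<bullet> x)) =
        (\<lambda>x. flat_exp ([:0, 0, 1:] * (p - pderiv p)) (c - x \<bullet> x) * (- 2 * (x $ i)))" for i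
      by (rule ext, subst partial_deriv_eq[OF flat_exp_radial_deriv]) (simp add: inner_axis)
    have "Ckb False k UNIV (\<lambda>x :: real ^ 'd. x $ i)" for i
      using smooth_nth[of i] by (simp add: smooth_def Ckb_False)
    then have "Ckb False k UNIV (partial_deriv i (\<lambda>x :: real ^ 'd. flat_exp p (c - x \<bullet> x)))" for i
      unfolding eq by (intro Ckb_mult Suc Ckb_const) auto
    then show ?case using d by simp
  qed
  then show ?thesis by (simp add: smooth_def Ckb_False)
qed

text \<open>
  The radial function \<open>exp(-1 / (e\<^sup>2 - |x|\<^sup>2))\<close>, divided by its integral.
\<close>

lemma mollifier_exists:
  assumes "e > 0"
  shows "\<exists>\<eta> :: real ^ 'd \<Rightarrow> real. smooth \<eta> \<and> (\<forall>x. 0 \<le> \<eta> x) \<and> (\<forall>x. e \<le> norm x \<longrightarrow> \<eta> x = 0) \<and>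
     integrable lborel \<eta> \<and> integral\<^sup>L lborel \<eta> = 1"
proof -
  let ?u = "\<lambda>x :: real ^ 'd. flat_exp 1 (e\<^sup>2 - x \<bullet> x)"
  have s: "smooth ?u" by (rule smooth_flat_exp_radial)
  have nn: "0 \<le> ?u x" for x by (simp add: flat_exp_def)
  have z: "?u x = 0" if "e \<le> norm x" for x
    using power_mono[OF that less_imp_le[OF assms], of 2] unfolding flat_exp_def power2_norm_eq_inner[symmetric] by auto
  have pos: "?u x > 0" if "norm x < e" for x
    using that assms by (simp add: flat_exp_def power2_norm_eq_inner[symmetric] power_strict_mono)
  have "integrable lborel (\<lambda>x. indicator (cball 0 e) x *\<^sub>R ?u x)"
    by (rule borel_integrable_compact) (auto intro: smooth_continuous[OF s])
  moreover have "(\<lambda>x. indicator (cball 0 e) x *\<^sub>R ?u x) = ?u" 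
    using z by (auto simp: indicator_def fun_eq_iff)
  ultimately have int: "integrable lborel ?u" by simp
  have "integral\<^sup>L lborel ?u \<noteq> 0"
  proof
    assume "integral\<^sup>L lborel ?u = 0"
    then have "AE x in lborel. ?u x = 0" using integral_nonneg_eq_0_iff_AE[OF int] nn by simp
    then have "AE x in lborel. x \<notin> ball (0 :: real ^ 'd) e" using pos by (auto simp: less_le)
    then have "emeasure lborel (ball (0 :: real ^ 'd) e) = 0"
      by (subst (asm) AE_iff_measurable[of "ball 0 e"]) auto
    then show False using assms unit_ball_vol_pos[of "real CARD('d)"] by (simp add: emeasure_ball)
  qed
  moreover have "integral\<^sup>L lborel ?u \<ge> 0" using nn by simp
  ultimately have c: "integral\<^sup>L lborel ?u > 0" by simp
  let ?c = "integral\<^sup>L lborel ?u"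
  show ?thesis
  proof (intro exI[of _ "\<lambda>x. inverse ?c * ?u x"] conjI allI impI)
    show "smooth (\<lambda>x. inverse ?c * ?u x)" by (intro smooth_mult smooth_const s)
  qed (use c nn z int in auto)
qed

section \<open>Translation and reflection invariance\<close>

lemma distr_lborel_shift: "distr lborel borel (\<lambda>x. x + c) = (lborel :: 'a::euclidean_space measure)"
proof -
  have "(\<lambda>x. x + c) = (+) c" by (auto simp: add.commute)
  then show ?thesis using lborel_distr_plus[of c] by simp
qed

lemma distr_lborel_reflect:
  fixes c :: "'a::euclidean_space"
  shows "distr lborel borel (\<lambda>x. c - x) = lborel"
  using lborel_affine[of "-1" c] by (simp add: density_1)

lemma nn_integral_lborel_shift:
  fixes f :: "'a::euclidean_space \<Rightarrow> ennreal"
  assumes [measurable]: "f \<in> borel_measurable borel"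
  shows "(\<integral>\<^sup>+ x. f (x + c) \<partial>lborel) = (\<integral>\<^sup>+ x. f x \<partial>lborel)"
proof -
  have "(\<integral>\<^sup>+ x. f x \<partial>lborel) = (\<integral>\<^sup>+ x. f x \<partial>distr lborel borel (\<lambda>x. x + c))"
    by (simp add: distr_lborel_shift)
  also have "\<dots> = (\<integral>\<^sup>+ x. f (x + c) \<partial>lborel)" by (rule nn_integral_distr) auto
  finally show ?thesis by simp
qed

lemma nn_integral_lborel_reflect:
  fixes f :: "'a::euclidean_space \<Rightarrow> ennreal"
  assumes [measurable]: "f \<in> borel_measurable borel"
  shows "(\<integral>\<^sup>+ x. f (c - x) \<partial>lborel) = (\<integral>\<^sup>+ x. f x \<partial>lborel)"
proof -
  have "(\<integral>\<^sup>+ x. f x \<partial>lborel) = (\<integral>\<^sup>+ x. f x \<partial>distr lborel borel (\<lambda>x. c - x))"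
    by (simp add: distr_lborel_reflect)
  also have "\<dots> = (\<integral>\<^sup>+ x. f (c - x) \<partial>lborel)" by (rule nn_integral_distr) auto
  finally show ?thesis by simp
qed

lemma integral_lborel_shift:
  fixes f :: "'a::euclidean_space \<Rightarrow> real"
  assumes [measurable]: "f \<in> borel_measurable borel"
  shows "(\<integral>x. f (x + c) \<partial>lborel) = (\<integral>x. f x \<partial>lborel)"
proof -
  have "(\<integral>x. f x \<partial>lborel) = (\<integral>x. f x \<partial>distr lborel borel (\<lambda>x. x + c))"
    by (simp add: distr_lborel_shift)
  also have "\<dots> = (\<integral>x. f (x + c) \<partial>lborel)" by (rule integral_distr) auto
  finally show ?thesis by simp
qed

lemma integral_lborel_reflect:
  fixes f :: "'a::euclidean_space \<Rightarrow> real"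
  assumes [measurable]: "f \<in> borel_measurable borel"
  shows "(\<integral>x. f (c - x) \<partial>lborel) = (\<integral>x. f x \<partial>lborel)"
proof -
  have "(\<integral>x. f x \<partial>lborel) = (\<integral>x. f x \<partial>distr lborel borel (\<lambda>x. c - x))"
    by (simp add: distr_lborel_reflect)
  also have "\<dots> = (\<integral>x. f (c - x) \<partial>lborel)" by (rule integral_distr) auto
  finally show ?thesis by simp
qed

lemma integrable_lborel_shift:
  fixes f :: "'a::euclidean_space \<Rightarrow> real"
  assumes "integrable lborel f"
  shows "integrable lborel (\<lambda>x. f (x + c))"
proof -
  have "integrable (distr lborel borel (\<lambda>x. x + c)) f" using assms by (simp add: distr_lborel_shift)
  then show ?thesis by (subst (asm) integrable_distr_eq) (use assms in auto)
qed

section \<open>Integration by parts\<close>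

lemma integrable_compact_support:
  fixes w :: "'a::euclidean_space \<Rightarrow> real"
  assumes "continuous_on UNIV w" "compact K" "\<And>x. x \<notin> K \<Longrightarrow> w x = 0"
  shows "integrable lborel w"
proof -
  have "integrable lborel (\<lambda>x. indicator K x *\<^sub>R w x)"
    by (rule borel_integrable_compact[OF assms(2)]) (use assms continuous_on_subset in blast)
  moreover have "(\<lambda>x. indicator K x *\<^sub>R w x) = w" using assms(3) by (auto simp: indicator_def fun_eq_iff)
  ultimately show ?thesis by simp
qed

lemma bounded_compact_support:
  fixes w :: "'a::euclidean_space \<Rightarrow> real"
  assumes "continuous_on UNIV w" "compact K" "\<And>x. x \<notin> K \<Longrightarrow> w x = 0"
  obtains B where "B \<ge> 0" "\<And>x. \<bar>w x\<bar> \<le> B"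
proof -
  have "compact (w ` K)" using assms compact_continuous_image continuous_on_subset by blast
  then obtain B where "B > 0" "\<And>x. x \<in> K \<Longrightarrow> \<bar>w x\<bar> \<le> B"
    using compact_imp_bounded bounded_pos by (metis imageI real_norm_def)
  then show ?thesis using that[of B] assms(3) by (metis abs_zero less_imp_le)
qed

text \<open>
  Difference quotients of \<open>u\<close> integrate to zero by translation invariance, and they converge to the
  partial derivative under a common bound.
\<close>

lemma integral_partial_deriv_zero:
  fixes u :: "real ^ 'd \<Rightarrow> real"
  assumes d: "\<And>x. u differentiable (at x)" and c: "continuous_on UNIV (partial_deriv i u)"
    and K: "compact K" and z: "\<And>x. x \<notin> K \<Longrightarrow> u x = 0"
  shows "integrable lborel (partial_deriv i u)" "integral\<^sup>L lborel (partial_deriv i u) = 0"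
proof -
  let ?v = "partial_deriv i u"
  have cu: "continuous_on UNIV u"
    using d by (simp add: differentiable_imp_continuous_within continuous_at_imp_continuous_on)
  have zv: "?v x = 0" if "x \<notin> K" for x
  proof -
    have "?v x = partial_deriv i (\<lambda>x. 0) x"
      using that K z by (intro partial_deriv_cong_open[of "- K"]) (auto intro: compact_imp_closed)
    then show ?thesis by (simp add: partial_deriv_eq[OF has_derivative_const])
  qed
  show "integrable lborel ?v" by (rule integrable_compact_support[OF c K zv])
  obtain B where B: "B \<ge> 0" "\<And>x. \<bar>?v x\<bar> \<le> B" using bounded_compact_support[OF c K zv] by metis
  define h where "h n = 1 / (real n + 1)" for n
  have h: "0 < h n" "h n \<le> 1" for n by (auto simp: h_def)
  let ?D = "\<lambda>n x. (u (x + h n *\<^sub>R axis i 1) - u x) / h n"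
  \<comment> \<open>all difference quotients vanish outside \<open>K'\<close> because \<open>h n \<le> 1\<close>\<close>
  define K' where "K' = {x + y |x y. x \<in> K \<and> y \<in> cball 0 1}"
  have K': "compact K'" unfolding K'_def by (rule compact_sums[OF K compact_cball])
  have "K \<subseteq> K'" unfolding K'_def by force
  have iu: "integrable lborel u" by (rule integrable_compact_support[OF cu K z])
  have mu: "u \<in> borel_measurable borel" using cu by (rule borel_measurable_continuous_onI)
  have "(\<lambda>n. integral\<^sup>L lborel (?D n)) \<longlonglongrightarrow> integral\<^sup>L lborel ?v"
  proof (rule integral_dominated_convergence[where w = "\<lambda>x. B * indicator K' x"])
    show "?v \<in> borel_measurable lborel" using borel_measurable_continuous_onI[OF c] by simp
    show "?D n \<in> borel_measurable lborel" for n using mu by measurable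
    have "emeasure lborel K' < \<infinity>" using K' emeasure_lborel_cbox_finite emeasure_compact_finite by blast
    then show "integrable lborel (\<lambda>x. B * indicator K' x)"
      using K' by (intro integrable_mult_right integrable_real_indicator) (auto intro: borel_compact)
    show "AE x in lborel. (\<lambda>n. ?D n x) \<longlonglongrightarrow> ?v x"
    proof (rule AE_I2)
      fix x
      have "((\<lambda>t. u (x + t *\<^sub>R axis i 1)) has_real_derivative ?v (x + 0 *\<^sub>R axis i 1)) (at 0)"
        by (rule line_deriv) (use d in simp)
      then have l: "(\<lambda>h. (u (x + h *\<^sub>R axis i 1) - u x) / h) \<midarrow>0\<rightarrow> ?v x" by (simp add: DERIV_def)
      have "h \<longlonglongrightarrow> 0" unfolding h_def by real_asymp
      then have "filterlim h (at 0) sequentially" using h(1) by (auto simp: filterlim_at less_imp_neq[symmetric])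
      then show "(\<lambda>n. ?D n x) \<longlonglongrightarrow> ?v x" by (rule filterlim_compose[OF l])
    qed
    show "AE x in lborel. norm (?D n x) \<le> B * indicator K' x" for n
    proof (rule AE_I2)
      fix x
      show "norm (?D n x) \<le> B * indicator K' x"
      proof (cases "x \<in> K'")
        case True
        have "\<exists>t. 0 < t \<and> t < h n \<and> u (x + h n *\<^sub>R axis i 1) - u (x + 0 *\<^sub>R axis i 1) = (h n - 0) * ?v (x + t *\<^sub>R axis i 1)"
          by (rule MVT2[OF h(1)], rule line_deriv, rule d)
        then show ?thesis using B(2) h(1)[of n] True by (auto simp: abs_mult)
      next
        case False
        have "x + h n *\<^sub>R axis i 1 \<notin> K"
        proof
          assume "x + h n *\<^sub>R axis i 1 \<in> K"
          moreover have "- (h n *\<^sub>R axis i 1) \<in> cball (0 :: real ^ 'd) 1" using h[of n] by (simp add: norm_axis_1)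
          ultimately have "(x + h n *\<^sub>R axis i 1) + - (h n *\<^sub>R axis i 1) \<in> K'" unfolding K'_def by blast
          then show False using False by simp
        qed
        then show ?thesis using False \<open>K \<subseteq> K'\<close> z by auto
      qed
    qed
  qed
  moreover have "integral\<^sup>L lborel (?D n) = 0" for n
    using integral_lborel_shift[OF mu, of "h n *\<^sub>R axis i 1"] iu integrable_lborel_shift[OF iu, of "h n *\<^sub>R axis i 1"] by simp
  ultimately have "(\<lambda>n::nat. 0) \<longlonglongrightarrow> integral\<^sup>L lborel ?v" by (simp only:)
  then show "integral\<^sup>L lborel ?v = 0" using LIMSEQ_unique[OF tendsto_const] by metis
qed

text \<open>
  Converts integrals over \<open>\<Omega>\<close> of compactly supported functions into integrals over the whole space.
\<close>

lemma zero_extension: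
  fixes w :: "real ^ 'd \<Rightarrow> real"
  assumes S: "open \<Omega>" and c: "continuous_on \<Omega> w" and K: "compact K" "K \<subseteq> \<Omega>" and z: "\<And>x. x \<in> \<Omega> \<Longrightarrow> x \<notin> K \<Longrightarrow> w x = 0"
  shows "continuous_on UNIV (\<lambda>x. if x \<in> \<Omega> then w x else 0)" (is "continuous_on _ ?w")
    "integrable lborel (\<lambda>x. if x \<in> \<Omega> then w x else 0)"
    "(LINT x|lebesgue_on \<Omega>. w x) = (\<integral>x. (if x \<in> \<Omega> then w x else 0) \<partial>lborel)"
    "integrable (lebesgue_on \<Omega>) w"
proof -
  have "continuous_on \<Omega> ?w" using c by (rule continuous_on_eq) auto
  moreover have "continuous_on (- K) ?w"
    by (rule continuous_on_eq[of _ "\<lambda>x. 0"]) (use z in auto)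
  moreover have "\<Omega> \<union> - K = UNIV" using K by auto
  ultimately show cw: "continuous_on UNIV ?w"
    using continuous_on_open_Un[OF S, of "- K" ?w] K compact_imp_closed by (metis open_Compl)
  show int: "integrable lborel ?w" by (rule integrable_compact_support[OF cw K(1)]) (use z in auto)
  have eq: "(\<lambda>x. indicator \<Omega> x *\<^sub>R w x) = ?w" by (auto simp: indicator_def)
  have m: "?w \<in> borel_measurable lborel" using borel_measurable_continuous_onI[OF cw] by simp
  have "(LINT x|lebesgue_on \<Omega>. w x) = integral\<^sup>L lebesgue ?w"
    using S unfolding eq[symmetric] by (subst integral_restrict_space) auto
  then show "(LINT x|lebesgue_on \<Omega>. w x) = integral\<^sup>L lborel ?w"
    using integral_completion[OF m] by simp
  show "integrable (lebesgue_on \<Omega>) w"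
  proof -
    have "integrable lebesgue (\<lambda>x. indicator \<Omega> x *\<^sub>R w x)"
      unfolding eq using int m by (simp add: integrable_completion)
    then show ?thesis using S by (subst integrable_restrict_space) auto
  qed
qed

lemma test_functions_iff:
  "\<phi> \<in> test_functions \<Omega> \<longleftrightarrow> smooth \<phi> \<and> (\<exists>K. compact K \<and> K \<subseteq> \<Omega> \<and> (\<forall>x. x \<notin> K \<longrightarrow> \<phi> x = 0))"
proof
  assume "\<phi> \<in> test_functions \<Omega>"
  then show "smooth \<phi> \<and> (\<exists>K. compact K \<and> K \<subseteq> \<Omega> \<and> (\<forall>x. x \<notin> K \<longrightarrow> \<phi> x = 0))"
    unfolding test_functions_def smooth_def using closure_subset[of "{x. \<phi> x \<noteq> 0}"]
    by (intro conjI exI[of _ "closure {x. \<phi> x \<noteq> 0}"]) auto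
next
  assume "smooth \<phi> \<and> (\<exists>K. compact K \<and> K \<subseteq> \<Omega> \<and> (\<forall>x. x \<notin> K \<longrightarrow> \<phi> x = 0))"
  then obtain K where K: "compact K" "K \<subseteq> \<Omega>" "\<And>x. x \<notin> K \<Longrightarrow> \<phi> x = 0" and s: "smooth \<phi>" by blast
  have "closure {x. \<phi> x \<noteq> 0} \<subseteq> K" using K compact_imp_closed by (intro closure_minimal) auto
  then show "\<phi> \<in> test_functions \<Omega>"
    using K s compact_Int_closed[of K "closure {x. \<phi> x \<noteq> 0}"]
    by (auto simp: test_functions_def smooth_def Int_absorb1)
qed

lemma pd_zero_outside:
  fixes f :: "real ^ 'd \<Rightarrow> real"
  assumes "closed K" "\<And>x. x \<notin> K \<Longrightarrow> f x = 0" "x \<notin> K"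
  shows "pd js f x = 0"
proof -
  have "pd js (\<lambda>x. 0 :: real) = (\<lambda>x :: real ^ 'd. 0)"
    by (induction js) (auto simp: partial_deriv_eq[OF has_derivative_const])
  moreover have "pd js f x = pd js (\<lambda>x. 0) x"
    using assms by (intro pd_cong_open[of "- K"]) auto
  ultimately show ?thesis by simp
qed

lemma test_functions_pd:
  assumes "\<phi> \<in> test_functions \<Omega>"
  shows "pd js \<phi> \<in> test_functions \<Omega>"
  using assms unfolding test_functions_iff by (metis compact_imp_closed pd_zero_outside smooth_pd)

lemma integration_by_parts:
  fixes G :: "real ^ 'd \<Rightarrow> real"
  assumes S: "open \<Omega>" and G: "Ck_on 1 \<Omega> G" and \<psi>: "\<psi> \<in> test_functions \<Omega>"
  shows "(LINT x|lebesgue_on \<Omega>. G x * partial_deriv i \<psi> x) = - (LINT x|lebesgue_on \<Omega>. partial_deriv i G x * \<psi> x)"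
proof -
  obtain K where K: "compact K" "K \<subseteq> \<Omega>" "\<And>x. x \<notin> K \<Longrightarrow> \<psi> x = 0" and s: "smooth \<psi>"
    using \<psi> unfolding test_functions_iff by blast
  have zp: "partial_deriv i \<psi> x = 0" if "x \<notin> K" for x
    using pd_zero_outside[of K \<psi> x "[i]"] K that compact_imp_closed by auto
  have cG: "continuous_on \<Omega> G" "continuous_on \<Omega> (partial_deriv i G)"
    using G by (auto simp: differentiable_imp_continuous_on)
  have c: "continuous_on \<Omega> \<psi>" "continuous_on \<Omega> (partial_deriv i \<psi>)"
    using s smooth_continuous smooth_partial_deriv by blast+
  define a where "a x = (if x \<in> \<Omega> then G x * partial_deriv i \<psi> x else 0)" for x
  define b where "b x = (if x \<in> \<Omega> then partial_deriv i G x * \<psi> x else 0)" for x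
  have a: "continuous_on UNIV a" "integrable lborel a" "(LINT x|lebesgue_on \<Omega>. G x * partial_deriv i \<psi> x) = integral\<^sup>L lborel a"
    unfolding a_def by (rule zero_extension[OF S _ K(1,2)], (intro continuous_intros cG c | simp add: zp)+)+
  have b: "continuous_on UNIV b" "integrable lborel b" "(LINT x|lebesgue_on \<Omega>. partial_deriv i G x * \<psi> x) = integral\<^sup>L lborel b"
    unfolding b_def by (rule zero_extension[OF S _ K(1,2)], (intro continuous_intros cG c | simp add: K(3))+)+
  \<comment> \<open>\<open>u\<close> is differentiable everywhere: near the points outside \<open>K\<close> it vanishes\<close>
  define u where "u x = (if x \<in> \<Omega> then G x * \<psi> x else 0)" for x
  have u0: "u x = 0" if "x \<notin> K" for x using K(3) that by (simp add: u_def)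
  have *: "u differentiable (at x) \<and> partial_deriv i u x = a x + b x" for x
  proof (cases "x \<in> \<Omega>")
    case True
    have d: "G differentiable (at x)" "\<psi> differentiable (at x)"
      using G S True s smooth_differentiable by (auto intro: differentiable_on_open_at)
    then have "(\<lambda>x. G x * \<psi> x) differentiable (at x)" by (rule differentiable_mult)
    then obtain D where "((\<lambda>x. G x * \<psi> x) has_derivative D) (at x)" by (auto simp: differentiable_def)
    then have "(u has_derivative D) (at x)"
      by (rule has_derivative_transform_within_open[OF _ S True]) (simp add: u_def)
    moreover have "partial_deriv i u x = partial_deriv i (\<lambda>x. G x * \<psi> x) x"
      by (rule partial_deriv_cong_open[OF S True]) (simp add: u_def)
    ultimately show ?thesis using partial_deriv_mult[OF d] True by (auto simp: differentiable_def a_def b_def)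
  next
    case False
    then have x: "x \<in> - K" "open (- K)" using K compact_imp_closed by auto
    have "(u has_derivative (\<lambda>h. 0)) (at x)"
      by (rule has_derivative_transform_within_open[OF has_derivative_const[of 0] x(2,1)]) (simp add: u0)
    then show ?thesis using False by (auto simp: differentiable_def a_def b_def partial_deriv_eq)
  qed
  have eq: "partial_deriv i u = (\<lambda>x. a x + b x)" using * by auto
  have "integral\<^sup>L lborel (\<lambda>x. a x + b x) = 0"
    using integral_partial_deriv_zero(2)[of u i K] * K(1) u0 a(1) b(1) unfolding eq
    by (simp add: continuous_on_add)
  then have "integral\<^sup>L lborel a + integral\<^sup>L lborel b = 0" using a b by simp
  then show ?thesis using a b by simp
qed

text \<open>
  The derivatives move from \<open>\<psi>\<close> to \<open>G\<close> one at a time, starting with the outermost one, so their order is reversed.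
\<close>

lemma integration_by_parts_pd:
  fixes G :: "real ^ 'd \<Rightarrow> real"
  assumes S: "open \<Omega>" and G: "Ck_on (length js) \<Omega> G" and \<psi>: "\<psi> \<in> test_functions \<Omega>"
  shows "(LINT x|lebesgue_on \<Omega>. G x * pd js \<psi> x) = (-1) ^ length js * (LINT x|lebesgue_on \<Omega>. pd (rev js) G x * \<psi> x)"
  using G
proof (induction js arbitrary: G)
  case (Cons i js)
  have "Ck_on 1 \<Omega> G" using Ckb_mono[of False "Suc (length js)" \<Omega> G 1] Cons.prems unfolding Ckb_False by simp
  from integration_by_parts[OF S this test_functions_pd[OF \<psi>]]
  have "(LINT x|lebesgue_on \<Omega>. G x * pd (i # js) \<psi> x) = - (LINT x|lebesgue_on \<Omega>. partial_deriv i G x * pd js \<psi> x)" by simp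
  also have "\<dots> = - ((-1) ^ length js * (LINT x|lebesgue_on \<Omega>. pd (rev js) (partial_deriv i G) x * \<psi> x))"
    using Cons by auto
  finally show ?case by (simp add: pd_append)
qed auto

section \<open>Weak derivatives along lists of coordinates\<close>

text \<open>
  Test functions are smooth, so the derivative may be taken along any list with the given multiplicities.
\<close>

lemma has_weak_deriv_list:
  "has_weak_deriv \<Omega> (count (mset js)) f g \<longleftrightarrow>
     locally_integrable_on f \<Omega> \<and> locally_integrable_on g \<Omega> \<and>
     (\<forall>\<phi> \<in> test_functions \<Omega>. (LINT x|lebesgue_on \<Omega>. f x * pd js \<phi> x) =
        (-1) ^ length js * (LINT x|lebesgue_on \<Omega>. g x * \<phi> x))"
proof -
  have "pd (canon (count (mset js))) \<phi> = pd js \<phi>" if "\<phi> \<in> test_functions \<Omega>" for \<phi>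
    using that pd_smooth_perm[OF _ mset_canon] by (auto simp: test_functions_iff)
  moreover have "mi_order (count (mset js)) = length js"
    by (metis length_canon mset_canon size_mset)
  ultimately show ?thesis unfolding has_weak_deriv_def mderiv_eq_pd by (auto cong: ball_cong)
qed

lemma has_weak_deriv_step:
  assumes f: "has_weak_deriv \<Omega> (count (mset js)) f g" and f': "has_weak_deriv \<Omega> (count (mset (i # js))) f g'"
  shows "has_weak_deriv \<Omega> (count (mset [i])) g g'"
  unfolding has_weak_deriv_list
proof (intro conjI ballI)
  show "locally_integrable_on g \<Omega>" "locally_integrable_on g' \<Omega>"
    using assms unfolding has_weak_deriv_list by blast+
  fix \<phi> assume \<phi>: "\<phi> \<in> test_functions \<Omega>"
  have "mset (i # js) = mset (js @ [i])" by simp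
  then have f'': "has_weak_deriv \<Omega> (count (mset (js @ [i]))) f g'" using f' by metis
  have "(-1) ^ length js * (LINT x|lebesgue_on \<Omega>. g x * pd [i] \<phi> x) = (LINT x|lebesgue_on \<Omega>. f x * pd js (pd [i] \<phi>) x)"
    using f test_functions_pd[OF \<phi>, of "[i]"] unfolding has_weak_deriv_list by simp
  also have "\<dots> = (-1) ^ length (js @ [i]) * (LINT x|lebesgue_on \<Omega>. g' x * \<phi> x)"
    using f'' \<phi> unfolding has_weak_deriv_list by (simp add: pd_append)
  finally have "(-1) ^ length js * (LINT x|lebesgue_on \<Omega>. g x * pd [i] \<phi> x) =
      (-1) ^ length js * (- (LINT x|lebesgue_on \<Omega>. g' x * \<phi> x))" by simp
  then have "(LINT x|lebesgue_on \<Omega>. g x * pd [i] \<phi> x) = - (LINT x|lebesgue_on \<Omega>. g' x * \<phi> x)"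
    by (subst (asm) mult_left_cancel) auto
  then show "(LINT x|lebesgue_on \<Omega>. g x * pd [i] \<phi> x) = (-1) ^ length [i] * (LINT x|lebesgue_on \<Omega>. g' x * \<phi> x)"
    by simp
qed

section \<open>Convolution with smooth kernels\<close>

definition conv :: "(real ^ 'd \<Rightarrow> real) \<Rightarrow> (real ^ 'd \<Rightarrow> real) \<Rightarrow> real ^ 'd \<Rightarrow> real" where
  "conv g \<eta> x = (\<integral>y. g y * \<eta> (x - y) \<partial>lborel)"

lemma uniformly_continuous_compact_support:
  fixes w :: "'a::euclidean_space \<Rightarrow> real"
  assumes c: "continuous_on UNIV w" and K: "compact K" "\<And>x. x \<notin> K \<Longrightarrow> w x = 0" and e: "0 < (e::real)"
  obtains d where "d > 0" "\<And>x y. dist x y < d \<Longrightarrow> \<bar>w x - w y\<bar> < e"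
proof -
  define K' where "K' = {x + y |x y. x \<in> K \<and> y \<in> cball 0 1}"
  have K': "compact K'" unfolding K'_def by (rule compact_sums[OF K(1) compact_cball])
  have "uniformly_continuous_on K' w"
    by (rule compact_uniformly_continuous[OF _ K']) (use c continuous_on_subset in blast)
  then obtain d where d: "d > 0" "\<And>x y. x \<in> K' \<Longrightarrow> y \<in> K' \<Longrightarrow> dist x y < d \<Longrightarrow> dist (w x) (w y) < e"
    unfolding uniformly_continuous_on_def using e by metis
  have near: "y \<in> K'" if "x \<in> K" "dist x y < 1" for x y
  proof -
    have "y - x \<in> cball 0 1" using that by (simp add: dist_norm norm_minus_commute)
    then have "x + (y - x) \<in> K'" unfolding K'_def using that by blast
    then show ?thesis by simp
  qed
  show ?thesis
  proof (rule that[of "min d 1"])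
    fix x y :: 'a assume xy: "dist x y < min d 1"
    show "\<bar>w x - w y\<bar> < e"
    proof (cases "x \<in> K \<or> y \<in> K")
      case True
      then have "x \<in> K'" "y \<in> K'" using near[of x y] near[of y x] near[of x x] near[of y y] xy by (auto simp: dist_commute)
      then show ?thesis using d(2) xy by (simp add: dist_real_def)
    qed (use K e in auto)
  qed (use d in auto)
qed

lemma uniformly_differentiable:
  fixes \<eta> :: "real ^ 'd \<Rightarrow> real"
  assumes s: "smooth \<eta>" and K: "compact K" "\<And>x. x \<notin> K \<Longrightarrow> \<eta> x = 0" and e: "0 < (e::real)"
  obtains d where "d > 0" "\<And>z h. norm h < d \<Longrightarrow> \<bar>\<eta> (z + h) - \<eta> z - (\<Sum>i\<in>UNIV. h $ i * partial_deriv i \<eta> z)\<bar> \<le> e * norm h"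
proof -
  define e' where "e' = e / CARD('d)"
  have e': "e' > 0" using e by (simp add: e'_def)
  have "\<forall>i. \<exists>d>0. \<forall>x y. dist x y < d \<longrightarrow> \<bar>partial_deriv i \<eta> x - partial_deriv i \<eta> y\<bar> < e'"
  proof
    fix i
    have "continuous_on UNIV (partial_deriv i \<eta>)" using s smooth_partial_deriv smooth_continuous by blast
    moreover have "partial_deriv i \<eta> x = 0" if "x \<notin> K" for x
      using pd_zero_outside[of K \<eta> x "[i]"] K that compact_imp_closed by auto
    ultimately show "\<exists>d>0. \<forall>x y. dist x y < d \<longrightarrow> \<bar>partial_deriv i \<eta> x - partial_deriv i \<eta> y\<bar> < e'"
      using uniformly_continuous_compact_support[OF _ K(1) _ e'] by metis
  qed
  then obtain D where D: "\<And>i. D i > 0" "\<And>i x y. dist x y < D i \<Longrightarrow> \<bar>partial_deriv i \<eta> x - partial_deriv i \<eta> y\<bar> < e'"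
    by metis
  define d where "d = Min (range D)"
  have d: "d > 0" "\<And>i. d \<le> D i" using D by (auto simp: d_def)
  let ?f' = "\<lambda>x h. \<Sum>i\<in>UNIV. h $ i * partial_deriv i \<eta> x"
  have "\<bar>\<eta> (z + h) - \<eta> z - ?f' z h\<bar> \<le> e * norm h" if h: "norm h < d" for z h
  proof -
    have "norm (\<eta> (z + h) - \<eta> z - ?f' z ((z + h) - z)) \<le> norm ((z + h) - z) * e"
    proof (rule differentiable_bound_linearization[where S = "ball z d"])
      show "z + t *\<^sub>R ((z + h) - z) \<in> ball z d" if "t \<in> {0..1}" for t
      proof -
        have "\<bar>t\<bar> * norm h \<le> 1 * norm h" using that by (intro mult_right_mono) auto
        then show ?thesis using h by (simp add: dist_norm)
      qed
      show "(\<eta> has_derivative ?f' x) (at x within ball z d)" for x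
        using has_derivative_partial_sum[OF smooth_differentiable[OF s]] by (simp add: has_derivative_at_withinI)
      show "onorm (?f' x - ?f' z) \<le> e" if "x \<in> ball z d" for x
      proof (rule onorm_le)
        fix h :: "real ^ 'd"
        have "norm ((?f' x - ?f' z) h) = \<bar>\<Sum>i\<in>UNIV. h $ i * (partial_deriv i \<eta> x - partial_deriv i \<eta> z)\<bar>"
          by (simp add: sum_subtractf[symmetric] algebra_simps)
        also have "\<dots> \<le> (\<Sum>i\<in>UNIV. \<bar>h $ i * (partial_deriv i \<eta> x - partial_deriv i \<eta> z)\<bar>)" by (rule sum_abs)
        also have "\<dots> \<le> (\<Sum>i\<in>(UNIV :: 'd set). norm h * e')"
        proof (rule sum_mono)
          fix i
          have "dist x z < D i" using that d(2)[of i] by (simp add: dist_commute)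
          then have "\<bar>partial_deriv i \<eta> x - partial_deriv i \<eta> z\<bar> \<le> e'" using D(2) less_imp_le by blast
          then show "\<bar>h $ i * (partial_deriv i \<eta> x - partial_deriv i \<eta> z)\<bar> \<le> norm h * e'"
            unfolding abs_mult by (intro mult_mono component_le_norm_cart) auto
        qed
        also have "\<dots> = e * norm h" by (simp add: e'_def)
        finally show "norm ((?f' x - ?f' z) h) \<le> e * norm h" .
      qed
    qed (use d in auto)
    then show ?thesis by (simp add: mult.commute)
  qed
  with d(1) show ?thesis using that by blast
qed

lemma integrable_conv:
  fixes w :: "real ^ 'd \<Rightarrow> real"
  assumes g: "integrable lborel g" and c: "continuous_on UNIV w" and K: "compact K" "\<And>x. x \<notin> K \<Longrightarrow> w x = 0"
  shows "integrable lborel (\<lambda>y. g y * w (x - y))"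
proof -
  obtain B where B: "B \<ge> 0" "\<And>x. \<bar>w x\<bar> \<le> B" using bounded_compact_support[OF c K] by metis
  have m: "w \<in> borel_measurable borel" using c by (rule borel_measurable_continuous_onI)
  show ?thesis
  proof (rule Bochner_Integration.integrable_bound)
    show "integrable lborel (\<lambda>y. B * g y)" using g by simp
    show "(\<lambda>y. g y * w (x - y)) \<in> borel_measurable lborel" using g m by measurable
    show "AE y in lborel. norm (g y * w (x - y)) \<le> norm (B * g y)"
      using B mult_left_mono[OF B(2)] by (auto simp: abs_mult mult.commute[of B])
  qed
qed

text \<open>
  The remainder in the expansion of the kernel is at most \<open>\<epsilon> |h|\<close> uniformly (\<open>uniformly_differentiable\<close>), and
  integrating it against \<open>g\<close> costs a factor \<open>\<parallel>g\<parallel>\<^sub>1\<close>.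
\<close>

lemma conv_deriv:
  fixes \<eta> :: "real ^ 'd \<Rightarrow> real"
  assumes g: "integrable lborel g" and s: "smooth \<eta>" and K: "compact K" "\<And>x. x \<notin> K \<Longrightarrow> \<eta> x = 0"
  shows "(conv g \<eta> has_derivative (\<lambda>h. \<Sum>i\<in>UNIV. h $ i * conv g (partial_deriv i \<eta>) x)) (at x)"
  unfolding has_derivative_at_alt
proof (intro conjI allI impI)
  show "bounded_linear (\<lambda>h. \<Sum>i\<in>UNIV. h $ i * conv g (partial_deriv i \<eta>) x)"
    by (intro bounded_linear_sum bounded_linear_mult_const bounded_linear_vec_nth)
  fix e :: real assume e: "0 < e"
  define N where "N = (\<integral>y. \<bar>g y\<bar> \<partial>lborel)"
  have N: "N \<ge> 0" by (simp add: N_def)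
  have "e / (N + 1) > 0" using e N by simp
  then obtain d where d: "d > 0" "\<And>z h. norm h < d \<Longrightarrow> \<bar>\<eta> (z + h) - \<eta> z - (\<Sum>i\<in>UNIV. h $ i * partial_deriv i \<eta> z)\<bar> \<le> e / (N + 1) * norm h"
    using uniformly_differentiable[OF s K] by metis
  have i0: "integrable lborel (\<lambda>y. g y * \<eta> (x - y))" for x
    by (rule integrable_conv[OF g smooth_continuous[OF s] K])
  have zp: "partial_deriv i \<eta> x = 0" if "x \<notin> K" for x i
      using pd_zero_outside[of K \<eta> x "[i]"] K that compact_imp_closed by auto
  have i1: "integrable lborel (\<lambda>y. g y * partial_deriv i \<eta> (x - y))" for x i
    by (rule integrable_conv[OF g smooth_continuous[OF smooth_partial_deriv[OF s]] K(1) zp])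
  show "\<exists>d>0. \<forall>y. norm (y - x) < d \<longrightarrow>
     norm (conv g \<eta> y - conv g \<eta> x - (\<Sum>i\<in>UNIV. (y - x) $ i * conv g (partial_deriv i \<eta>) x)) \<le> e * norm (y - x)"
  proof (intro exI[of _ d] conjI allI impI d(1))
    fix y assume y: "norm (y - x) < d"
    define h where "h = y - x"
    let ?q = "\<lambda>z. g z * (\<eta> ((x - z) + h) - \<eta> (x - z) - (\<Sum>i\<in>UNIV. h $ i * partial_deriv i \<eta> (x - z)))"
    have q: "?q z = g z * \<eta> (y - z) - g z * \<eta> (x - z) - (\<Sum>i\<in>UNIV. h $ i * (g z * partial_deriv i \<eta> (x - z)))" for z
      by (simp add: h_def algebra_simps sum_distrib_left)
    have iq: "integrable lborel ?q" unfolding q by (intro Bochner_Integration.integrable_diff Bochner_Integration.integrable_sum i0 i1 integrable_mult_right)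
    have "conv g \<eta> y - conv g \<eta> x - (\<Sum>i\<in>UNIV. h $ i * conv g (partial_deriv i \<eta>) x) = integral\<^sup>L lborel ?q"
      unfolding q conv_def by (simp add: i0 i1)
    then have "norm (conv g \<eta> y - conv g \<eta> x - (\<Sum>i\<in>UNIV. h $ i * conv g (partial_deriv i \<eta>) x)) = norm (integral\<^sup>L lborel ?q)"
      by (rule arg_cong)
    also have "\<dots> \<le> (\<integral>z. norm (?q z) \<partial>lborel)" by (rule integral_norm_bound)
    also have "\<dots> \<le> (\<integral>z. \<bar>g z\<bar> * (e / (N + 1) * norm h) \<partial>lborel)"
    proof (rule integral_mono)
      show "integrable lborel (\<lambda>z. norm (?q z))" using iq by (rule integrable_norm)
      show "integrable lborel (\<lambda>z. \<bar>g z\<bar> * (e / (N + 1) * norm h))" using g by simp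
      show "norm (?q z) \<le> \<bar>g z\<bar> * (e / (N + 1) * norm h)" for z
        unfolding real_norm_def abs_mult using d(2)[of h "x - z"] y by (intro mult_left_mono) (auto simp: h_def)
    qed
    also have "\<dots> = N * (e / (N + 1) * norm h)" unfolding N_def by (rule Bochner_Integration.integral_mult_left) (use g in simp)
    also have "\<dots> = (N / (N + 1)) * (e * norm h)" by simp
    also have "\<dots> \<le> 1 * (e * norm h)" using N e by (intro mult_right_mono) auto
    finally show "norm (conv g \<eta> y - conv g \<eta> x - (\<Sum>i\<in>UNIV. (y - x) $ i * conv g (partial_deriv i \<eta>) x)) \<le> e * norm (y - x)"
      by (simp add: h_def)
  qed
qed

lemma partial_deriv_conv:
  fixes \<eta> :: "real ^ 'd \<Rightarrow> real"
  assumes "integrable lborel g" "smooth \<eta>" "compact K" "\<And>x. x \<notin> K \<Longrightarrow> \<eta> x = 0"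
  shows "partial_deriv i (conv g \<eta>) = conv g (partial_deriv i \<eta>)"
  by (rule ext, subst partial_deriv_eq[OF conv_deriv[OF assms]])
    (auto simp: axis_def if_distrib[of "\<lambda>x. x * _"] cong: if_cong)

lemma pd_conv:
  fixes \<eta> :: "real ^ 'd \<Rightarrow> real"
  assumes "integrable lborel g" "smooth \<eta>" "compact K" "\<And>x. x \<notin> K \<Longrightarrow> \<eta> x = 0"
  shows "pd js (conv g \<eta>) = conv g (pd js \<eta>)"
proof (induction js)
  case (Cons i js)
  have "pd js \<eta> x = 0" if "x \<notin> K" for x
    using pd_zero_outside[of K \<eta> x js] assms that compact_imp_closed by auto
  with Cons show ?case using partial_deriv_conv[OF assms(1) smooth_pd[OF assms(2)] assms(3)] by simp
qed simp

lemma smooth_conv: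
  fixes \<eta> :: "real ^ 'd \<Rightarrow> real"
  assumes g: "integrable lborel g" and s: "smooth \<eta>" and K: "compact K" "\<And>x. x \<notin> K \<Longrightarrow> \<eta> x = 0"
  shows "smooth (conv g \<eta>)"
proof -
  have "Ck_on (Suc k) UNIV (conv g \<eta>)" for k
    using s K(2)
  proof (induction k arbitrary: \<eta>)
    have d: "conv g \<eta> differentiable_on UNIV" if "smooth \<eta>" "\<And>x. x \<notin> K \<Longrightarrow> \<eta> x = 0" for \<eta>
      using conv_deriv[OF g that(1) K(1) that(2)] by (auto simp: differentiable_on_def differentiable_def)
    have z: "partial_deriv i \<eta> x = 0" if "\<And>x. x \<notin> K \<Longrightarrow> \<eta> x = 0" "x \<notin> K" for i and \<eta> :: "real ^ 'd \<Rightarrow> real" and x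
      using pd_zero_outside[of K \<eta> x "[i]"] K that compact_imp_closed by auto
    {
      case 0
      have "conv g (partial_deriv i \<eta>) differentiable_on UNIV" for i
        by (rule d[OF smooth_partial_deriv[OF 0(1)] z[OF 0(2)]])
      then show ?case using d[OF 0] partial_deriv_conv[OF g 0(1) K(1) 0(2)]
        by (simp add: differentiable_imp_continuous_on)
    next
      case (Suc k)
      have "Ck_on (Suc k) UNIV (conv g (partial_deriv i \<eta>))" for i
        by (rule Suc.IH[OF smooth_partial_deriv[OF Suc.prems(1)] z[OF Suc.prems(2)]])
      then show ?case using d[OF Suc.prems] partial_deriv_conv[OF g Suc.prems(1) K(1) Suc.prems(2)]
        unfolding Ck_on.simps(2)[of "Suc k"] by simp
    }
  qed
  then show ?thesis using Ck_on_SucD unfolding smooth_def by blast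
qed

section \<open>Continuity of translations in the mean\<close>

definition L1_translation_continuous :: "('a::euclidean_space \<Rightarrow> real) \<Rightarrow> bool" where
  "L1_translation_continuous g \<longleftrightarrow>
     (\<forall>e>0. \<exists>d>0. \<forall>y. norm y < d \<longrightarrow> (\<integral>\<^sup>+ x. ennreal \<bar>g (x + y) - g x\<bar> \<partial>lborel) \<le> ennreal e)"

text \<open>
  Squeeze \<open>E\<close> between a compact set \<open>C\<close> and an open set \<open>U\<close> up to measure \<open>e/4\<close> on either side. If \<open>y\<close> is short, translates
  of \<open>C\<close> by \<open>y\<close> and \<open>- y\<close> stay in \<open>U\<close>, so \<open>E\<close> and its translate differ only where one of the two points
  lies in \<open>E - C\<close> or \<open>U - E\<close>.
\<close>

lemma L1_translation_continuous_indicator: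
  fixes E :: "'a::euclidean_space set"
  assumes E: "E \<in> sets lborel" "emeasure lborel E < \<infinity>"
  shows "L1_translation_continuous (indicator E)"
  unfolding L1_translation_continuous_def
proof (intro allI impI)
  fix e :: real assume e: "e > 0"
  have Eb[measurable]: "E \<in> sets borel" using E by simp
  obtain U where U: "open U" "E \<subseteq> U" "emeasure lborel (U - E) < ennreal (e / 4)"
    using outer_regular_lborel[OF Eb, of "e / 4"] e by auto
  obtain C where C: "compact C" "C \<subseteq> E" "emeasure lborel (E - C) < ennreal (e / 4)"
  proof -
    have "E \<in> sets lebesgue" "0 < e / 8" using e by auto
    then obtain T where T: "closed T" "T \<subseteq> E" "emeasure lebesgue (E - T) < ennreal (e / 8)"
      by (rule sets_lebesgue_inner_closed)
    have "(\<lambda>n. emeasure lborel (E - cball 0 (real n))) \<longlonglongrightarrow> emeasure lborel (\<Inter>n. E - cball 0 (real n))"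
    proof (rule Lim_emeasure_decseq)
      show "decseq (\<lambda>n. E - cball 0 (real n))" by (auto simp: decseq_def)
      show "emeasure lborel (E - cball 0 (real i)) \<noteq> \<infinity>" for i
        using emeasure_mono[of "E - cball 0 (real i)" E lborel] E by (auto simp: top_unique)
    qed auto
    moreover have "(\<Inter>n. E - cball 0 (real n)) = {}"
    proof (intro set_eqI iffI)
      fix x assume x: "x \<in> (\<Inter>n. E - cball 0 (real n))"
      obtain n where "norm x \<le> real n" using real_arch_simple by blast
      with x show "x \<in> {}" by auto
    qed auto
    ultimately have "(\<lambda>n. emeasure lborel (E - cball 0 (real n))) \<longlonglongrightarrow> 0" by (simp only: emeasure_empty)
    then have "eventually (\<lambda>n. emeasure lborel (E - cball 0 (real n)) < ennreal (e / 8)) sequentially"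
      using e by (intro order_tendstoD) auto
    then obtain n where n: "emeasure lborel (E - cball 0 (real n)) < ennreal (e / 8)"
      by (auto simp: eventually_sequentially)
    show thesis
    proof (rule that[of "T \<inter> cball 0 (real n)"])
      have [measurable]: "T \<in> sets borel" using T by simp
      have "emeasure lborel (E - (T \<inter> cball 0 (real n))) \<le> emeasure lborel ((E - T) \<union> (E - cball 0 (real n)))"
        by (intro emeasure_mono) auto
      also have "\<dots> \<le> emeasure lborel (E - T) + emeasure lborel (E - cball 0 (real n))"
        by (intro emeasure_subadditive) auto
      also have "\<dots> < ennreal (e / 8) + ennreal (e / 8)" using T(3) n by (intro add_strict_mono) auto
      also have "\<dots> = ennreal (e / 4)" using e by (simp flip: ennreal_plus)
      finally show "emeasure lborel (E - (T \<inter> cball 0 (real n))) < ennreal (e / 4)" .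
    qed (use T in auto)
  qed
  have [measurable]: "C \<in> sets borel" "U \<in> sets borel" using C U by (auto intro: borel_compact)
  obtain d where d: "d > 0" "(\<Union>x\<in>C. cball x d) \<subseteq> U"
    using compact_subset_open_imp_cball_epsilon_subset[of C U] C U by blast
  show "\<exists>d>0. \<forall>y. norm y < d \<longrightarrow> (\<integral>\<^sup>+ x. ennreal \<bar>indicator E (x + y) - indicator E x\<bar> \<partial>lborel) \<le> ennreal e"
  proof (intro exI[of _ d] conjI allI impI d(1))
    fix y :: 'a assume y: "norm y < d"
    let ?a = "\<lambda>x. indicator (E - C) x :: ennreal" and ?b = "\<lambda>x. indicator (U - E) x :: ennreal"
    have near: "q \<in> U" if "p \<in> C" "norm (p - q) < d" for p q
      using d(2) that by (force simp: dist_norm)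
    have "(\<integral>\<^sup>+ x. ennreal \<bar>indicator E (x + y) - indicator E x\<bar> \<partial>lborel)
        \<le> (\<integral>\<^sup>+ x. (?a (x + y) + ?a x) + (?b x + ?b (x + y)) \<partial>lborel)"
    proof (rule nn_integral_mono)
      fix x
      show "ennreal \<bar>indicator E (x + y) - indicator E x\<bar> \<le> (?a (x + y) + ?a x) + (?b x + ?b (x + y))"
        using near[of x "x + y"] near[of "x + y" x] y C(2) by (auto simp: indicator_def)
    qed
    also have "\<dots> = ((\<integral>\<^sup>+ x. ?a (x + y) \<partial>lborel) + (\<integral>\<^sup>+ x. ?a x \<partial>lborel)) + ((\<integral>\<^sup>+ x. ?b x \<partial>lborel) + (\<integral>\<^sup>+ x. ?b (x + y) \<partial>lborel))"
      by (simp add: nn_integral_add)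
    also have "\<dots> = (emeasure lborel (E - C) + emeasure lborel (E - C)) + (emeasure lborel (U - E) + emeasure lborel (U - E))"
      by (simp add: nn_integral_lborel_shift[of "indicator (E - C)"] nn_integral_lborel_shift[of "indicator (U - E)"])
    also have "\<dots> \<le> (ennreal (e / 4) + ennreal (e / 4)) + (ennreal (e / 4) + ennreal (e / 4))"
      using C(3) U(3) by (intro add_mono) auto
    also have "\<dots> = ennreal e" using e by (simp flip: ennreal_plus)
    finally show "(\<integral>\<^sup>+ x. ennreal \<bar>indicator E (x + y) - indicator E x\<bar> \<partial>lborel) \<le> ennreal e" .
  qed
qed

lemma translation_continuous_triangle:
  fixes f s :: "'a::euclidean_space \<Rightarrow> real"
  assumes [measurable]: "f \<in> borel_measurable borel" "s \<in> borel_measurable borel"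
  shows "(\<integral>\<^sup>+ x. ennreal \<bar>f (x + y) - f x\<bar> \<partial>lborel)
    \<le> (\<integral>\<^sup>+ x. ennreal \<bar>s (x + y) - s x\<bar> \<partial>lborel) + 2 * (\<integral>\<^sup>+ x. ennreal \<bar>f x - s x\<bar> \<partial>lborel)"
proof -
  have "(\<integral>\<^sup>+ x. ennreal \<bar>f (x + y) - f x\<bar> \<partial>lborel)
     \<le> (\<integral>\<^sup>+ x. ennreal \<bar>s (x + y) - s x\<bar> + (ennreal \<bar>f (x + y) - s (x + y)\<bar> + ennreal \<bar>f x - s x\<bar>) \<partial>lborel)"
    by (intro nn_integral_mono) (simp flip: ennreal_plus)
  also have "\<dots> = (\<integral>\<^sup>+ x. ennreal \<bar>s (x + y) - s x\<bar> \<partial>lborel) + ((\<integral>\<^sup>+ x. ennreal \<bar>f (x + y) - s (x + y)\<bar> \<partial>lborel) + (\<integral>\<^sup>+ x. ennreal \<bar>f x - s x\<bar> \<partial>lborel))"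
    by (simp add: nn_integral_add)
  also have "(\<integral>\<^sup>+ x. ennreal \<bar>f (x + y) - s (x + y)\<bar> \<partial>lborel) = (\<integral>\<^sup>+ x. ennreal \<bar>f x - s x\<bar> \<partial>lborel)"
    using nn_integral_lborel_shift[of "\<lambda>x. ennreal \<bar>f x - s x\<bar>" y] by simp
  finally show ?thesis by (simp add: mult_2)
qed

lemma integrable_imp_L1_translation_continuous:
  fixes g :: "'a::euclidean_space \<Rightarrow> real"
  assumes "integrable lborel g"
  shows "L1_translation_continuous g"
  using assms
proof (induction rule: integrable_induct)
  case (base E c)
  show ?case unfolding L1_translation_continuous_def
  proof (intro allI impI)
    fix e :: real assume e: "e > 0"
    then have "e / (\<bar>c\<bar> + 1) > 0" by simp
    then obtain d where d: "d > 0" "\<And>y. norm y < d \<Longrightarrow> (\<integral>\<^sup>+ x. ennreal \<bar>indicator E (x + y) - indicator E x\<bar> \<partial>lborel) \<le> ennreal (e / (\<bar>c\<bar> + 1))"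
      using L1_translation_continuous_indicator[OF base, unfolded L1_translation_continuous_def, rule_format] by blast
    have [measurable]: "E \<in> sets borel" using base by simp
    have "(\<integral>\<^sup>+ x. ennreal \<bar>indicator E (x + y) *\<^sub>R c - indicator E x *\<^sub>R c\<bar> \<partial>lborel) \<le> ennreal e" if "norm y < d" for y
    proof -
      have "(\<integral>\<^sup>+ x. ennreal \<bar>indicator E (x + y) *\<^sub>R c - indicator E x *\<^sub>R c\<bar> \<partial>lborel)
        = (\<integral>\<^sup>+ x. ennreal \<bar>c\<bar> * ennreal \<bar>indicator E (x + y) - indicator E x\<bar> \<partial>lborel)"
      proof (rule nn_integral_cong)
        fix x
        have "\<bar>indicator E (x + y) *\<^sub>R c - indicator E x *\<^sub>R c\<bar> = \<bar>c\<bar> * \<bar>indicator E (x + y) - indicator E x\<bar>"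
          by (simp add: abs_mult[symmetric] algebra_simps)
        then show "ennreal \<bar>indicator E (x + y) *\<^sub>R c - indicator E x *\<^sub>R c\<bar> = ennreal \<bar>c\<bar> * ennreal \<bar>indicator E (x + y) - indicator E x\<bar>"
          by (simp add: ennreal_mult)
      qed
      also have "\<dots> = ennreal \<bar>c\<bar> * (\<integral>\<^sup>+ x. ennreal \<bar>indicator E (x + y) - indicator E x\<bar> \<partial>lborel)"
        by (rule nn_integral_cmult) measurable
      also have "\<dots> \<le> ennreal \<bar>c\<bar> * ennreal (e / (\<bar>c\<bar> + 1))" using d(2)[OF that] by (rule mult_left_mono) simp
      also have "\<dots> = ennreal (\<bar>c\<bar> / (\<bar>c\<bar> + 1) * e)" by (simp flip: ennreal_mult')
      also have "\<dots> \<le> ennreal (1 * e)" using e by (intro ennreal_leI mult_right_mono) auto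
      finally show ?thesis by simp
    qed
    with d(1) show "\<exists>d>0. \<forall>y. norm y < d \<longrightarrow> (\<integral>\<^sup>+ x. ennreal \<bar>indicator E (x + y) *\<^sub>R c - indicator E x *\<^sub>R c\<bar> \<partial>lborel) \<le> ennreal e"
      by blast
  qed
next
  case (add f g)
  show ?case unfolding L1_translation_continuous_def
  proof (intro allI impI)
    fix e :: real assume "e > 0"
    then have e: "e / 2 > 0" by simp
    obtain d1 where d1: "d1 > 0" "\<And>y. norm y < d1 \<Longrightarrow> (\<integral>\<^sup>+ x. ennreal \<bar>f (x + y) - f x\<bar> \<partial>lborel) \<le> ennreal (e / 2)"
      using add.IH(1)[unfolded L1_translation_continuous_def, rule_format, OF e] by blast
    obtain d2 where d2: "d2 > 0" "\<And>y. norm y < d2 \<Longrightarrow> (\<integral>\<^sup>+ x. ennreal \<bar>g (x + y) - g x\<bar> \<partial>lborel) \<le> ennreal (e / 2)"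
      using add.IH(2)[unfolded L1_translation_continuous_def, rule_format, OF e] by blast
    have [measurable]: "f \<in> borel_measurable borel" "g \<in> borel_measurable borel" using add.hyps by auto
    have "(\<integral>\<^sup>+ x. ennreal \<bar>f (x + y) + g (x + y) - (f x + g x)\<bar> \<partial>lborel) \<le> ennreal e" if "norm y < min d1 d2" for y
    proof -
      have "(\<integral>\<^sup>+ x. ennreal \<bar>f (x + y) + g (x + y) - (f x + g x)\<bar> \<partial>lborel)
        \<le> (\<integral>\<^sup>+ x. ennreal \<bar>f (x + y) - f x\<bar> + ennreal \<bar>g (x + y) - g x\<bar> \<partial>lborel)"
        by (intro nn_integral_mono) (simp flip: ennreal_plus)
      also have "\<dots> = (\<integral>\<^sup>+ x. ennreal \<bar>f (x + y) - f x\<bar> \<partial>lborel) + (\<integral>\<^sup>+ x. ennreal \<bar>g (x + y) - g x\<bar> \<partial>lborel)"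
        by (rule nn_integral_add) measurable
      also have "\<dots> \<le> ennreal (e / 2) + ennreal (e / 2)" using d1(2) d2(2) that by (intro add_mono) auto
      also have "\<dots> = ennreal e" using e by (simp flip: ennreal_plus)
      finally show ?thesis .
    qed
    then show "\<exists>d>0. \<forall>y. norm y < d \<longrightarrow> (\<integral>\<^sup>+ x. ennreal \<bar>f (x + y) + g (x + y) - (f x + g x)\<bar> \<partial>lborel) \<le> ennreal e"
      using d1(1) d2(1) by (intro exI[of _ "min d1 d2"]) auto
  qed
next
  case (lim f s)
  show ?case unfolding L1_translation_continuous_def
  proof (intro allI impI)
    fix e :: real assume "e > 0"
    then have e: "e / 3 > 0" by simp
    have [measurable]: "f \<in> borel_measurable borel" using lim.hyps by auto
    have [measurable]: "s i \<in> borel_measurable borel" for i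
      using borel_measurable_integrable[of lborel "s i"] lim.hyps by simp
    have "(\<lambda>i. \<integral>\<^sup>+ x. norm (f x - s i x) \<partial>lborel) \<longlonglongrightarrow> 0"
    proof (rule nn_integral_dominated_convergence_norm[where w = "\<lambda>x. 2 * norm (f x)"])
      show "(\<integral>\<^sup>+ x. ennreal (2 * norm (f x)) \<partial>lborel) < \<infinity>"
        using lim by (simp add: integrable_iff_bounded ennreal_mult nn_integral_cmult ennreal_mult_less_top)
    qed (use lim in auto)
    then have "eventually (\<lambda>i. (\<integral>\<^sup>+ x. norm (f x - s i x) \<partial>lborel) < ennreal (e / 3)) sequentially"
      using e by (intro order_tendstoD) auto
    then obtain i where i: "(\<integral>\<^sup>+ x. norm (f x - s i x) \<partial>lborel) < ennreal (e / 3)"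
      by (auto simp: eventually_sequentially)
    obtain d where d: "d > 0" "\<And>y. norm y < d \<Longrightarrow> (\<integral>\<^sup>+ x. ennreal \<bar>s i (x + y) - s i x\<bar> \<partial>lborel) \<le> ennreal (e / 3)"
      using lim.IH[of i, unfolded L1_translation_continuous_def, rule_format, OF e] by blast
    have "(\<integral>\<^sup>+ x. ennreal \<bar>f (x + y) - f x\<bar> \<partial>lborel) \<le> ennreal e" if "norm y < d" for y
    proof -
      have "(\<integral>\<^sup>+ x. ennreal \<bar>f (x + y) - f x\<bar> \<partial>lborel)
        \<le> (\<integral>\<^sup>+ x. ennreal \<bar>s i (x + y) - s i x\<bar> \<partial>lborel) + 2 * (\<integral>\<^sup>+ x. ennreal \<bar>f x - s i x\<bar> \<partial>lborel)"
        by (rule translation_continuous_triangle) auto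
      also have "\<dots> \<le> ennreal (e / 3) + 2 * ennreal (e / 3)"
      proof (rule add_mono)
        show "2 * (\<integral>\<^sup>+ x. ennreal \<bar>f x - s i x\<bar> \<partial>lborel) \<le> 2 * ennreal (e / 3)"
          using i by (intro mult_left_mono) (simp_all add: less_imp_le)
      qed (rule d(2)[OF that])
      also have "\<dots> = ennreal (e / 3) + (ennreal (e / 3) + ennreal (e / 3))" by (simp add: mult_2)
      also have "\<dots> = ennreal e" using e by (simp flip: ennreal_plus)
      finally show ?thesis .
    qed
    with d(1) show "\<exists>d>0. \<forall>y. norm y < d \<longrightarrow> (\<integral>\<^sup>+ x. ennreal \<bar>f (x + y) - f x\<bar> \<partial>lborel) \<le> ennreal e"
      by blast
  qed
qed

section \<open>Mollification\<close>

definition mollifier :: "real \<Rightarrow> (real ^ 'd \<Rightarrow> real) \<Rightarrow> bool" where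
  "mollifier e \<eta> \<longleftrightarrow> smooth \<eta> \<and> (\<forall>x. 0 \<le> \<eta> x) \<and> (\<forall>x. e \<le> norm x \<longrightarrow> \<eta> x = 0) \<and>
     integrable lborel \<eta> \<and> integral\<^sup>L lborel \<eta> = 1"

lemma mollifier_nn_integral:
  assumes "mollifier e \<eta>"
  shows "(\<integral>\<^sup>+ y. ennreal (\<eta> y) \<partial>lborel) = 1"
  using assms nn_integral_eq_integral[of lborel \<eta>] by (auto simp: mollifier_def)

lemma mollifier_measurable: "mollifier e \<eta> \<Longrightarrow> \<eta> \<in> borel_measurable borel"
  using smooth_continuous borel_measurable_continuous_onI by (metis mollifier_def)

lemma mollifier_zero: "mollifier e \<eta> \<Longrightarrow> x \<notin> cball 0 e \<Longrightarrow> \<eta> x = 0"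
  by (auto simp: mollifier_def)

lemma smooth_conv_mollifier: "integrable lborel g \<Longrightarrow> mollifier e \<eta> \<Longrightarrow> smooth (conv g \<eta>)"
  using smooth_conv[of g \<eta> "cball 0 e"] mollifier_zero by (auto simp: mollifier_def)

text \<open>
  The kernel has integral one, so \<open>g x\<close> can be brought under the integral.
\<close>

lemma conv_diff_bound:
  assumes g: "integrable lborel g" and \<eta>: "mollifier e \<eta>"
  shows "ennreal \<bar>conv g \<eta> x - g x\<bar> \<le> (\<integral>\<^sup>+ y. ennreal \<bar>g (x - y) - g x\<bar> * ennreal (\<eta> y) \<partial>lborel)"
proof -
  have s: "smooth \<eta>" and nn: "\<And>x. 0 \<le> \<eta> x" using \<eta> by (auto simp: mollifier_def)
  have m[measurable]: "\<eta> \<in> borel_measurable borel" "g \<in> borel_measurable borel"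
    using \<eta> mollifier_measurable g by auto
  have i1: "integrable lborel (\<lambda>y. g y * \<eta> (x - y))"
    by (rule integrable_conv[OF g smooth_continuous[OF s] compact_cball mollifier_zero[OF \<eta>]])
  have i2: "integrable lborel (\<lambda>y. \<eta> (x - y))"
  proof -
    have "integrable (distr lborel borel (\<lambda>y. x - y)) \<eta>" using \<eta> by (simp add: distr_lborel_reflect mollifier_def)
    then show ?thesis by (subst (asm) integrable_distr_eq) auto
  qed
  have "conv g \<eta> x - g x = (\<integral>y. g y * \<eta> (x - y) \<partial>lborel) - (\<integral>y. g x * \<eta> (x - y) \<partial>lborel)"
    using integral_lborel_reflect[OF m(1), of x] \<eta> by (simp add: conv_def mollifier_def)
  also have "\<dots> = (\<integral>y. g y * \<eta> (x - y) - g x * \<eta> (x - y) \<partial>lborel)"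
    using i1 i2 by simp
  finally have "ennreal \<bar>conv g \<eta> x - g x\<bar> = ennreal (norm (\<integral>y. g y * \<eta> (x - y) - g x * \<eta> (x - y) \<partial>lborel))" by simp
  also have "\<dots> \<le> (\<integral>\<^sup>+ y. norm (g y * \<eta> (x - y) - g x * \<eta> (x - y)) \<partial>lborel)"
    by (rule integral_norm_bound_ennreal) (use i1 i2 in simp)
  also have "\<dots> = (\<integral>\<^sup>+ y. ennreal \<bar>g (x - (x - y)) - g x\<bar> * ennreal (\<eta> (x - y)) \<partial>lborel)"
    by (intro nn_integral_cong) (use nn in \<open>simp add: abs_mult flip: ennreal_mult left_diff_distrib\<close>)
  also have "\<dots> = (\<integral>\<^sup>+ y. ennreal \<bar>g (x - y) - g x\<bar> * ennreal (\<eta> y) \<partial>lborel)"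
    by (rule nn_integral_lborel_reflect[of "\<lambda>y. ennreal \<bar>g (x - y) - g x\<bar> * ennreal (\<eta> y)"]) measurable
  finally show ?thesis .
qed

lemma conv_L1_close:
  fixes g :: "real ^ 'd \<Rightarrow> real"
  assumes g: "integrable lborel g" and e: "0 < e"
  obtains d where "d > 0" "\<And>\<eta> r. mollifier r \<eta> \<Longrightarrow> r \<le> d \<Longrightarrow> (\<integral>\<^sup>+ x. ennreal \<bar>conv g \<eta> x - g x\<bar> \<partial>lborel) \<le> ennreal e"
proof -
  obtain d where d: "d > 0" "\<And>y. norm y < d \<Longrightarrow> (\<integral>\<^sup>+ x. ennreal \<bar>g (x + y) - g x\<bar> \<partial>lborel) \<le> ennreal e"
    using integrable_imp_L1_translation_continuous[OF g] e unfolding L1_translation_continuous_def by metis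
  have [measurable]: "g \<in> borel_measurable borel" using g by auto
  have "(\<integral>\<^sup>+ x. ennreal \<bar>conv g \<eta> x - g x\<bar> \<partial>lborel) \<le> ennreal e" if \<eta>: "mollifier r \<eta>" and r: "r \<le> d" for \<eta> r
  proof -
    have [measurable]: "\<eta> \<in> borel_measurable borel" using \<eta> mollifier_measurable by blast
    have "(\<integral>\<^sup>+ x. ennreal \<bar>conv g \<eta> x - g x\<bar> \<partial>lborel)
        \<le> (\<integral>\<^sup>+ x. \<integral>\<^sup>+ y. ennreal \<bar>g (x - y) - g x\<bar> * ennreal (\<eta> y) \<partial>lborel \<partial>lborel)"
      by (intro nn_integral_mono conv_diff_bound[OF g \<eta>])
    also have "\<dots> = (\<integral>\<^sup>+ y. \<integral>\<^sup>+ x. ennreal \<bar>g (x - y) - g x\<bar> * ennreal (\<eta> y) \<partial>lborel \<partial>lborel)"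
      by (rule lborel_pair.Fubini') measurable
    also have "\<dots> \<le> (\<integral>\<^sup>+ y. ennreal e * ennreal (\<eta> y) \<partial>lborel)"
    proof (rule nn_integral_mono)
      fix y
      have "(\<integral>\<^sup>+ x. ennreal \<bar>g (x - y) - g x\<bar> * ennreal (\<eta> y) \<partial>lborel) = (\<integral>\<^sup>+ x. ennreal \<bar>g (x - y) - g x\<bar> \<partial>lborel) * ennreal (\<eta> y)"
        by (rule nn_integral_multc) measurable
      also have "\<dots> \<le> ennreal e * ennreal (\<eta> y)"
      proof (cases "norm y < d")
        case True
        then show ?thesis using d(2)[of "- y"] by (intro mult_right_mono) auto
      next
        case False
        then have "\<eta> y = 0" using \<eta> r by (auto simp: mollifier_def)
        then show ?thesis by simp
      qed
      finally show "(\<integral>\<^sup>+ x. ennreal \<bar>g (x - y) - g x\<bar> * ennreal (\<eta> y) \<partial>lborel) \<le> ennreal e * ennreal (\<eta> y)" .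
    qed
    also have "\<dots> = ennreal e * (\<integral>\<^sup>+ y. ennreal (\<eta> y) \<partial>lborel)" by (rule nn_integral_cmult) measurable
    also have "\<dots> = ennreal e" using mollifier_nn_integral[OF \<eta>] by simp
    finally show ?thesis .
  qed
  with d(1) show ?thesis using that by blast
qed

text \<open>
  Jensen's inequality for the probability density \<open>\<eta>\<close>, obtained from the Cauchy-Schwarz inequality by
  splitting \<open>\<eta> = \<surd>\<eta> \<surd>\<eta>\<close>.
\<close>

lemma conv_L2_bound:
  fixes g :: "real ^ 'd \<Rightarrow> real"
  assumes g: "integrable lborel g" and \<eta>: "mollifier e \<eta>"
  shows "(\<integral>\<^sup>+ x. ennreal (\<bar>conv g \<eta> x\<bar>\<^sup>2) \<partial>lborel) \<le> (\<integral>\<^sup>+ x. ennreal (\<bar>g x\<bar>\<^sup>2) \<partial>lborel)"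
proof -
  have s: "smooth \<eta>" and nn: "\<And>x. 0 \<le> \<eta> x" using \<eta> by (auto simp: mollifier_def)
  have m[measurable]: "\<eta> \<in> borel_measurable borel" "g \<in> borel_measurable borel"
    using \<eta> mollifier_measurable g by auto
  have one: "(\<integral>\<^sup>+ y. ennreal (\<eta> (x - y)) \<partial>lborel) = 1" for x
    using nn_integral_lborel_reflect[of "\<lambda>y. ennreal (\<eta> y)" x] mollifier_nn_integral[OF \<eta>] by simp
  have one': "(\<integral>\<^sup>+ x. ennreal (\<eta> (x - y)) \<partial>lborel) = 1" for y
    using nn_integral_lborel_shift[of "\<lambda>y. ennreal (\<eta> y)" "- y"] mollifier_nn_integral[OF \<eta>] by simp
  have "ennreal (\<bar>conv g \<eta> x\<bar>\<^sup>2) \<le> (\<integral>\<^sup>+ y. ennreal (\<bar>g y\<bar>\<^sup>2) * ennreal (\<eta> (x - y)) \<partial>lborel)" for x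
  proof -
    have i1: "integrable lborel (\<lambda>y. g y * \<eta> (x - y))"
      by (rule integrable_conv[OF g smooth_continuous[OF s] compact_cball mollifier_zero[OF \<eta>]])
    have "ennreal \<bar>conv g \<eta> x\<bar> \<le> (\<integral>\<^sup>+ y. norm (g y * \<eta> (x - y)) \<partial>lborel)"
      unfolding conv_def real_norm_def[symmetric] by (rule integral_norm_bound_ennreal[OF i1])
    also have "\<dots> = (\<integral>\<^sup>+ y. ennreal (\<bar>g y\<bar> * sqrt (\<eta> (x - y))) * ennreal (sqrt (\<eta> (x - y))) \<partial>lborel)"
      using nn by (intro nn_integral_cong) (simp add: abs_mult flip: ennreal_mult)
    finally have "(ennreal \<bar>conv g \<eta> x\<bar>)\<^sup>2 \<le> (\<integral>\<^sup>+ y. ennreal (\<bar>g y\<bar> * sqrt (\<eta> (x - y))) * ennreal (sqrt (\<eta> (x - y))) \<partial>lborel)\<^sup>2"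
      by (rule power_mono) simp
    also have "\<dots> \<le> (\<integral>\<^sup>+ y. (ennreal (\<bar>g y\<bar> * sqrt (\<eta> (x - y))))\<^sup>2 \<partial>lborel) * (\<integral>\<^sup>+ y. (ennreal (sqrt (\<eta> (x - y))))\<^sup>2 \<partial>lborel)"
      by (rule Cauchy_Schwarz_nn_integral) measurable
    also have "(\<lambda>y. (ennreal (sqrt (\<eta> (x - y))))\<^sup>2) = (\<lambda>y. ennreal (\<eta> (x - y)))"
      using nn by (simp add: ennreal_power)
    also have "(\<lambda>y. (ennreal (\<bar>g y\<bar> * sqrt (\<eta> (x - y))))\<^sup>2) = (\<lambda>y. ennreal (\<bar>g y\<bar>\<^sup>2) * ennreal (\<eta> (x - y)))"
      using nn by (simp add: ennreal_power power_mult_distrib flip: ennreal_mult)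
    finally show ?thesis by (simp add: one ennreal_power)
  qed
  then have "(\<integral>\<^sup>+ x. ennreal (\<bar>conv g \<eta> x\<bar>\<^sup>2) \<partial>lborel) \<le> (\<integral>\<^sup>+ x. \<integral>\<^sup>+ y. ennreal (\<bar>g y\<bar>\<^sup>2) * ennreal (\<eta> (x - y)) \<partial>lborel \<partial>lborel)"
    by (intro nn_integral_mono)
  also have "\<dots> = (\<integral>\<^sup>+ y. \<integral>\<^sup>+ x. ennreal (\<bar>g y\<bar>\<^sup>2) * ennreal (\<eta> (x - y)) \<partial>lborel \<partial>lborel)"
    by (rule lborel_pair.Fubini') measurable
  also have "\<dots> = (\<integral>\<^sup>+ y. ennreal (\<bar>g y\<bar>\<^sup>2) \<partial>lborel)"
    by (subst nn_integral_cmult) (auto simp: one')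
  finally show ?thesis .
qed

section \<open>Smooth approximation of weakly differentiable functions\<close>

lemma smooth_reflect:
  fixes F :: "real ^ 'd \<Rightarrow> real"
  assumes "smooth F"
  shows "smooth (\<lambda>y. F (x - y))"
  unfolding smooth_def
proof
  fix k
  have "Ckb False k UNIV (\<lambda>y :: real ^ 'd. x $ l + (-1) * y $ l)" for l
    using smooth_nth[of l] by (intro Ckb_add Ckb_mult Ckb_const) (auto simp: smooth_def Ckb_False)
  then show "Ck_on k UNIV (\<lambda>y. F (x - y))"
    by (intro Ck_on_compose[OF open_UNIV _ _ assms]) (simp_all add: Ckb_False differentiable_on_def)
qed

lemma pd_reflect:
  fixes F :: "real ^ 'd \<Rightarrow> real"
  assumes F: "smooth F"
  shows "pd js (\<lambda>y. F (x - y)) = (\<lambda>y. (-1) ^ length js * pd js F (x - y))"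
proof (induction js)
  case (Cons i js)
  have "((\<lambda>y. (-1) ^ length js * pd js F (x - y)) has_derivative
      (\<lambda>h. (-1) ^ length js * (\<Sum>j\<in>UNIV. ((- h) $ j) *\<^sub>R partial_deriv j (pd js F) (x - y)))) (at y)" for y
  proof -
    have "((\<lambda>y. x - y) has_derivative (\<lambda>h. - h)) (at y)" by (auto intro!: derivative_eq_intros)
    from diff_chain_at[OF this has_derivative_partial_sum[OF smooth_differentiable[OF smooth_pd[OF F, of js]]]]
    show ?thesis by (auto simp: o_def intro!: has_derivative_mult_right)
  qed
  from partial_deriv_eq[OF this, of i] show ?case unfolding pd_Cons Cons
    by (simp add: fun_eq_iff axis_def if_distrib[of "\<lambda>x. x * _"] sum_negf cong: if_cong)
qed simp

lemma integrable_borel_representative: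
  fixes u :: "'a::euclidean_space \<Rightarrow> real"
  assumes u: "integrable lebesgue u"
  obtains u0 where "integrable lborel u0" "AE x in lborel. u x = u0 x"
proof -
  obtain u0 where u0: "u0 \<in> borel_measurable lborel" "AE x in lborel. u x = u0 x"
    using completion_ex_borel_measurable_real[of u lborel] u by auto
  have "integrable lebesgue u0"
    using u u0 by (subst integrable_cong_AE[of _ _ u]) (auto simp: AE_completion measurable_completion eq_commute)
  then show ?thesis using that u0 integrable_completion[OF u0(1)] by blast
qed

text \<open>
  Near \<open>x\<close>, mollifying the function cut off outside \<open>K\<close> and replaced by a Borel representative is the
  same as integrating \<open>f\<close> over \<open>\<Omega>\<close> against the translated kernel.
\<close>

lemma conv_eq_lebesgue_on:
  fixes w :: "real ^ 'd \<Rightarrow> real"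
  assumes S: "open \<Omega>" and K: "compact K" "K \<subseteq> \<Omega>" and f: "f absolutely_integrable_on K"
    and f0: "integrable lborel f0" "AE y in lborel. indicator K y *\<^sub>R f y = f0 y"
    and w: "continuous_on UNIV w" "\<And>z. z \<notin> cball 0 e \<Longrightarrow> w z = 0" and x: "cball x e \<subseteq> K"
  shows "conv f0 w x = (LINT y|lebesgue_on \<Omega>. f y * w (x - y))"
proof -
  have m: "w \<in> borel_measurable borel" using w(1) by (rule borel_measurable_continuous_onI)
  then have m': "(\<lambda>y. w (x - y)) \<in> borel_measurable lborel" by measurable
  have f0m: "f0 \<in> borel_measurable lborel" using f0 by simp
  have "conv f0 w x = (\<integral>y. f0 y * w (x - y) \<partial>lebesgue)"
    unfolding conv_def using m' f0m by (subst integral_completion) auto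
  also have "\<dots> = (\<integral>y. (indicator K y *\<^sub>R f y) * w (x - y) \<partial>lebesgue)"
  proof (rule integral_cong_AE)
    have "(\<lambda>y. indicator K y *\<^sub>R f y) \<in> borel_measurable lebesgue" using f by (auto simp: set_integrable_def)
    then show "(\<lambda>y. indicator K y *\<^sub>R f y * w (x - y)) \<in> borel_measurable lebesgue"
      using measurable_completion[OF m'] by (rule borel_measurable_times)
    show "(\<lambda>y. f0 y * w (x - y)) \<in> borel_measurable lebesgue"
      by (rule measurable_completion) (use m' f0m in measurable)
    have "AE y in lebesgue. indicator K y *\<^sub>R f y = f0 y" by (rule AE_completion[OF f0(2)])
    then show "AE y in lebesgue. f0 y * w (x - y) = indicator K y *\<^sub>R f y * w (x - y)" by eventually_elim simp
  qed
  also have "\<dots> = (\<integral>y. indicator \<Omega> y *\<^sub>R (f y * w (x - y)) \<partial>lebesgue)"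
  proof (rule Bochner_Integration.integral_cong[OF refl])
    fix y
    have "w (x - y) = 0" if "y \<notin> K"
    proof -
      have "y \<notin> cball x e" using that x by blast
      then show ?thesis by (intro w(2)) (simp add: dist_norm norm_minus_commute)
    qed
    then show "indicator K y *\<^sub>R f y * w (x - y) = indicator \<Omega> y *\<^sub>R (f y * w (x - y))"
      using K by (auto simp: indicator_def)
  qed
  also have "\<dots> = (LINT y|lebesgue_on \<Omega>. f y * w (x - y))"
    using S by (subst integral_restrict_space) auto
  finally show ?thesis .
qed

text \<open>
  As a function of \<open>y\<close>, \<open>\<eta> (x - y)\<close> is a test function on \<open>\<Omega>\<close>. The definition of the weak derivative applies to it
  directly, and the sign \<open>(-1)\<^sup>n\<close> cancels against the one from reflecting the kernel.
\<close>

lemma conv_weak_deriv: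
  fixes \<eta> :: "real ^ 'd \<Rightarrow> real"
  assumes S: "open \<Omega>" and K: "compact K" "K \<subseteq> \<Omega>" and fg: "has_weak_deriv \<Omega> (count (mset js)) f g"
    and f0: "integrable lborel f0" "AE y in lborel. indicator K y *\<^sub>R f y = f0 y"
    and g0: "integrable lborel g0" "AE y in lborel. indicator K y *\<^sub>R g y = g0 y"
    and \<eta>: "mollifier e \<eta>" and x: "cball x e \<subseteq> K"
  shows "pd js (conv f0 \<eta>) x = conv g0 \<eta> x"
proof -
  have s: "smooth \<eta>" using \<eta> by (simp add: mollifier_def)
  have li: "f absolutely_integrable_on K" "g absolutely_integrable_on K"
    using fg K by (auto simp: has_weak_deriv_def locally_integrable_on_def)
  have z: "pd js \<eta> y = 0" if "y \<notin> cball 0 e" for y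
    by (rule pd_zero_outside[OF closed_cball mollifier_zero[OF \<eta>] that])
  have "\<eta> (x - y) = 0" if "y \<notin> cball x e" for y
    using that by (intro mollifier_zero[OF \<eta>]) (simp add: dist_norm norm_minus_commute)
  then have test: "(\<lambda>y. \<eta> (x - y)) \<in> test_functions \<Omega>"
    unfolding test_functions_iff using smooth_reflect[OF s] x K compact_cball[of x e] by blast
  have "pd js (conv f0 \<eta>) x = conv f0 (pd js \<eta>) x"
    by (rule fun_cong[OF pd_conv[OF f0(1) s compact_cball mollifier_zero[OF \<eta>]]])
  also have "\<dots> = (LINT y|lebesgue_on \<Omega>. f y * pd js \<eta> (x - y))"
    by (rule conv_eq_lebesgue_on[OF S K li(1) f0 smooth_continuous[OF smooth_pd[OF s]] z x])
  also have "\<dots> = (LINT y|lebesgue_on \<Omega>. (-1) ^ length js * (f y * pd js (\<lambda>y. \<eta> (x - y)) y))"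
    unfolding pd_reflect[OF s] by (intro Bochner_Integration.integral_cong) (auto simp: power_mult_distrib[symmetric])
  also have "\<dots> = (-1) ^ length js * (LINT y|lebesgue_on \<Omega>. f y * pd js (\<lambda>y. \<eta> (x - y)) y)"
    by (rule integral_mult_right_zero)
  also have "\<dots> = (LINT y|lebesgue_on \<Omega>. g y * \<eta> (x - y))"
    using fg test unfolding has_weak_deriv_list by (simp add: power_mult_distrib[symmetric])
  also have "\<dots> = conv g0 \<eta> x"
    by (rule conv_eq_lebesgue_on[OF S K li(2) g0 smooth_continuous[OF s] mollifier_zero[OF \<eta>] x, symmetric])
  finally show ?thesis .
qed

lemma L1_close_on_compact:
  fixes g0 :: "real ^ 'd \<Rightarrow> real"
  assumes K: "K \<in> sets lebesgue" "K \<subseteq> K'" and g0: "AE y in lborel. indicator K' y *\<^sub>R g y = g0 y"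
  shows "(\<integral>\<^sup>+ x. ennreal \<bar>c x - g x\<bar> * indicator K x \<partial>lebesgue) \<le> (\<integral>\<^sup>+ x. ennreal \<bar>c x - g0 x\<bar> \<partial>lborel)"
proof -
  have "(\<integral>\<^sup>+ x. ennreal \<bar>c x - g x\<bar> * indicator K x \<partial>lebesgue) \<le> (\<integral>\<^sup>+ x. ennreal \<bar>c x - g0 x\<bar> \<partial>lebesgue)"
    by (rule nn_integral_mono_AE, rule AE_mp[OF AE_completion[OF g0]], rule AE_I2) (use K in \<open>auto simp: indicator_def\<close>)
  then show ?thesis by (simp add: nn_integral_completion)
qed

text \<open>
  Cut \<open>f\<close> off outside a compact neighbourhood \<open>K'\<close> of \<open>K\<close> in \<open>\<Omega>\<close> and mollify at scales below the distance of \<open>K\<close> to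
  the complement of \<open>K'\<close>. On \<open>K\<close> the derivatives of the result are the mollified weak derivatives. One
  sequence serves all orders up to \<open>k\<close>.
\<close>

proposition smooth_approximation:
  fixes f :: "real ^ 'd \<Rightarrow> real" and g :: "'d list \<Rightarrow> real ^ 'd \<Rightarrow> real"
  assumes S: "open \<Omega>" and K: "compact K" "K \<subseteq> \<Omega>" and f: "locally_integrable_on f \<Omega>"
    and g: "\<And>js. length js \<le> k \<Longrightarrow> has_weak_deriv \<Omega> (count (mset js)) f (g js)"
  obtains F :: "nat \<Rightarrow> real ^ 'd \<Rightarrow> real" where "\<And>n. smooth (F n)"
    "(\<lambda>n. \<integral>\<^sup>+ x. ennreal \<bar>F n x - f x\<bar> * indicator K x \<partial>lebesgue) \<longlonglongrightarrow> 0"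
    "\<And>js. length js \<le> k \<Longrightarrow> (\<lambda>n. \<integral>\<^sup>+ x. ennreal \<bar>pd js (F n) x - g js x\<bar> * indicator K x \<partial>lebesgue) \<longlonglongrightarrow> 0"
    "\<And>js n. length js \<le> k \<Longrightarrow> (\<integral>\<^sup>+ x. ennreal (\<bar>pd js (F n) x\<bar>\<^sup>2) * indicator K x \<partial>lebesgue)
        \<le> (\<integral>\<^sup>+ x. ennreal (\<bar>g js x\<bar>\<^sup>2) * indicator \<Omega> x \<partial>lebesgue)"
proof -
  obtain \<rho> where \<rho>: "\<rho> > 0" "(\<Union>x\<in>K. cball x \<rho>) \<subseteq> \<Omega>"
    using compact_subset_open_imp_cball_epsilon_subset[OF K(1) S K(2)] by blast
  define K' where "K' = (\<Union>x\<in>K. \<Union>y\<in>cball 0 \<rho>. {x + y})"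
  have K'eq: "K' = (\<Union>x\<in>K. cball x \<rho>)"
  proof (intro set_eqI iffI)
    fix z assume "z \<in> (\<Union>x\<in>K. cball x \<rho>)"
    then obtain x where "x \<in> K" "z - x \<in> cball 0 \<rho>" by (auto simp: dist_norm norm_minus_commute)
    moreover have "z = x + (z - x)" by simp
    ultimately show "z \<in> K'" unfolding K'_def by blast
  qed (force simp: K'_def dist_norm)
  have K': "compact K'" unfolding K'_def by (rule compact_sums'[OF K(1) compact_cball])
  have K'\<Omega>: "K' \<subseteq> \<Omega>" using \<rho>(2) K'eq by simp
  have KK': "K \<subseteq> K'" using \<rho>(1) unfolding K'eq by force
  have Km: "K \<in> sets lebesgue" using K(1) by (simp add: lmeasurable_compact fmeasurableD)
  have rep: "\<exists>u0. integrable lborel u0 \<and> (AE y in lborel. indicator K' y *\<^sub>R u y = u0 y)"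
    if "locally_integrable_on u \<Omega>" for u
  proof -
    have "integrable lebesgue (\<lambda>y. indicator K' y *\<^sub>R u y)"
      using that K' K'\<Omega> unfolding locally_integrable_on_def set_integrable_def by blast
    then show ?thesis by (rule integrable_borel_representative) blast
  qed
  obtain f0 where f0: "integrable lborel f0" "AE y in lborel. indicator K' y *\<^sub>R f y = f0 y"
    using rep[OF f] by blast
  have "\<exists>g0. integrable lborel g0 \<and> (AE y in lborel. indicator K' y *\<^sub>R g js y = g0 y)" if "length js \<le> k" for js
    using rep g[OF that] by (simp add: has_weak_deriv_def)
  then obtain g0 where g0: "\<And>js. length js \<le> k \<Longrightarrow> integrable lborel (g0 js)"
      "\<And>js. length js \<le> k \<Longrightarrow> AE y in lborel. indicator K' y *\<^sub>R g js y = g0 js y"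
    by metis
  define r where "r n = \<rho> / (real n + 1)" for n
  have r: "r n > 0" "r n \<le> \<rho>" for n using \<rho>(1) by (auto simp: r_def divide_le_eq)
  have rlim: "r \<longlonglongrightarrow> 0" unfolding r_def by real_asymp
  have "\<exists>\<eta> :: real ^ 'd \<Rightarrow> real. mollifier (r n) \<eta>" for n
    using mollifier_exists[OF r(1)] unfolding mollifier_def by blast
  then obtain \<eta> :: "nat \<Rightarrow> real ^ 'd \<Rightarrow> real" where \<eta>: "\<And>n. mollifier (r n) (\<eta> n)" by metis
  have lim: "(\<lambda>n. \<integral>\<^sup>+ x. ennreal \<bar>conv u0 (\<eta> n) x - u x\<bar> * indicator K x \<partial>lebesgue) \<longlonglongrightarrow> 0"
    if u0: "integrable lborel u0" and u: "AE y in lborel. indicator K' y *\<^sub>R u y = u0 y" for u0 u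
  proof (rule order_tendstoI)
    fix a :: ennreal assume "0 < a"
    then obtain e where e: "0 < e" "ennreal e < a"
    proof (cases a)
      case (real r)
      then show ?thesis using \<open>0 < a\<close> that[of "r / 2"] by (simp add: ennreal_less_iff)
    next
      case top
      then show ?thesis using that[of 1] by simp
    qed
    obtain d where d: "d > 0" "\<And>\<eta> r. mollifier r \<eta> \<Longrightarrow> r \<le> d \<Longrightarrow> (\<integral>\<^sup>+ x. ennreal \<bar>conv u0 \<eta> x - u0 x\<bar> \<partial>lborel) \<le> ennreal e"
      using conv_L1_close[OF u0 e(1)] by metis
    have "eventually (\<lambda>n. r n < d) sequentially" using rlim d(1) by (rule order_tendstoD)
    then show "eventually (\<lambda>n. (\<integral>\<^sup>+ x. ennreal \<bar>conv u0 (\<eta> n) x - u x\<bar> * indicator K x \<partial>lebesgue) < a) sequentially"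
    proof eventually_elim
      case (elim n)
      have "(\<integral>\<^sup>+ x. ennreal \<bar>conv u0 (\<eta> n) x - u x\<bar> * indicator K x \<partial>lebesgue) \<le> (\<integral>\<^sup>+ x. ennreal \<bar>conv u0 (\<eta> n) x - u0 x\<bar> \<partial>lborel)"
        by (rule L1_close_on_compact[OF Km KK' u])
      also have "\<dots> \<le> ennreal e" using d(2)[OF \<eta>] elim by simp
      finally show ?case using e(2) by simp
    qed
  qed auto
  have key: "pd js (conv f0 (\<eta> n)) x = conv (g0 js) (\<eta> n) x" if js: "length js \<le> k" and x: "x \<in> K" for js n x
  proof -
    have "cball x (r n) \<subseteq> cball x \<rho>" using r(2) by (rule subset_cball)
    then have "cball x (r n) \<subseteq> K'" using x unfolding K'eq by blast
    then show ?thesis by (rule conv_weak_deriv[OF S K' K'\<Omega> g[OF js] f0 g0(1)[OF js] g0(2)[OF js] \<eta>])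
  qed
  show thesis
  proof (rule that[of "\<lambda>n. conv f0 (\<eta> n)"])
    show "smooth (conv f0 (\<eta> n))" for n by (rule smooth_conv_mollifier[OF f0(1) \<eta>])
    show "(\<lambda>n. \<integral>\<^sup>+ x. ennreal \<bar>conv f0 (\<eta> n) x - f x\<bar> * indicator K x \<partial>lebesgue) \<longlonglongrightarrow> 0"
      by (rule lim[OF f0])
    fix js :: "'d list" assume js: "length js \<le> k"
    have "(\<integral>\<^sup>+ x. ennreal \<bar>pd js (conv f0 (\<eta> n)) x - g js x\<bar> * indicator K x \<partial>lebesgue) =
        (\<integral>\<^sup>+ x. ennreal \<bar>conv (g0 js) (\<eta> n) x - g js x\<bar> * indicator K x \<partial>lebesgue)" for n
      by (intro nn_integral_cong) (auto simp: indicator_def key[OF js])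
    then show "(\<lambda>n. \<integral>\<^sup>+ x. ennreal \<bar>pd js (conv f0 (\<eta> n)) x - g js x\<bar> * indicator K x \<partial>lebesgue) \<longlonglongrightarrow> 0"
      using lim[OF g0(1)[OF js] g0(2)[OF js]] by simp
    fix n
    have "(\<integral>\<^sup>+ x. ennreal (\<bar>pd js (conv f0 (\<eta> n)) x\<bar>\<^sup>2) * indicator K x \<partial>lebesgue) \<le> (\<integral>\<^sup>+ x. ennreal (\<bar>conv (g0 js) (\<eta> n) x\<bar>\<^sup>2) \<partial>lebesgue)"
      by (intro nn_integral_mono) (auto simp: indicator_def key[OF js])
    also have "\<dots> \<le> (\<integral>\<^sup>+ x. ennreal (\<bar>g0 js x\<bar>\<^sup>2) \<partial>lebesgue)"
      unfolding nn_integral_completion by (rule conv_L2_bound[OF g0(1)[OF js] \<eta>])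
    also have "\<dots> \<le> (\<integral>\<^sup>+ x. ennreal (\<bar>g js x\<bar>\<^sup>2) * indicator \<Omega> x \<partial>lebesgue)"
      by (rule nn_integral_mono_AE, rule AE_mp[OF AE_completion[OF g0(2)[OF js]]], rule AE_I2)
        (use K'\<Omega> in \<open>auto simp: indicator_def\<close>)
    finally show "(\<integral>\<^sup>+ x. ennreal (\<bar>pd js (conv f0 (\<eta> n)) x\<bar>\<^sup>2) * indicator K x \<partial>lebesgue)
        \<le> (\<integral>\<^sup>+ x. ennreal (\<bar>g js x\<bar>\<^sup>2) * indicator \<Omega> x \<partial>lebesgue)" .
  qed
qed

section \<open>Change of variables as an inequality\<close>

lemma emeasure_UN_le_count_space:
  assumes I: "countable I" and X: "\<And>i. i \<in> I \<Longrightarrow> X i \<in> sets M"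
  shows "emeasure M (\<Union>i\<in>I. X i) \<le> (\<integral>\<^sup>+ i. emeasure M (X i) \<partial>count_space I)"
proof -
  have "emeasure M (\<Union>i\<in>I. X i) = (\<integral>\<^sup>+ x. indicator (\<Union>i\<in>I. X i) x \<partial>M)"
    using sets.countable_UN'[OF I] X by (subst nn_integral_indicator) auto
  also have "\<dots> \<le> (\<integral>\<^sup>+ x. \<integral>\<^sup>+ i. indicator (X i) x \<partial>count_space I \<partial>M)"
  proof (rule nn_integral_mono)
    fix x
    show "indicator (\<Union>i\<in>I. X i) x \<le> (\<integral>\<^sup>+ i. indicator (X i) x \<partial>count_space I)"
    proof (cases "x \<in> (\<Union>i\<in>I. X i)")
      case True
      then obtain i where i: "i \<in> I" "x \<in> X i" by blast
      then show ?thesis using nn_integral_ge_point[of i I "\<lambda>i. indicator (X i) x"] True by simp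
    qed simp
  qed
  also have "\<dots> = (\<integral>\<^sup>+ i. \<integral>\<^sup>+ x. indicator (X i) x \<partial>M \<partial>count_space I)"
    by (rule nn_integral_count_space_nn_integral) (use I X in auto)
  also have "\<dots> = (\<integral>\<^sup>+ i. emeasure M (X i) \<partial>count_space I)"
    by (intro nn_integral_cong) (use X in auto)
  finally show ?thesis .
qed

text \<open>
  Cover \<open>E\<close> up to a null set by disjoint balls inside an open set of nearly the same measure (Vitali). A ball of
  radius \<open>r\<close> is mapped into a ball of radius \<open>L r\<close>, and null sets are mapped to null sets.
\<close>

proposition emeasure_image_le:
  fixes B :: "'a::euclidean_space \<Rightarrow> 'a"
  assumes Y: "open Y" and dB: "\<And>y. y \<in> Y \<Longrightarrow> (B has_derivative B' y) (at y)"
    and L: "L > 0" "\<And>y. y \<in> Y \<Longrightarrow> onorm (B' y) \<le> L"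
    and E: "E \<in> sets lebesgue" "E \<subseteq> Y"
  shows "emeasure lebesgue (B ` E) \<le> ennreal (L ^ DIM('a)) * emeasure lebesgue E"
proof -
  let ?c = "ennreal (L ^ DIM('a))"
  have diffE: "B differentiable_on T" if "T \<subseteq> Y" for T
    using dB that by (meson differentiable_at_withinI differentiable_def differentiable_on_def subsetD)
  have BE: "B ` E \<in> sets lebesgue"
    by (rule differentiable_image_in_sets_lebesgue[OF E(1) order_refl diffE[OF E(2)]])
  have "emeasure lebesgue (B ` E) \<le> ?c * emeasure lebesgue E + ennreal e" if e: "e > 0" for e
  proof -
    define e' where "e' = e / L ^ DIM('a)"
    have e': "e' > 0" using e L by (simp add: e'_def)
    obtain T where T: "open T" "E \<subseteq> T" "T - E \<in> lmeasurable" "emeasure lebesgue (T - E) < ennreal e'"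
      using sets_lebesgue_outer_open[OF E(1) e'] by metis
    define T' where "T' = T \<inter> Y"
    have T': "open T'" "E \<subseteq> T'" using T Y E by (auto simp: T'_def)
    define K where "K = {(x, r). x \<in> E \<and> 0 < r \<and> cball x r \<subseteq> T'}"
    have K1: "0 < snd i" if "i \<in> K" for i using that by (auto simp: K_def)
    have K2: "\<exists>i. i \<in> K \<and> x \<in> cball (fst i) (snd i) \<and> snd i < d" if "x \<in> E" "0 < d" for x d
    proof -
      have "x \<in> T'" using T'(2) that(1) by blast
      with T'(1)[unfolded open_contains_cball] obtain r where r: "r > 0" "cball x r \<subseteq> T'" by (meson bspec)
      have "cball x (min r (d / 2)) \<subseteq> T'" using r(2) subset_cball[of "min r (d / 2)" r x] by simp
      then have "(x, min r (d / 2)) \<in> K" using r(1) that by (simp add: K_def)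
      moreover have "min r (d / 2) < d" using that by (simp add: min_less_iff_disj)
      ultimately show ?thesis using r(1) that by (intro exI[of _ "(x, min r (d / 2))"]) simp
    qed
    obtain C where C: "countable C" "C \<subseteq> K"
      "pairwise (\<lambda>i j. disjnt (cball (fst i) (snd i)) (cball (fst j) (snd j))) C"
      "negligible (E - (\<Union>i\<in>C. cball (fst i) (snd i)))"
      by (rule Vitali_covering_theorem_cballs[of K snd E fst, OF K1 K2])
    let ?N = "E - (\<Union>i\<in>C. cball (fst i) (snd i))"
    let ?V = "\<Union>i\<in>C. cball (B (fst i)) (L * snd i)"
    have "negligible (B ` ?N)"
      by (rule negligible_differentiable_image_negligible[OF order_refl C(4) diffE]) (use E in auto)
    then have N: "B ` ?N \<in> null_sets lebesgue" by (simp add: negligible_iff_null_sets)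
    have V: "?V \<in> sets lebesgue" using C(1) by (intro sets.countable_UN') auto
    have "B ` E \<subseteq> ?V \<union> B ` ?N"
    proof
      fix z assume "z \<in> B ` E"
      then obtain y where y: "y \<in> E" "z = B y" by blast
      show "z \<in> ?V \<union> B ` ?N"
      proof (cases "y \<in> (\<Union>i\<in>C. cball (fst i) (snd i))")
        case True
        then obtain i where i: "i \<in> C" "y \<in> cball (fst i) (snd i)" by blast
        have sub: "cball (fst i) (snd i) \<subseteq> Y" "0 < snd i"
          using subsetD[OF C(2) i(1)] by (simp_all add: K_def T'_def split_def)
        have "norm (B y - B (fst i)) \<le> L * norm (y - fst i)"
        proof (rule differentiable_bound[of "cball (fst i) (snd i)" B B' L])
          fix x assume "x \<in> cball (fst i) (snd i)"
          then have "x \<in> Y" using sub(1) by blast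
          then show "(B has_derivative B' x) (at x within cball (fst i) (snd i))" "onorm (B' x) \<le> L"
            using dB L(2) by (auto intro: has_derivative_at_withinI)
        qed (use i sub in auto)
        also have "\<dots> \<le> L * snd i" using i L by (intro mult_left_mono) (auto simp: dist_norm norm_minus_commute)
        finally have "B y \<in> cball (B (fst i)) (L * snd i)" by (simp add: dist_norm norm_minus_commute)
        then show ?thesis using i y by blast
      qed (use y in auto)
    qed
    then have "emeasure lebesgue (B ` E) \<le> emeasure lebesgue (?V \<union> B ` ?N)"
      using V N by (intro emeasure_mono) auto
    also have "\<dots> = emeasure lebesgue ?V" by (rule emeasure_Un_null_set[OF V N])
    also have "\<dots> \<le> (\<integral>\<^sup>+ i. emeasure lebesgue (cball (B (fst i)) (L * snd i)) \<partial>count_space C)"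
      by (rule emeasure_UN_le_count_space[OF C(1)]) auto
    also have "\<dots> = (\<integral>\<^sup>+ i. ?c * emeasure lebesgue (cball (fst i) (snd i)) \<partial>count_space C)"
    proof (rule nn_integral_cong)
      fix i assume "i \<in> space (count_space C)"
      then have "i \<in> K" using C(2) by auto
      then have "0 \<le> snd i" using K1 less_imp_le by blast
      let ?v = "unit_ball_vol (real DIM('a))"
      have "emeasure lebesgue (cball (B (fst i)) (L * snd i)) = ennreal (?v * (L * snd i) ^ DIM('a))"
        using L \<open>0 \<le> snd i\<close> by (simp add: emeasure_cball)
      also have "?v * (L * snd i) ^ DIM('a) = L ^ DIM('a) * (?v * snd i ^ DIM('a))"
        by (simp add: power_mult_distrib)
      also have "ennreal \<dots> = ?c * ennreal (?v * snd i ^ DIM('a))"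
        by (rule ennreal_mult') (use L in simp)
      also have "ennreal (?v * snd i ^ DIM('a)) = emeasure lebesgue (cball (fst i) (snd i))"
        using \<open>0 \<le> snd i\<close> by (simp add: emeasure_cball)
      finally show "emeasure lebesgue (cball (B (fst i)) (L * snd i)) = ?c * emeasure lebesgue (cball (fst i) (snd i))" .
    qed
    also have "\<dots> = ?c * (\<integral>\<^sup>+ i. emeasure lebesgue (cball (fst i) (snd i)) \<partial>count_space C)"
      by (rule nn_integral_cmult) simp
    also have "(\<integral>\<^sup>+ i. emeasure lebesgue (cball (fst i) (snd i)) \<partial>count_space C) = emeasure lebesgue (\<Union>i\<in>C. cball (fst i) (snd i))"
      by (rule emeasure_UN_countable[symmetric]) (use C in \<open>auto simp: disjoint_family_on_def pairwise_def disjnt_def\<close>)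
    also have "emeasure lebesgue (\<Union>i\<in>C. cball (fst i) (snd i)) \<le> emeasure lebesgue T"
    proof (rule emeasure_mono)
      have "cball (fst i) (snd i) \<subseteq> T" if "i \<in> C" for i
        using subsetD[OF C(2) that] by (simp add: K_def T'_def split_def)
      then show "(\<Union>i\<in>C. cball (fst i) (snd i)) \<subseteq> T" by blast
    qed (use T in simp)
    also have "emeasure lebesgue T = emeasure lebesgue (E \<union> (T - E))" using T(2) by (simp add: Un_absorb1)
    also have "\<dots> \<le> emeasure lebesgue E + emeasure lebesgue (T - E)"
      using E(1) T(3) by (intro emeasure_subadditive) auto
    also have "\<dots> \<le> emeasure lebesgue E + ennreal e'" using T(4) by (intro add_left_mono) simp
    finally have "emeasure lebesgue (B ` E) \<le> ?c * (emeasure lebesgue E + ennreal e')"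
      by (simp add: mult_left_mono)
    also have "\<dots> = ?c * emeasure lebesgue E + ennreal e"
      using L e e' by (simp add: distrib_left e'_def flip: ennreal_mult)
    finally show ?thesis .
  qed
  then show ?thesis by (rule ennreal_le_epsilon)
qed

lemma abs_det_le:
  fixes J :: "real ^ 'n ^ 'n"
  assumes "\<And>i j. \<bar>J $ i $ j\<bar> \<le> M"
  shows "\<bar>det J\<bar> \<le> real (card {p. p permutes (UNIV :: 'n set)}) * M ^ CARD('n)"
proof -
  have "\<bar>det J\<bar> \<le> (\<Sum>p\<in>{p. p permutes (UNIV :: 'n set)}. \<bar>of_int (sign p) * (\<Prod>i\<in>UNIV. J $ i $ p i)\<bar>)"
    unfolding det_def by (rule sum_abs)
  also have "\<dots> \<le> (\<Sum>p\<in>{p. p permutes (UNIV :: 'n set)}. M ^ CARD('n))"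
  proof (rule sum_mono)
    fix p :: "'n \<Rightarrow> 'n"
    have "\<bar>of_int (sign p) * (\<Prod>i\<in>UNIV. J $ i $ p i)\<bar> = (\<Prod>i\<in>UNIV. \<bar>J $ i $ p i\<bar>)"
      by (simp add: abs_mult abs_prod sign_def)
    also have "\<dots> \<le> (\<Prod>i\<in>(UNIV :: 'n set). M)" by (intro prod_mono) (use assms in auto)
    finally show "\<bar>of_int (sign p) * (\<Prod>i\<in>UNIV. J $ i $ p i)\<bar> \<le> M ^ CARD('n)" by simp
  qed
  finally show ?thesis by simp
qed

text \<open>
  By Cramer's rule the coordinates of \<open>v\<close> are quotients of determinants; by scaling it suffices to consider
  \<open>v\<close> with \<open>|J v| = 1\<close>, where all entries in the numerator are at most \<open>M\<close>.
\<close>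

lemma norm_le_of_det:
  fixes J :: "real ^ 'n ^ 'n"
  assumes c: "c > 0" "c \<le> \<bar>det J\<bar>" and M: "M \<ge> 1" "\<And>i j. \<bar>J $ i $ j\<bar> \<le> M"
  shows "norm v \<le> CARD('n) * (real (card {p. p permutes (UNIV :: 'n set)}) * M ^ CARD('n) / c) * norm (J *v v)"
proof (cases "J *v v = 0")
  case True
  have "v $ k * det J = 0" for k
  proof -
    have "v $ k * det J = det (\<chi> i j. if j = k then (J *v v) $ i else J $ i $ j)"
      by (rule cramer_lemma[symmetric])
    also have "\<dots> = 0" by (rule det_zero_column(1)[of k]) (simp add: True column_def vec_eq_iff)
    finally show ?thesis .
  qed
  moreover have "det J \<noteq> 0" using c by auto
  ultimately have "v = 0" by (simp add: vec_eq_iff)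
  then show ?thesis by simp
next
  case False
  define w where "w = v /\<^sub>R norm (J *v v)"
  have Jw: "norm (J *v w) = 1" using False by (simp add: w_def matrix_vector_mult_scaleR)
  let ?D = "real (card {p. p permutes (UNIV :: 'n set)}) * M ^ CARD('n)"
  have wk: "\<bar>w $ k\<bar> \<le> ?D / c" for k
  proof -
    have "\<bar>w $ k * det J\<bar> = \<bar>det (\<chi> i j. if j = k then (J *v w) $ i else J $ i $ j)\<bar>"
      by (simp only: cramer_lemma)
    also have "\<dots> \<le> ?D"
    proof (rule abs_det_le)
      fix i j
      have "\<bar>(J *v w) $ i\<bar> \<le> M" using component_le_norm_cart[of "J *v w" i] Jw M(1) by simp
      then show "\<bar>(\<chi> i j. if j = k then (J *v w) $ i else J $ i $ j) $ i $ j\<bar> \<le> M" using M(2) by simp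
    qed
    finally have "\<bar>w $ k\<bar> * c \<le> ?D"
      using mult_left_mono[OF c(2), of "\<bar>w $ k\<bar>"] by (simp add: abs_mult)
    then show ?thesis using c(1) by (simp add: pos_le_divide_eq)
  qed
  have "norm w \<le> (\<Sum>k\<in>UNIV. \<bar>w $ k\<bar>)" by (rule norm_le_l1_cart)
  also have "\<dots> \<le> (\<Sum>k\<in>(UNIV :: 'n set). ?D / c)" by (intro sum_mono wk)
  finally have w: "norm w \<le> CARD('n) * (?D / c)" by simp
  have "norm v = norm w * norm (J *v v)" using False by (simp add: w_def)
  also have "\<dots> \<le> CARD('n) * (?D / c) * norm (J *v v)" by (rule mult_right_mono[OF w norm_ge_zero])
  finally show ?thesis .
qed

lemma inverse_derivative_bound:
  fixes A B :: "real ^ 'n \<Rightarrow> real ^ 'n"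
  assumes Y: "open Y" "y \<in> Y" and AB: "\<And>y. y \<in> Y \<Longrightarrow> A (B y) = y"
    and dA: "(A has_derivative A') (at (B y))" and dB: "(B has_derivative B') (at y)"
    and c: "c > 0" "c \<le> \<bar>det (matrix A')\<bar>" and M: "M \<ge> 1" "\<And>i j. \<bar>A' (axis j 1) $ i\<bar> \<le> M"
  shows "onorm B' \<le> CARD('n) * (real (card {p. p permutes (UNIV :: 'n set)}) * M ^ CARD('n) / c)"
proof (rule onorm_le)
  fix h
  have "((\<lambda>y. y) has_derivative (\<lambda>h. A' (B' h))) (at y)"
    by (rule has_derivative_transform_within_open[OF diff_chain_at[OF dB dA, unfolded o_def] Y]) (rule AB)
  then have AB': "A' (B' h) = h" for h
    using has_derivative_unique[OF _ has_derivative_ident] by metis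
  have "matrix A' *v v = A' v" for v
    using fun_cong[OF matrix_vector_mul(2)[OF has_derivative_linear[OF dA]]] by simp
  then have "matrix A' *v B' h = h" using AB' by simp
  then show "norm (B' h) \<le> CARD('n) * (real (card {p. p permutes (UNIV :: 'n set)}) * M ^ CARD('n) / c) * norm h"
    using norm_le_of_det[OF c M(1), of "B' h"] M(2) by (simp add: matrix_def)
qed

lemma diffeomorphism_measurable:
  fixes A :: "'a::euclidean_space \<Rightarrow> 'a"
  assumes XY: "open X" "open Y" "bij_betw A X Y" and dB: "inv_into X A differentiable_on Y"
  shows "A \<in> measurable (lebesgue_on X) (lebesgue_on Y)"
    "\<And>E. E \<subseteq> Y \<Longrightarrow> A -` E \<inter> X = inv_into X A ` E"
proof -
  show eq: "A -` E \<inter> X = inv_into X A ` E" if "E \<subseteq> Y" for E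
  proof (intro set_eqI iffI)
    fix x assume "x \<in> A -` E \<inter> X"
    then have "inv_into X A (A x) = x" "A x \<in> E" using XY(3) by (auto simp: bij_betw_def)
    then show "x \<in> inv_into X A ` E" by (metis imageI)
  next
    fix x assume "x \<in> inv_into X A ` E"
    then obtain y where "y \<in> E" "x = inv_into X A y" by blast
    moreover have "y \<in> A ` X" using \<open>y \<in> E\<close> that XY(3) by (auto simp: bij_betw_def)
    ultimately show "x \<in> A -` E \<inter> X" by (simp add: inv_into_into f_inv_into_f)
  qed
  show "A \<in> measurable (lebesgue_on X) (lebesgue_on Y)"
  proof (rule measurableI)
    show "A x \<in> space (lebesgue_on Y)" if "x \<in> space (lebesgue_on X)" for x
      using that XY by (auto simp: bij_betw_def)
    fix E assume "E \<in> sets (lebesgue_on Y)"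
    then have E: "E \<in> sets lebesgue" "E \<subseteq> Y" using XY(2) by (auto simp: sets_restrict_space_iff)
    have "inv_into X A ` E \<in> sets lebesgue"
      by (rule differentiable_image_in_sets_lebesgue[OF E(1) order_refl differentiable_on_subset[OF dB E(2)]])
    then show "A -` E \<inter> space (lebesgue_on X) \<in> sets (lebesgue_on X)"
      using eq[OF E(2)] XY(1) by (auto simp: sets_restrict_space_iff)
  qed
qed

lemma nn_integral_diffeomorphism_le:
  fixes A :: "'a::euclidean_space \<Rightarrow> 'a" and u :: "'a \<Rightarrow> ennreal"
  assumes XY: "open X" "open Y" "bij_betw A X Y"
    and dB: "\<And>y. y \<in> Y \<Longrightarrow> (inv_into X A has_derivative B' y) (at y)"
    and L: "L > 0" "\<And>y. y \<in> Y \<Longrightarrow> onorm (B' y) \<le> L"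
    and u: "u \<in> borel_measurable (lebesgue_on Y)"
  shows "(\<integral>\<^sup>+ x. u (A x) \<partial>lebesgue_on X) \<le> ennreal (L ^ DIM('a)) * (\<integral>\<^sup>+ y. u y \<partial>lebesgue_on Y)"
proof -
  let ?c = "ennreal (L ^ DIM('a))"
  have "inv_into X A differentiable_on Y"
    using dB by (meson differentiable_at_withinI differentiable_def differentiable_on_def)
  note m = diffeomorphism_measurable[OF XY this]
  have "(\<integral>\<^sup>+ x. u (A x) \<partial>lebesgue_on X) = (\<integral>\<^sup>+ y. u y \<partial>distr (lebesgue_on X) (lebesgue_on Y) A)"
    by (rule nn_integral_distr[symmetric]) (use m u in auto)
  also have "\<dots> \<le> (\<integral>\<^sup>+ y. u y \<partial>scale_measure ?c (lebesgue_on Y))"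
  proof (rule nn_integral_mono_measure)
    show "distr (lebesgue_on X) (lebesgue_on Y) A \<le> scale_measure ?c (lebesgue_on Y)"
    proof (subst le_measure)
      show "\<forall>E\<in>sets (distr (lebesgue_on X) (lebesgue_on Y) A).
          emeasure (distr (lebesgue_on X) (lebesgue_on Y) A) E \<le> emeasure (scale_measure ?c (lebesgue_on Y)) E"
      proof
        fix E assume "E \<in> sets (distr (lebesgue_on X) (lebesgue_on Y) A)"
        then have Es: "E \<in> sets (lebesgue_on Y)" by simp
        then have E: "E \<in> sets lebesgue" "E \<subseteq> Y" using XY(2) by (auto simp: sets_restrict_space_iff)
        have "inv_into X A ` E \<subseteq> X" using m(2)[OF E(2)] by blast
        then have "emeasure (distr (lebesgue_on X) (lebesgue_on Y) A) E = emeasure lebesgue (inv_into X A ` E)"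
          using m(1) Es XY m(2)[OF E(2)] by (simp add: emeasure_distr emeasure_restrict_space)
        also have "\<dots> \<le> ?c * emeasure lebesgue E"
          by (rule emeasure_image_le[OF XY(2) dB L E])
        also have "\<dots> = emeasure (scale_measure ?c (lebesgue_on Y)) E"
          using E XY by (simp add: emeasure_restrict_space)
        finally show "emeasure (distr (lebesgue_on X) (lebesgue_on Y) A) E \<le> emeasure (scale_measure ?c (lebesgue_on Y)) E" .
      qed
    qed simp
  qed simp
  also have "\<dots> = ?c * (\<integral>\<^sup>+ y. u y \<partial>lebesgue_on Y)" by (rule nn_integral_scale_measure[OF u])
  finally show ?thesis .
qed

section \<open>Uniqueness of weak derivatives\<close>

lemma AE_open_by_compacts:
  fixes \<Omega> :: "'a::euclidean_space set"
  assumes S: "open \<Omega>" and K: "\<And>K. compact K \<Longrightarrow> K \<subseteq> \<Omega> \<Longrightarrow> AE x in lebesgue. x \<in> K \<longrightarrow> P x"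
  shows "AE x in lebesgue_on \<Omega>. P x"
proof -
  obtain C :: "nat \<Rightarrow> 'a set" where C: "\<And>n. compact (C n)" "\<And>n. C n \<subseteq> \<Omega>" "\<Union>(range C) = \<Omega>"
    using open_Union_compact_subsets[OF S] by metis
  have "AE x in lebesgue. \<forall>n. x \<in> C n \<longrightarrow> P x"
    unfolding AE_all_countable using K C by blast
  then have "AE x in lebesgue. x \<in> \<Omega> \<longrightarrow> P x" by eventually_elim (use C(3) in blast)
  then show ?thesis using S by (simp add: AE_restrict_space_iff)
qed

lemma locally_integrable_measurable:
  assumes S: "open \<Omega>" and f: "locally_integrable_on f \<Omega>"
  shows "f \<in> borel_measurable (lebesgue_on \<Omega>)"
proof -
  obtain C :: "nat \<Rightarrow> (real ^ 'a) set" where C: "\<And>n. compact (C n)" "\<And>n. C n \<subseteq> \<Omega>"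
      and ex: "\<And>K. compact K \<Longrightarrow> K \<subseteq> \<Omega> \<Longrightarrow> \<exists>N. \<forall>n\<ge>N. K \<subseteq> C n"
    using open_Union_compact_subsets[OF S] by metis
  have "(\<lambda>x. if x \<in> \<Omega> then f x else 0) \<in> borel_measurable lebesgue"
  proof (rule borel_measurable_LIMSEQ_real)
    show "(\<lambda>x. indicator (C n) x *\<^sub>R f x) \<in> borel_measurable lebesgue" for n
      using f C by (auto simp: locally_integrable_on_def set_integrable_def)
    fix x
    show "(\<lambda>n. indicator (C n) x *\<^sub>R f x) \<longlonglongrightarrow> (if x \<in> \<Omega> then f x else 0)"
    proof (cases "x \<in> \<Omega>")
      case True
      obtain N where "\<And>n. n \<ge> N \<Longrightarrow> x \<in> C n" using ex[of "{x}"] True by auto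
      then have "eventually (\<lambda>n. indicator (C n) x *\<^sub>R f x = f x) sequentially"
        unfolding eventually_sequentially by (intro exI[of _ N]) auto
      then show ?thesis using True by (simp add: tendsto_eventually)
    next
      case False
      then have "x \<notin> C n" for n using C(2) by blast
      then show ?thesis using False by simp
    qed
  qed
  then show ?thesis by (rule borel_measurable_if_D)
qed

text \<open>
  Two limits of the same sequence in \<open>L\<^sup>1(K)\<close>.
\<close>

lemma L1_limit_unique:
  fixes f g :: "'a::euclidean_space \<Rightarrow> real" and F :: "nat \<Rightarrow> 'a \<Rightarrow> real"
  assumes K: "K \<in> sets lebesgue"
    and m: "(\<lambda>x. indicator K x *\<^sub>R f x) \<in> borel_measurable lebesgue" "(\<lambda>x. indicator K x *\<^sub>R g x) \<in> borel_measurable lebesgue"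
      "\<And>n. (\<lambda>x. indicator K x *\<^sub>R F n x) \<in> borel_measurable lebesgue"
    and f: "(\<lambda>n. \<integral>\<^sup>+ x. ennreal \<bar>F n x - f x\<bar> * indicator K x \<partial>lebesgue) \<longlonglongrightarrow> 0"
    and g: "(\<lambda>n. \<integral>\<^sup>+ x. ennreal \<bar>F n x - g x\<bar> * indicator K x \<partial>lebesgue) \<longlonglongrightarrow> 0"
  shows "AE x in lebesgue. x \<in> K \<longrightarrow> f x = g x"
proof -
  define G where "G n x = indicator K x *\<^sub>R F n x" for n x
  define a where "a x = indicator K x *\<^sub>R f x" for x
  define b where "b x = indicator K x *\<^sub>R g x" for x
  have [measurable]: "a \<in> borel_measurable lebesgue" "b \<in> borel_measurable lebesgue" "G n \<in> borel_measurable lebesgue" for n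
    using m unfolding a_def b_def G_def by auto
  have ea: "ennreal \<bar>F n x - f x\<bar> * indicator K x = ennreal \<bar>G n x - a x\<bar>"
    "ennreal \<bar>F n x - g x\<bar> * indicator K x = ennreal \<bar>G n x - b x\<bar>" for n x
    by (auto simp: G_def a_def b_def indicator_def)
  have "(\<integral>\<^sup>+ x. ennreal \<bar>a x - b x\<bar> \<partial>lebesgue) \<le> (\<integral>\<^sup>+ x. ennreal \<bar>G n x - a x\<bar> \<partial>lebesgue) + (\<integral>\<^sup>+ x. ennreal \<bar>G n x - b x\<bar> \<partial>lebesgue)" for n
  proof -
    have "(\<integral>\<^sup>+ x. ennreal \<bar>a x - b x\<bar> \<partial>lebesgue) \<le> (\<integral>\<^sup>+ x. ennreal \<bar>G n x - a x\<bar> + ennreal \<bar>G n x - b x\<bar> \<partial>lebesgue)"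
      by (intro nn_integral_mono) (simp flip: ennreal_plus)
    then show ?thesis by (simp add: nn_integral_add)
  qed
  moreover have "(\<lambda>n. (\<integral>\<^sup>+ x. ennreal \<bar>G n x - a x\<bar> \<partial>lebesgue) + (\<integral>\<^sup>+ x. ennreal \<bar>G n x - b x\<bar> \<partial>lebesgue)) \<longlonglongrightarrow> 0 + 0"
    using f g unfolding ea by (rule tendsto_add)
  ultimately have "(\<integral>\<^sup>+ x. ennreal \<bar>a x - b x\<bar> \<partial>lebesgue) \<le> 0"
    by (intro LIMSEQ_le_const[where X = "\<lambda>n. (\<integral>\<^sup>+ x. ennreal \<bar>G n x - a x\<bar> \<partial>lebesgue) + (\<integral>\<^sup>+ x. ennreal \<bar>G n x - b x\<bar> \<partial>lebesgue)"]) auto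
  then have "AE x in lebesgue. ennreal \<bar>a x - b x\<bar> = 0"
    by (subst nn_integral_0_iff_AE[symmetric]) auto
  then show ?thesis by eventually_elim (auto simp: a_def b_def)
qed

lemma smooth_locally_integrable:
  assumes "smooth (F :: real ^ 'd \<Rightarrow> real)"
  shows "locally_integrable_on F \<Omega>"
  unfolding locally_integrable_on_def set_integrable_def
proof (intro allI impI)
  fix K :: "(real ^ 'd) set" assume "compact K \<and> K \<subseteq> \<Omega>"
  then have i: "integrable lborel (\<lambda>x. indicator K x *\<^sub>R F x)"
    by (intro borel_integrable_compact smooth_continuous[OF assms]) auto
  then show "integrable lebesgue (\<lambda>x. indicator K x *\<^sub>R F x)"
    by (subst integrable_completion) auto
qed

text \<open>
  If \<open>g\<close> and \<open>h\<close> are weak derivatives of \<open>f\<close>, then \<open>h\<close> is a weak derivative of \<open>g\<close> of order zero. Smooth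
  approximations of \<open>g\<close> therefore converge to both \<open>g\<close> and \<open>h\<close>.
\<close>

theorem weak_deriv_unique:
  assumes S: "open \<Omega>" and g: "has_weak_deriv \<Omega> \<alpha> f g" and h: "has_weak_deriv \<Omega> \<alpha> f h"
  shows "AE x in lebesgue_on \<Omega>. g x = h x"
proof (rule AE_open_by_compacts[OF S])
  fix K :: "(real ^ 'a) set" assume K: "compact K" "K \<subseteq> \<Omega>"
  have \<alpha>: "\<alpha> = count (mset (canon \<alpha>))" using canon_perm[of "canon \<alpha>" \<alpha>] by simp
  have li: "locally_integrable_on g \<Omega>" "locally_integrable_on h \<Omega>" using g h by (auto simp: has_weak_deriv_def)
  have gh: "has_weak_deriv \<Omega> (count (mset [])) g h"
  proof (subst has_weak_deriv_list, intro conjI ballI li)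
    fix \<phi> assume \<phi>: "\<phi> \<in> test_functions \<Omega>"
    have "(-1) ^ mi_order \<alpha> * (LINT x|lebesgue_on \<Omega>. g x * \<phi> x) = (-1) ^ mi_order \<alpha> * (LINT x|lebesgue_on \<Omega>. h x * \<phi> x)"
    proof -
      have "(LINT x|lebesgue_on \<Omega>. f x * mderiv \<alpha> \<phi> x) = (-1) ^ mi_order \<alpha> * (LINT x|lebesgue_on \<Omega>. g x * \<phi> x)"
        using g \<phi> unfolding has_weak_deriv_def by blast
      moreover have "(LINT x|lebesgue_on \<Omega>. f x * mderiv \<alpha> \<phi> x) = (-1) ^ mi_order \<alpha> * (LINT x|lebesgue_on \<Omega>. h x * \<phi> x)"
        using h \<phi> unfolding has_weak_deriv_def by blast
      ultimately show ?thesis by (simp only:)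
    qed
    then show "(LINT x|lebesgue_on \<Omega>. g x * pd [] \<phi> x) = (-1) ^ length [] * (LINT x|lebesgue_on \<Omega>. h x * \<phi> x)" by simp
  qed
  have g0: "has_weak_deriv \<Omega> (count (mset js)) g h" if "length js \<le> 0" for js :: "'a list"
    using gh that by simp
  obtain F :: "nat \<Rightarrow> real ^ 'a \<Rightarrow> real" where F: "\<And>n. smooth (F n)"
    "(\<lambda>n. \<integral>\<^sup>+ x. ennreal \<bar>F n x - g x\<bar> * indicator K x \<partial>lebesgue) \<longlonglongrightarrow> 0"
    "\<And>js. length js \<le> 0 \<Longrightarrow> (\<lambda>n. \<integral>\<^sup>+ x. ennreal \<bar>pd js (F n) x - h x\<bar> * indicator K x \<partial>lebesgue) \<longlonglongrightarrow> 0"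
    "\<And>js n. length js \<le> 0 \<Longrightarrow> (\<integral>\<^sup>+ x. ennreal (\<bar>pd js (F n) x\<bar>\<^sup>2) * indicator K x \<partial>lebesgue)
        \<le> (\<integral>\<^sup>+ x. ennreal (\<bar>h x\<bar>\<^sup>2) * indicator \<Omega> x \<partial>lebesgue)"
    by (rule smooth_approximation[where k = 0 and g = "\<lambda>_. h", OF S K li(1) g0], assumption) (rule that; fast)
  have m: "(\<lambda>x. indicator K x *\<^sub>R u x) \<in> borel_measurable lebesgue" if "locally_integrable_on u \<Omega>" for u
    using that K by (auto simp: locally_integrable_on_def set_integrable_def)
  show "AE x in lebesgue. x \<in> K \<longrightarrow> g x = h x"
  proof (rule L1_limit_unique[where F = F])
    show "(\<lambda>n. \<integral>\<^sup>+ x. ennreal \<bar>F n x - h x\<bar> * indicator K x \<partial>lebesgue) \<longlonglongrightarrow> 0" using F(3)[of "[]"] by simp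
  qed (use K m[OF li(1)] m[OF li(2)] m[OF smooth_locally_integrable[OF F(1)]] F(2) in \<open>auto simp: lmeasurable_compact fmeasurableD\<close>)
qed

section \<open>The chain rule for weak derivatives\<close>

text \<open>
  All that the chain rule and the norm estimates need to know about volumes under \<open>A\<close>. Taking \<open>u\<close> to be an
  indicator shows that preimages of null sets are null sets.
\<close>

definition controlled_map ::
  "(real ^ 'd) set \<Rightarrow> (real ^ 'd) set \<Rightarrow> (real ^ 'd \<Rightarrow> real ^ 'd) \<Rightarrow> real \<Rightarrow> bool" where
  "controlled_map X Y A c \<longleftrightarrow> open X \<and> open Y \<and> A ` X \<subseteq> Y \<and> continuous_on X A \<and>
     A \<in> measurable (lebesgue_on X) (lebesgue_on Y) \<and> 0 \<le> c \<and>
     (\<forall>u\<in>borel_measurable (lebesgue_on Y).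
        (\<integral>\<^sup>+ x. u (A x) \<partial>lebesgue_on X) \<le> ennreal c * (\<integral>\<^sup>+ y. u y \<partial>lebesgue_on Y))"

lemma controlled_map_AE:
  assumes A: "controlled_map X Y A c" and P: "AE y in lebesgue_on Y. P y"
  shows "AE x in lebesgue_on X. P (A x)"
proof -
  obtain N where N: "N \<in> null_sets (lebesgue_on Y)" "{y \<in> space (lebesgue_on Y). \<not> P y} \<subseteq> N"
    using P by (auto simp: eventually_ae_filter)
  have m: "A \<in> measurable (lebesgue_on X) (lebesgue_on Y)" using A by (simp add: controlled_map_def)
  have Ns: "N \<in> sets (lebesgue_on Y)" using N by auto
  have "(\<integral>\<^sup>+ x. indicator N (A x) \<partial>lebesgue_on X) \<le> ennreal c * (\<integral>\<^sup>+ y. indicator N y \<partial>lebesgue_on Y)"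
    using A Ns unfolding controlled_map_def by (meson borel_measurable_indicator)
  also have "\<dots> = 0" using N by (simp add: null_setsD1 Ns)
  finally have "(\<integral>\<^sup>+ x. indicator N (A x) \<partial>lebesgue_on X) = 0" by simp
  moreover have "(\<lambda>x. indicator N (A x) :: ennreal) \<in> borel_measurable (lebesgue_on X)"
    by (rule measurable_compose[OF m]) (use Ns in auto)
  ultimately have "AE x in lebesgue_on X. (indicator N (A x) :: ennreal) = 0"
    using nn_integral_0_iff_AE by blast
  moreover have "AE x in lebesgue_on X. A x \<in> space (lebesgue_on Y)"
    using measurable_space[OF m] by (intro AE_I2)
  ultimately show ?thesis by eventually_elim (use N(2) in \<open>auto simp: indicator_def split: if_splits\<close>)
qed

lemma locally_integrable_compose:
  assumes A: "controlled_map X Y A c" and u: "locally_integrable_on u Y"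
  shows "locally_integrable_on (\<lambda>x. u (A x)) X"
  unfolding locally_integrable_on_def
proof (intro allI impI)
  fix K assume K: "compact K \<and> K \<subseteq> X"
  have o: "open X" "open Y" "A ` X \<subseteq> Y" and cA: "continuous_on X A"
    and m: "A \<in> measurable (lebesgue_on X) (lebesgue_on Y)"
    and le: "\<And>u. u \<in> borel_measurable (lebesgue_on Y) \<Longrightarrow> (\<integral>\<^sup>+ x. u (A x) \<partial>lebesgue_on X) \<le> ennreal c * (\<integral>\<^sup>+ y. u y \<partial>lebesgue_on Y)"
    using A by (auto simp: controlled_map_def)
  have AK: "compact (A ` K)" "A ` K \<subseteq> Y" using K cA o compact_continuous_image continuous_on_subset by blast+
  have sets: "K \<in> sets lebesgue" "A ` K \<in> sets lebesgue" "X \<in> sets lebesgue" "Y \<in> sets lebesgue"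
    using K AK o by (auto simp: lmeasurable_compact fmeasurableD)
  have um: "u \<in> borel_measurable (lebesgue_on Y)" by (rule locally_integrable_measurable[OF o(2) u])
  have AKm: "A ` K \<in> sets (lebesgue_on Y)" using sets AK by (simp add: sets_restrict_space_iff)
  have "(\<lambda>x. u (A x)) \<in> borel_measurable (lebesgue_on X)" by (rule measurable_compose[OF m um])
  then have "(\<lambda>x. if x \<in> X then u (A x) else 0) \<in> borel_measurable lebesgue" using sets by (simp add: borel_measurable_if)
  then have "(\<lambda>x. indicator K x *\<^sub>R (if x \<in> X then u (A x) else 0)) \<in> borel_measurable lebesgue"
    using sets by simp
  also have "(\<lambda>x. indicator K x *\<^sub>R (if x \<in> X then u (A x) else 0)) = (\<lambda>x. indicator K x *\<^sub>R u (A x))"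
    using K by (auto simp: indicator_def fun_eq_iff)
  finally have meas: "(\<lambda>x. indicator K x *\<^sub>R u (A x)) \<in> borel_measurable lebesgue" .
  have "(\<integral>\<^sup>+ x. ennreal (norm (indicator K x *\<^sub>R u (A x))) \<partial>lebesgue) = (\<integral>\<^sup>+ x. (ennreal \<bar>u (A x)\<bar> * indicator K x) * indicator X x \<partial>lebesgue)"
    by (intro nn_integral_cong) (use K in \<open>auto simp: indicator_def\<close>)
  also have "\<dots> = (\<integral>\<^sup>+ x. ennreal \<bar>u (A x)\<bar> * indicator K x \<partial>lebesgue_on X)"
    using sets by (subst nn_integral_restrict_space) auto
  also have "\<dots> \<le> (\<integral>\<^sup>+ x. ennreal \<bar>u (A x)\<bar> * indicator (A ` K) (A x) \<partial>lebesgue_on X)"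
    by (intro nn_integral_mono mult_left_mono) (auto simp: indicator_def)
  also have "\<dots> \<le> ennreal c * (\<integral>\<^sup>+ y. ennreal \<bar>u y\<bar> * indicator (A ` K) y \<partial>lebesgue_on Y)"
    by (rule le) (use um AKm in measurable)
  also have "(\<integral>\<^sup>+ y. ennreal \<bar>u y\<bar> * indicator (A ` K) y \<partial>lebesgue_on Y) = (\<integral>\<^sup>+ y. ennreal (norm (indicator (A ` K) y *\<^sub>R u y)) \<partial>lebesgue)"
  proof -
    have "indicator (A ` K) y * indicator Y y = (indicator (A ` K) y :: ennreal)" for y
      by (cases "y \<in> A ` K") (use subsetD[OF AK(2)] in auto)
    then have "(\<integral>\<^sup>+ y. ennreal \<bar>u y\<bar> * indicator (A ` K) y \<partial>lebesgue_on Y) = (\<integral>\<^sup>+ y. ennreal \<bar>u y\<bar> * indicator (A ` K) y \<partial>lebesgue)"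
      using sets by (subst nn_integral_restrict_space) (auto simp: mult.assoc)
    then show ?thesis by (simp only:) (intro nn_integral_cong, auto simp: indicator_def)
  qed
  also have "ennreal c * \<dots> < \<infinity>"
  proof -
    have "integrable lebesgue (\<lambda>y. indicator (A ` K) y *\<^sub>R u y)"
      using u AK by (simp add: locally_integrable_on_def set_integrable_def)
    then show ?thesis by (simp add: integrable_iff_bounded ennreal_mult_less_top)
  qed
  finally show "(\<lambda>x. u (A x)) absolutely_integrable_on K"
    unfolding set_integrable_def by (intro integrableI_bounded meas)
qed

lemma locally_integrable_mult:
  assumes v: "locally_integrable_on v X" and w: "continuous_on X w"
  shows "locally_integrable_on (\<lambda>x. w x * v x) X"
  unfolding locally_integrable_on_def
proof (intro allI impI)
  fix K assume K: "compact K \<and> K \<subseteq> X"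
  then have cw: "continuous_on K w" using w continuous_on_subset by blast
  show "(\<lambda>x. w x * v x) absolutely_integrable_on K"
  proof (rule absolutely_integrable_bounded_measurable_product[OF bilinear_times])
    show s: "K \<in> sets lebesgue" using K by (simp add: lmeasurable_compact fmeasurableD)
    show "w \<in> borel_measurable (lebesgue_on K)" using cw s by (rule continuous_imp_measurable_on_sets_lebesgue)
    show "bounded (w ` K)" using compact_continuous_image[OF cw] K compact_imp_bounded by blast
    show "v absolutely_integrable_on K" using v K by (simp add: locally_integrable_on_def)
  qed
qed

lemma locally_integrable_sum:
  assumes "finite I" "\<And>i. i \<in> I \<Longrightarrow> locally_integrable_on (v i) X"
  shows "locally_integrable_on (\<lambda>x. \<Sum>i\<in>I. v i x) X"
  using assms unfolding locally_integrable_on_def by (auto intro!: absolutely_integrable_sum)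

lemma integrable_compactly_supported_product:
  assumes X: "open X" and v: "locally_integrable_on v X" and w: "continuous_on X w"
    and K: "compact K" "K \<subseteq> X" "\<And>x. x \<notin> K \<Longrightarrow> w x = 0"
  shows "integrable (lebesgue_on X) (\<lambda>x. v x * w x)"
proof -
  have "(\<lambda>x. w x * v x) absolutely_integrable_on K"
    using locally_integrable_mult[OF v w] K by (simp add: locally_integrable_on_def)
  then have "integrable lebesgue (\<lambda>x. indicator K x *\<^sub>R (w x * v x))" by (simp add: set_integrable_def)
  also have "(\<lambda>x. indicator K x *\<^sub>R (w x * v x)) = (\<lambda>x. indicator X x *\<^sub>R (v x * w x))"
    using K by (auto simp: indicator_def fun_eq_iff)
  finally show ?thesis using X by (subst integrable_restrict_space) auto
qed

text \<open>
  \<open>L\<^sup>1\<close>-convergence on the compact set \<open>A ` K\<close> passes to the compositions on \<open>K\<close>.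
\<close>

lemma integral_compose_tendsto:
  assumes A: "controlled_map X Y A c" and un: "\<And>n. locally_integrable_on (un n) Y" and u: "locally_integrable_on u Y"
    and K: "compact K" "K \<subseteq> X" and w: "continuous_on X w" "\<And>x. x \<notin> K \<Longrightarrow> w x = 0"
    and lim: "(\<lambda>n. \<integral>\<^sup>+ y. ennreal \<bar>un n y - u y\<bar> * indicator (A ` K) y \<partial>lebesgue) \<longlonglongrightarrow> 0"
  shows "(\<lambda>n. LINT x|lebesgue_on X. un n (A x) * w x) \<longlonglongrightarrow> (LINT x|lebesgue_on X. u (A x) * w x)"
proof (rule tendsto_L1_int)
  have o: "open X" "open Y" "A ` X \<subseteq> Y" and cA: "continuous_on X A"
    and le: "\<And>u. u \<in> borel_measurable (lebesgue_on Y) \<Longrightarrow> (\<integral>\<^sup>+ x. u (A x) \<partial>lebesgue_on X) \<le> ennreal c * (\<integral>\<^sup>+ y. u y \<partial>lebesgue_on Y)"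
    using A by (auto simp: controlled_map_def)
  show "integrable (lebesgue_on X) (\<lambda>x. un n (A x) * w x)" for n
    by (rule integrable_compactly_supported_product[OF o(1) locally_integrable_compose[OF A un] w(1) K w(2)])
  show "integrable (lebesgue_on X) (\<lambda>x. u (A x) * w x)"
    by (rule integrable_compactly_supported_product[OF o(1) locally_integrable_compose[OF A u] w(1) K w(2)])
  have AK: "compact (A ` K)" "A ` K \<subseteq> Y" using K cA o compact_continuous_image continuous_on_subset by blast+
  have AKs: "A ` K \<in> sets lebesgue" "Y \<in> sets lebesgue" using AK o by (auto simp: lmeasurable_compact fmeasurableD)
  then have AKm: "A ` K \<in> sets (lebesgue_on Y)" using AK by (simp add: sets_restrict_space_iff)
  have um: "u \<in> borel_measurable (lebesgue_on Y)" "\<And>n. un n \<in> borel_measurable (lebesgue_on Y)"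
    using locally_integrable_measurable[OF o(2)] u un by auto
  have "compact (w ` K)" using compact_continuous_image[OF continuous_on_subset[OF w(1) K(2)] K(1)] .
  then obtain W where W: "W > 0" "\<And>x. x \<in> K \<Longrightarrow> \<bar>w x\<bar> \<le> W"
    using compact_imp_bounded bounded_pos by (metis imageI real_norm_def)
  have bound: "(\<integral>\<^sup>+ x. ennreal (norm (un n (A x) * w x - u (A x) * w x)) \<partial>lebesgue_on X)
      \<le> ennreal W * ennreal c * (\<integral>\<^sup>+ y. ennreal \<bar>un n y - u y\<bar> * indicator (A ` K) y \<partial>lebesgue)" for n
  proof -
    have "(\<integral>\<^sup>+ x. ennreal (norm (un n (A x) * w x - u (A x) * w x)) \<partial>lebesgue_on X)
       \<le> (\<integral>\<^sup>+ x. ennreal W * (ennreal \<bar>un n (A x) - u (A x)\<bar> * indicator (A ` K) (A x)) \<partial>lebesgue_on X)"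
    proof (rule nn_integral_mono)
      fix x
      show "ennreal (norm (un n (A x) * w x - u (A x) * w x)) \<le> ennreal W * (ennreal \<bar>un n (A x) - u (A x)\<bar> * indicator (A ` K) (A x))"
      proof (cases "x \<in> K")
        case True
        have "norm (un n (A x) * w x - u (A x) * w x) = \<bar>w x\<bar> * \<bar>un n (A x) - u (A x)\<bar>"
          by (simp add: abs_mult[symmetric] algebra_simps)
        also have "\<dots> \<le> W * \<bar>un n (A x) - u (A x)\<bar>" by (rule mult_right_mono[OF W(2)[OF True]]) simp
        finally have "ennreal (norm (un n (A x) * w x - u (A x) * w x)) \<le> ennreal (W * \<bar>un n (A x) - u (A x)\<bar>)" by (rule ennreal_leI)
        then show ?thesis using True W(1) by (simp add: ennreal_mult)
      next
        case False
        then show ?thesis using w(2) by simp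
      qed
    qed
    also have "\<dots> \<le> ennreal c * (\<integral>\<^sup>+ y. ennreal W * (ennreal \<bar>un n y - u y\<bar> * indicator (A ` K) y) \<partial>lebesgue_on Y)"
      by (rule le) (use um AKm in measurable)
    also have "(\<integral>\<^sup>+ y. ennreal W * (ennreal \<bar>un n y - u y\<bar> * indicator (A ` K) y) \<partial>lebesgue_on Y)
        = ennreal W * (\<integral>\<^sup>+ y. ennreal \<bar>un n y - u y\<bar> * indicator (A ` K) y \<partial>lebesgue_on Y)"
      by (rule nn_integral_cmult) (use um AKm in measurable)
    also have "(\<integral>\<^sup>+ y. ennreal \<bar>un n y - u y\<bar> * indicator (A ` K) y \<partial>lebesgue_on Y) = (\<integral>\<^sup>+ y. ennreal \<bar>un n y - u y\<bar> * indicator (A ` K) y \<partial>lebesgue)"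
    proof -
      have "indicator (A ` K) y * indicator Y y = (indicator (A ` K) y :: ennreal)" for y
        by (cases "y \<in> A ` K") (use subsetD[OF AK(2)] in auto)
      then show ?thesis using AKs by (subst nn_integral_restrict_space) (auto simp: mult.assoc)
    qed
    finally show ?thesis by (simp add: mult_ac)
  qed
  have "(\<lambda>n. ennreal W * ennreal c * (\<integral>\<^sup>+ y. ennreal \<bar>un n y - u y\<bar> * indicator (A ` K) y \<partial>lebesgue)) \<longlonglongrightarrow> ennreal W * ennreal c * 0"
    by (rule ennreal_tendsto_cmult[OF _ lim]) (simp add: ennreal_mult_less_top)
  then have "(\<lambda>n. ennreal W * ennreal c * (\<integral>\<^sup>+ y. ennreal \<bar>un n y - u y\<bar> * indicator (A ` K) y \<partial>lebesgue)) \<longlonglongrightarrow> 0" by simp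
  then show "(\<lambda>n. \<integral>\<^sup>+ x. ennreal (norm (un n (A x) * w x - u (A x) * w x)) \<partial>lebesgue_on X) \<longlonglongrightarrow> 0"
    by (rule tendsto_sandwich[OF _ _ tendsto_const, rotated -1]) (use bound in auto)
qed

text \<open>
  The classical formula holds for the smooth approximations \<open>F n\<close> of \<open>f\<close>; both sides, tested against
  \<open>\<phi>\<close>, converge. The classical rule is applied to the reversed list because integration by parts reverses
  the order of differentiation.
\<close>

theorem weak_chain_rule:
  fixes A :: "real ^ 'd \<Rightarrow> real ^ 'd"
  assumes A: "controlled_map X Y A c" and dA: "A differentiable_on X" and CA: "\<And>l. Ckb True m X (\<lambda>x. A x $ l)"
    and js: "length js \<le> m"
  shows "\<exists>P. (\<forall>is \<in> lists_upto (length js). Ckb True (m - length js) X (P is)) \<and>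
     (\<forall>f g. (\<forall>is \<in> lists_upto (length js). has_weak_deriv Y (count (mset is)) f (g is)) \<longrightarrow>
        has_weak_deriv X (count (mset js)) (\<lambda>x. f (A x)) (\<lambda>x. \<Sum>is\<in>lists_upto (length js). P is x * g is (A x)))"
proof -
  have o: "open X" "open Y" "A ` X \<subseteq> Y" and cA: "continuous_on X A" using A by (auto simp: controlled_map_def)
  define N where "N = length js"
  have "length (rev js) \<le> m" using js by simp
  from chain_rule_pd[OF o(1) dA CA this] obtain P
    where P: "\<And>is. length is \<le> N \<Longrightarrow> Ckb True (m - N) X (P is)"
      and PF: "\<And>(F :: real ^ 'd \<Rightarrow> real) x. smooth F \<Longrightarrow> x \<in> X \<Longrightarrow> pd (rev js) (\<lambda>x. F (A x)) x = (\<Sum>is\<in>lists_upto N. P is x * pd is F (A x))"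
    unfolding length_rev N_def[symmetric] by (auto simp only: mem_Collect_eq)
  have cP: "continuous_on X (P is)" if "length is \<le> N" for "is" using P[OF that] by (rule Ckb_continuous)
  have "has_weak_deriv X (count (mset js)) (\<lambda>x. f (A x)) (\<lambda>x. \<Sum>is\<in>lists_upto N. P is x * g is (A x))"
    if g: "\<And>is. length is \<le> N \<Longrightarrow> has_weak_deriv Y (count (mset is)) f (g is)" for f g
    unfolding has_weak_deriv_list
  proof (intro conjI ballI)
    have lf: "locally_integrable_on f Y" using g[of "[]"] by (simp add: has_weak_deriv_def)
    have lg: "locally_integrable_on (g is) Y" if "length is \<le> N" for "is" using g[OF that] by (simp add: has_weak_deriv_def)
    show "locally_integrable_on (\<lambda>x. f (A x)) X" by (rule locally_integrable_compose[OF A lf])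
    show "locally_integrable_on (\<lambda>x. \<Sum>is\<in>lists_upto N. P is x * g is (A x)) X"
      by (intro locally_integrable_sum locally_integrable_mult locally_integrable_compose[OF A] lg cP) auto
    fix \<phi> assume \<phi>: "\<phi> \<in> test_functions X"
    then obtain K where K: "compact K" "K \<subseteq> X" and z: "\<And>x. x \<notin> K \<Longrightarrow> \<phi> x = 0" and s: "smooth \<phi>"
      unfolding test_functions_iff by blast
    have zp: "pd js \<phi> x = 0" if "x \<notin> K" for x by (rule pd_zero_outside[OF compact_imp_closed[OF K(1)] z that])
    have AK: "compact (A ` K)" "A ` K \<subseteq> Y" using K cA o compact_continuous_image continuous_on_subset by blast+
    obtain F :: "nat \<Rightarrow> real ^ 'd \<Rightarrow> real" where F: "\<And>n. smooth (F n)"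
      and F0: "(\<lambda>n. \<integral>\<^sup>+ x. ennreal \<bar>F n x - f x\<bar> * indicator (A ` K) x \<partial>lebesgue) \<longlonglongrightarrow> 0"
      and Fg: "\<And>is. length is \<le> N \<Longrightarrow> (\<lambda>n. \<integral>\<^sup>+ x. ennreal \<bar>pd is (F n) x - g is x\<bar> * indicator (A ` K) x \<partial>lebesgue) \<longlonglongrightarrow> 0"
      and "\<And>is n. length is \<le> N \<Longrightarrow> (\<integral>\<^sup>+ x. ennreal (\<bar>pd is (F n) x\<bar>\<^sup>2) * indicator (A ` K) x \<partial>lebesgue)
        \<le> (\<integral>\<^sup>+ x. ennreal (\<bar>g is x\<bar>\<^sup>2) * indicator Y x \<partial>lebesgue)"
      by (rule smooth_approximation[where k = N and g = g, OF o(2) AK lf g], assumption) (rule that; fast)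
    have L: "(\<lambda>n. LINT x|lebesgue_on X. F n (A x) * pd js \<phi> x) \<longlonglongrightarrow> (LINT x|lebesgue_on X. f (A x) * pd js \<phi> x)"
      by (rule integral_compose_tendsto[OF A smooth_locally_integrable[OF F] lf K smooth_continuous[OF smooth_pd[OF s]] zp F0])
    have iP: "integrable (lebesgue_on X) (\<lambda>x. u (A x) * (P is x * \<phi> x))" if "length is \<le> N" "locally_integrable_on u Y" for "is" u
      by (rule integrable_compactly_supported_product[OF o(1) locally_integrable_compose[OF A that(2)] _ K])
        (auto intro!: continuous_on_mult cP that smooth_continuous[OF s] simp: z)
    have R1: "(\<lambda>n. LINT x|lebesgue_on X. pd is (F n) (A x) * (P is x * \<phi> x)) \<longlonglongrightarrow> (LINT x|lebesgue_on X. g is (A x) * (P is x * \<phi> x))"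
      if "length is \<le> N" for "is"
      by (rule integral_compose_tendsto[OF A smooth_locally_integrable[OF smooth_pd[OF F]] lg[OF that] K _ _ Fg[OF that]])
        (auto intro!: continuous_on_mult cP that smooth_continuous[OF s] simp: z)
    have eq: "(LINT x|lebesgue_on X. F n (A x) * pd js \<phi> x) =
        (-1) ^ N * (\<Sum>is\<in>lists_upto N. LINT x|lebesgue_on X. pd is (F n) (A x) * (P is x * \<phi> x))" for n
    proof -
      have "Ck_on (length js) X (\<lambda>x. F n (A x))"
      proof (rule Ck_on_compose[OF o(1) dA _ F])
        show "Ck_on (length js) X (\<lambda>x. A x $ l)" for l
          using Ckb_imp_Ck_on[OF Ckb_mono[OF CA js]] .
      qed
      from integration_by_parts_pd[OF o(1) this \<phi>]
      have "(LINT x|lebesgue_on X. F n (A x) * pd js \<phi> x) = (-1) ^ N * (LINT x|lebesgue_on X. pd (rev js) (\<lambda>x. F n (A x)) x * \<phi> x)"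
        by (simp add: N_def)
      also have "(LINT x|lebesgue_on X. pd (rev js) (\<lambda>x. F n (A x)) x * \<phi> x) =
          (LINT x|lebesgue_on X. (\<Sum>is\<in>lists_upto N. pd is (F n) (A x) * (P is x * \<phi> x)))"
        by (intro Bochner_Integration.integral_cong refl) (auto simp: PF[OF F] sum_distrib_right sum_distrib_left mult_ac)
      also have "\<dots> = (\<Sum>is\<in>lists_upto N. LINT x|lebesgue_on X. pd is (F n) (A x) * (P is x * \<phi> x))"
        by (rule Bochner_Integration.integral_sum) (auto intro!: iP smooth_locally_integrable smooth_pd F)
      finally show ?thesis .
    qed
    have "(\<lambda>n. LINT x|lebesgue_on X. F n (A x) * pd js \<phi> x) \<longlonglongrightarrow>
        (-1) ^ N * (\<Sum>is\<in>lists_upto N. LINT x|lebesgue_on X. g is (A x) * (P is x * \<phi> x))"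
      unfolding eq by (intro tendsto_intros R1) auto
    from LIMSEQ_unique[OF L this]
    have "(LINT x|lebesgue_on X. f (A x) * pd js \<phi> x) = (-1) ^ N * (\<Sum>is\<in>lists_upto N. LINT x|lebesgue_on X. g is (A x) * (P is x * \<phi> x))" .
    also have "(\<Sum>is\<in>lists_upto N. LINT x|lebesgue_on X. g is (A x) * (P is x * \<phi> x)) =
        (LINT x|lebesgue_on X. (\<Sum>is\<in>lists_upto N. g is (A x) * (P is x * \<phi> x)))"
      by (rule Bochner_Integration.integral_sum[symmetric]) (auto intro!: iP lg)
    also have "\<dots> = (LINT x|lebesgue_on X. (\<Sum>is\<in>lists_upto N. P is x * g is (A x)) * \<phi> x)"
      by (intro Bochner_Integration.integral_cong refl) (auto simp: sum_distrib_right sum_distrib_left mult_ac)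
    finally show "(LINT x|lebesgue_on X. f (A x) * pd js \<phi> x) =
        (-1) ^ length js * (LINT x|lebesgue_on X. (\<Sum>is\<in>lists_upto N. P is x * g is (A x)) * \<phi> x)"
      by (simp add: N_def)
  qed
  then show ?thesis using P unfolding N_def by (intro exI[of _ P]) auto
qed

section \<open>Detours in Lipschitz domains\<close>

text \<open>
  The polygonal path from \<open>x\<close> to \<open>y\<close> through the points displaced by \<open>v\<close>, scaled with the distance of \<open>x\<close>
  and \<open>y\<close>, lies in \<open>\<Omega>\<close>. The path has length at most a constant times that distance, and for fixed \<open>y - x\<close> its
  vertices are translates of \<open>x\<close> by fixed vectors.
\<close>

definition detour :: "'a::real_normed_vector set \<Rightarrow> 'a \<Rightarrow> 'a \<Rightarrow> 'a \<Rightarrow> bool" where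
  "detour \<Omega> v x y \<longleftrightarrow>
     closed_segment x (x + norm (x - y) *\<^sub>R v) \<subseteq> \<Omega> \<and>
     closed_segment (x + norm (x - y) *\<^sub>R v) (y + norm (x - y) *\<^sub>R v) \<subseteq> \<Omega> \<and>
     closed_segment y (y + norm (x - y) *\<^sub>R v) \<subseteq> \<Omega>"

text \<open>
  Over a segment of length \<open>D\<close> the graph of an \<open>L\<close>-Lipschitz function lies at most \<open>L D\<close> below its values at the
  end points. Lowering the segment by \<open>L D\<close> therefore puts it below the graph.
\<close>

lemma below_graph_detour:
  fixes \<xi> \<zeta> :: "real ^ 'd" and k :: 'd
  defines "proj \<equiv> \<lambda>y :: real ^ 'd. \<chi> j. if j = k then 0 else y $ j"
  assumes lip: "L-lipschitz_on {y. y $ k = 0} \<phi>"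
    and \<xi>: "\<xi> $ k < \<phi> (proj \<xi>)" and \<zeta>: "\<zeta> $ k < \<phi> (proj \<zeta>)" and t: "0 \<le> t" "t \<le> 1"
  defines "p \<equiv> (1 - t) *\<^sub>R \<xi> + t *\<^sub>R \<zeta> - (norm (\<xi> - \<zeta>) * L) *\<^sub>R axis k 1"
  shows "p $ k < \<phi> (proj p)"
proof -
  have L: "L \<ge> 0" using lip by (rule lipschitz_on_nonneg)
  define q where "q = (1 - t) *\<^sub>R \<xi> + t *\<^sub>R \<zeta>"
  have pq: "proj p = proj q" by (simp add: proj_def p_def q_def vec_eq_iff axis_def)
  have ker: "proj y \<in> {y. y $ k = 0}" for y by (simp add: proj_def)
  have nproj: "norm (proj a - proj b) \<le> norm (a - b)" for a b
    by (rule norm_le_componentwise_cart) (simp add: proj_def)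
  have lip': "\<bar>\<phi> (proj a) - \<phi> (proj b)\<bar> \<le> L * norm (a - b)" for a b
  proof -
    have "dist (\<phi> (proj a)) (\<phi> (proj b)) \<le> L * dist (proj a) (proj b)"
      by (rule lipschitz_onD[OF lip ker ker])
    also have "\<dots> \<le> L * norm (a - b)" using L nproj by (simp add: dist_norm mult_left_mono)
    finally show ?thesis by (simp add: dist_real_def)
  qed
  let ?D = "norm (\<xi> - \<zeta>)"
  have "\<xi> - q = t *\<^sub>R (\<xi> - \<zeta>)" "\<zeta> - q = (1 - t) *\<^sub>R (\<zeta> - \<xi>)" by (simp_all add: q_def algebra_simps)
  then have n: "norm (\<xi> - q) = t * ?D" "norm (\<zeta> - q) = (1 - t) * ?D" using t by (simp_all add: norm_minus_commute)
  have "t * ?D \<le> 1 * ?D" "(1 - t) * ?D \<le> 1 * ?D" using t by (intro mult_right_mono; simp)+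
  then have LD: "L * (t * ?D) \<le> L * ?D" "L * ((1 - t) * ?D) \<le> L * ?D" using L by (intro mult_left_mono; simp)+
  have a: "\<phi> (proj \<xi>) \<le> \<phi> (proj q) + L * ?D" using lip'[of \<xi> q] LD n by (auto simp: abs_le_iff)
  have b: "\<phi> (proj \<zeta>) \<le> \<phi> (proj q) + L * ?D" using lip'[of \<zeta> q] LD n by (auto simp: abs_le_iff)
  have "q $ k < \<phi> (proj q) + L * ?D"
  proof (cases "t = 0")
    case True
    then show ?thesis using \<xi> a by (simp add: q_def)
  next
    case False
    have "q $ k = (1 - t) * \<xi> $ k + t * \<zeta> $ k" by (simp add: q_def)
    also have "\<dots> < (1 - t) * \<phi> (proj \<xi>) + t * \<phi> (proj \<zeta>)"
      using \<xi> \<zeta> t False by (intro add_le_less_mono mult_left_mono mult_strict_left_mono) auto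
    also have "\<dots> \<le> (1 - t) * (\<phi> (proj q) + L * ?D) + t * (\<phi> (proj q) + L * ?D)"
      using a b t by (intro add_mono mult_left_mono) auto
    also have "\<dots> = \<phi> (proj q) + L * ?D" by (simp add: algebra_simps)
    finally show ?thesis .
  qed
  moreover have "p $ k = q $ k - ?D * L" by (simp add: p_def q_def axis_def)
  ultimately show ?thesis by (simp add: pq mult.commute)
qed

text \<open>
  At an interior point a ball and \<open>v = 0\<close> will do. At a boundary point \<open>v\<close> points downwards in the chart, with
  length \<open>L\<close>; the radius \<open>\<rho>\<close> is so small that displaced points remain in the domain of the chart.
\<close>

lemma local_detour:
  fixes \<Omega> :: "(real ^ 'd) set"
  assumes \<Omega>: "open \<Omega>" "lipschitz_boundary \<Omega>" and x0: "x0 \<in> closure \<Omega>"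
  shows "\<exists>\<rho>>0. \<exists>v. \<forall>x\<in>\<Omega> \<inter> ball x0 \<rho>. \<forall>y\<in>\<Omega> \<inter> ball x0 \<rho>. detour \<Omega> v x y"
proof (cases "x0 \<in> \<Omega>")
  case True
  then obtain \<rho> where \<rho>: "\<rho> > 0" "ball x0 \<rho> \<subseteq> \<Omega>" using \<Omega> open_contains_ball by blast
  have "detour \<Omega> 0 x y" if "x \<in> ball x0 \<rho>" "y \<in> ball x0 \<rho>" for x y
    using closed_segment_subset[OF that convex_ball] that \<rho>(2) by (auto simp: detour_def)
  with \<rho>(1) show ?thesis by blast
next
  case False
  then have "x0 \<in> frontier \<Omega>" using x0 \<Omega>(1) by (simp add: frontier_def interior_open)
  from bspec[OF \<Omega>(2)[unfolded lipschitz_boundary_def] this]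
  obtain U k \<phi> L Q b where U: "open U" "x0 \<in> U" and lip: "L-lipschitz_on {y. y $ k = 0} (\<phi> :: real ^ 'd \<Rightarrow> real)"
    and Q: "orthogonal_transformation Q"
    and eq: "U \<inter> \<Omega> = U \<inter> (\<lambda>y. b + Q y) ` {y. y $ k < \<phi> (\<chi> j. if j = k then 0 else y $ j)}"
    by (elim exE conjE)
  obtain \<rho>0 where \<rho>0: "\<rho>0 > 0" "ball x0 \<rho>0 \<subseteq> U" using U open_contains_ball by blast
  have L: "L \<ge> 0" using lip by (rule lipschitz_on_nonneg)
  define \<rho> where "\<rho> = \<rho>0 / (2 + 2 * L)"
  have \<rho>: "\<rho> > 0" "\<rho> + 2 * \<rho> * L < \<rho>0"
  proof -
    show "\<rho> > 0" using \<rho>0 L by (simp add: \<rho>_def)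
    moreover have "\<rho> * (2 + 2 * L) = \<rho>0" using L by (simp add: \<rho>_def)
    ultimately show "\<rho> + 2 * \<rho> * L < \<rho>0" by (simp add: algebra_simps)
  qed
  define v where "v = - (L *\<^sub>R Q (axis k 1))"
  have nv: "norm v = L" using L by (simp add: v_def orthogonal_transformation_norm[OF Q] norm_axis_1)
  have lQ: "linear Q" using Q by (rule orthogonal_transformation_linear)
  \<comment> \<open>all three segments of the detour consist of such points: \<open>t = 0\<close>, \<open>s = 1\<close> and \<open>t = 1\<close>, respectively\<close>
  have core: "(1 - t) *\<^sub>R x + t *\<^sub>R y + (s * norm (x - y)) *\<^sub>R v \<in> \<Omega>"
    if x: "x \<in> \<Omega> \<inter> ball x0 \<rho>" and y: "y \<in> \<Omega> \<inter> ball x0 \<rho>" and t: "0 \<le> t" "t \<le> 1" and s: "0 \<le> s" "s \<le> 1" "s = 1 \<or> t = 0 \<or> t = 1" for x y t s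
  proof -
    let ?R = "{y. y $ k < \<phi> (\<chi> j. if j = k then 0 else y $ j)}"
    let ?z = "(1 - t) *\<^sub>R x + t *\<^sub>R y + (s * norm (x - y)) *\<^sub>R v"
    have "\<rho> \<le> \<rho>0" using \<rho> L by (smt (verit) mult_nonneg_nonneg)
    then have "x \<in> U \<inter> \<Omega>" "y \<in> U \<inter> \<Omega>" using x y \<rho>0(2) by auto
    then obtain \<xi> \<zeta> where \<xi>: "x = b + Q \<xi>" "\<xi> \<in> ?R" and \<zeta>: "y = b + Q \<zeta>" "\<zeta> \<in> ?R" unfolding eq by blast
    have "x - y = Q (\<xi> - \<zeta>)" using \<xi> \<zeta> lQ by (simp add: linear_diff)
    then have nxy: "norm (x - y) = norm (\<xi> - \<zeta>)" by (simp add: orthogonal_transformation_norm[OF Q])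
    define p where "p = (1 - t) *\<^sub>R \<xi> + t *\<^sub>R \<zeta> - (s * norm (\<xi> - \<zeta>) * L) *\<^sub>R axis k 1"
    have zp: "?z = b + Q p"
      unfolding p_def nxy unfolding \<xi>(1) \<zeta>(1) v_def using lQ
      by (simp add: linear_add linear_diff linear_scale scaleR_add_right scaleR_left_diff_distrib algebra_simps)
    have "p \<in> ?R"
    proof -
      consider "s = 1" | "t = 0" | "t = 1" using s by blast
      then show ?thesis
      proof cases
        case 1
        then show ?thesis using below_graph_detour[OF lip, of \<xi> \<zeta> t] \<xi> \<zeta> t by (simp add: p_def)
      next
        have pr: "(\<chi> j. if j = k then 0 else (w - c *\<^sub>R axis k 1) $ j) = (\<chi> j. if j = k then 0 else w $ j)"
          for w :: "real ^ 'd" and c by (simp add: vec_eq_iff axis_def)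
        have c: "0 \<le> s * norm (\<xi> - \<zeta>) * L" using s L by simp
        {
          case 2
          then show ?thesis using \<xi>(2) c by (simp add: p_def pr)
        next
          case 3
          then show ?thesis using \<zeta>(2) c by (simp add: p_def pr)
        }
      qed
    qed
    moreover have "?z \<in> ball x0 \<rho>0"
    proof -
      have "(1 - t) *\<^sub>R x + t *\<^sub>R y \<in> ball x0 \<rho>"
        using x y t by (intro convexD_alt[OF convex_ball]) auto
      then have 1: "norm ((1 - t) *\<^sub>R x + t *\<^sub>R y - x0) < \<rho>" by (simp add: dist_norm norm_minus_commute)
      have "norm (x - y) \<le> norm (x - x0) + norm (y - x0)" using norm_triangle_ineq4[of "x - x0" "y - x0"] by simp
      also have "\<dots> \<le> 2 * \<rho>" using x y by (simp add: dist_norm norm_minus_commute)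
      finally have "s * norm (x - y) \<le> 1 * (2 * \<rho>)" using s by (intro mult_mono) auto
      then have 2: "norm ((s * norm (x - y)) *\<^sub>R v) \<le> 2 * \<rho> * L"
        using s L by (simp add: nv mult_right_mono)
      have "?z - x0 = ((1 - t) *\<^sub>R x + t *\<^sub>R y - x0) + (s * norm (x - y)) *\<^sub>R v" by simp
      then have "norm (?z - x0) \<le> norm ((1 - t) *\<^sub>R x + t *\<^sub>R y - x0) + norm ((s * norm (x - y)) *\<^sub>R v)"
        by (metis norm_triangle_ineq)
      then have "norm (?z - x0) < \<rho>0" using 1 2 \<rho> by linarith
      then show ?thesis by (simp add: dist_norm norm_minus_commute)
    qed
    ultimately have "?z \<in> U \<inter> (\<lambda>y. b + Q y) ` ?R" using zp \<rho>0(2) by blast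
    then show ?thesis using eq by blast
  qed
  have "detour \<Omega> v x y" if x: "x \<in> \<Omega> \<inter> ball x0 \<rho>" and y: "y \<in> \<Omega> \<inter> ball x0 \<rho>" for x y
    unfolding detour_def closed_segment_def
  proof (intro conjI subsetI; elim CollectE exE conjE)
    fix z u :: "real ^ 'd" and t :: real
    assume t: "0 \<le> t" "t \<le> 1"
    {
      assume "z = (1 - t) *\<^sub>R x + t *\<^sub>R (x + norm (x - y) *\<^sub>R v)"
      then have "z = (1 - 0) *\<^sub>R x + 0 *\<^sub>R y + (t * norm (x - y)) *\<^sub>R v" by (simp add: algebra_simps)
      then show "z \<in> \<Omega>" using core[OF x y, of 0 t] t by simp
    next
      assume "z = (1 - t) *\<^sub>R (x + norm (x - y) *\<^sub>R v) + t *\<^sub>R (y + norm (x - y) *\<^sub>R v)"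
      then have "z = (1 - t) *\<^sub>R x + t *\<^sub>R y + (1 * norm (x - y)) *\<^sub>R v" by (simp add: algebra_simps)
      then show "z \<in> \<Omega>" using core[OF x y, of t 1] t by simp
    next
      assume "z = (1 - t) *\<^sub>R y + t *\<^sub>R (y + norm (x - y) *\<^sub>R v)"
      then have "z = (1 - 1) *\<^sub>R x + 1 *\<^sub>R y + (t * norm (x - y)) *\<^sub>R v" by (simp add: algebra_simps)
      then show "z \<in> \<Omega>" using core[OF x y, of 1 t] t by simp
    }
  qed
  with \<rho>(1) show ?thesis by blast
qed

text \<open>
  Compactness of the closure of \<open>\<Omega>\<close> leaves finitely many directions and a positive distance.
\<close>

proposition uniform_detours:
  fixes \<Omega> :: "(real ^ 'd) set"
  assumes \<Omega>: "bounded_lipschitz_domain \<Omega>"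
  obtains \<delta> V where "\<delta> > 0" "finite V"
    "\<And>x y. x \<in> \<Omega> \<Longrightarrow> y \<in> \<Omega> \<Longrightarrow> norm (x - y) < \<delta> \<Longrightarrow> \<exists>v\<in>V. detour \<Omega> v x y"
proof -
  have o: "open \<Omega>" "\<Omega> \<noteq> {}" "lipschitz_boundary \<Omega>" "bounded \<Omega>"
    using \<Omega> by (auto simp: bounded_lipschitz_domain_def domain_set_def)
  obtain \<rho> v where \<rho>: "\<And>x0. x0 \<in> closure \<Omega> \<Longrightarrow> \<rho> x0 > 0"
    and v: "\<And>x0 x y. x0 \<in> closure \<Omega> \<Longrightarrow> x \<in> \<Omega> \<inter> ball x0 (\<rho> x0) \<Longrightarrow> y \<in> \<Omega> \<inter> ball x0 (\<rho> x0) \<Longrightarrow> detour \<Omega> (v x0) x y"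
    using local_detour[OF o(1,3)] by metis
  \<comment> \<open>balls of half the radius: points at distance less than \<open>\<delta>\<close> then share a ball of full radius\<close>
  have cov: "closure \<Omega> \<subseteq> (\<Union>x\<in>closure \<Omega>. ball x (\<rho> x / 2))" using \<rho> by force
  have "compact (closure \<Omega>)" using o(4) by simp
  from compactE_image[OF this _ cov] obtain D where D: "D \<subseteq> closure \<Omega>" "finite D" "closure \<Omega> \<subseteq> (\<Union>x\<in>D. ball x (\<rho> x / 2))"
    by auto
  have "D \<noteq> {}" using D(3) o(2) closure_subset[of \<Omega>] by auto
  define \<delta> where "\<delta> = Min ((\<lambda>x. \<rho> x / 2) ` D)"
  have \<delta>: "\<delta> > 0" using D \<rho> \<open>D \<noteq> {}\<close> by (auto simp: \<delta>_def)
  have \<delta>2: "\<delta> \<le> \<rho> x / 2" if "x \<in> D" for x unfolding \<delta>_def using D that by (intro Min_le) auto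
  show thesis
  proof (rule that[of \<delta> "v ` D"])
    fix x y assume x: "x \<in> \<Omega>" and y: "y \<in> \<Omega>" and n: "norm (x - y) < \<delta>"
    have "x \<in> closure \<Omega>" using x closure_subset by blast
    then obtain x0 where x0: "x0 \<in> D" "dist x0 x < \<rho> x0 / 2" using D(3) by (auto simp: subset_iff)
    have "dist x0 y \<le> dist x0 x + dist x y" by (rule dist_triangle)
    also have "\<dots> < \<rho> x0" using x0 n \<delta>2[OF x0(1)] by (simp add: dist_norm)
    finally have "dist x0 y < \<rho> x0" .
    moreover have "dist x0 x < \<rho> x0" using x0 \<rho>[of x0] D(1) by auto
    ultimately have "detour \<Omega> (v x0) x y" using v[of x0 x y] x y x0(1) D(1) by auto
    then show "\<exists>v\<in>v ` D. detour \<Omega> v x y" using x0(1) by blast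
  qed (use \<delta> D in auto)
qed

text \<open>
  For close points integrate along a detour; for distant points the bound on \<open>G\<close> itself suffices.
\<close>

lemma Ckb_1_lipschitz:
  fixes G :: "real ^ 'd \<Rightarrow> real"
  assumes \<Omega>: "bounded_lipschitz_domain \<Omega>" and G: "Ckb True 1 \<Omega> G"
  obtains C where "C \<ge> 0" "\<And>x y. x \<in> \<Omega> \<Longrightarrow> y \<in> \<Omega> \<Longrightarrow> \<bar>G x - G y\<bar> \<le> C * norm (x - y)"
proof -
  have o: "open \<Omega>" using \<Omega> by (auto simp: bounded_lipschitz_domain_def domain_set_def)
  obtain \<delta> V where \<delta>: "\<delta> > 0" "finite V"
    "\<And>x y. x \<in> \<Omega> \<Longrightarrow> y \<in> \<Omega> \<Longrightarrow> norm (x - y) < \<delta> \<Longrightarrow> \<exists>v\<in>V. detour \<Omega> v x y"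
    using uniform_detours[OF \<Omega>] by blast
  obtain B0 where B0: "\<And>x. x \<in> \<Omega> \<Longrightarrow> \<bar>G x\<bar> \<le> B0" using G by (auto simp: bounded_iff)
  have "\<forall>i. \<exists>B. \<forall>x\<in>\<Omega>. \<bar>partial_deriv i G x\<bar> \<le> B" using G by (auto simp: bounded_iff)
  then obtain B where B: "\<And>i x. x \<in> \<Omega> \<Longrightarrow> \<bar>partial_deriv i G x\<bar> \<le> B i" by metis
  define K where "K = (\<Sum>i\<in>UNIV. \<bar>B i\<bar>)"
  have K: "K \<ge> 0" by (simp add: K_def sum_nonneg)
  have seg: "\<bar>G a - G b\<bar> \<le> K * norm (a - b)" if ab: "closed_segment a b \<subseteq> \<Omega>" for a b
  proof -
    have "norm (G a - G b) \<le> K * norm (a - b)"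
    proof (rule differentiable_bound[where S = "closed_segment a b"])
      fix x assume "x \<in> closed_segment a b"
      then have x: "x \<in> \<Omega>" using ab by blast
      have "G differentiable (at x)" using G x o by (auto intro: differentiable_on_open_at)
      from has_derivative_partial_sum[OF this]
      show "(G has_derivative (\<lambda>h. \<Sum>i\<in>UNIV. (h $ i) *\<^sub>R partial_deriv i G x)) (at x within closed_segment a b)"
        by (rule has_derivative_at_withinI)
      show "onorm (\<lambda>h. \<Sum>i\<in>UNIV. (h $ i) *\<^sub>R partial_deriv i G x) \<le> K"
      proof (rule onorm_le)
        fix h :: "real ^ 'd"
        have "norm (\<Sum>i\<in>UNIV. (h $ i) *\<^sub>R partial_deriv i G x) \<le> (\<Sum>i\<in>UNIV. \<bar>h $ i\<bar> * \<bar>partial_deriv i G x\<bar>)"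
          by (rule order_trans[OF norm_sum]) (simp add: abs_mult)
        also have "\<dots> \<le> (\<Sum>i\<in>UNIV. norm h * \<bar>B i\<bar>)"
          using B[OF x] by (intro sum_mono mult_mono component_le_norm_cart) (auto intro: order_trans[OF _ abs_ge_self])
        also have "\<dots> = K * norm h" by (simp add: K_def sum_distrib_left mult.commute)
        finally show "norm (\<Sum>i\<in>UNIV. (h $ i) *\<^sub>R partial_deriv i G x) \<le> K * norm h" .
      qed
    qed auto
    then show ?thesis by simp
  qed
  define M where "M = (\<Sum>v\<in>V. norm v)"
  have M: "norm v \<le> M" if "v \<in> V" for v using \<delta>(2) that by (auto simp: M_def intro: member_le_sum)
  have M0: "M \<ge> 0" by (simp add: M_def sum_nonneg)
  define C where "C = max (K * (2 * M + 1)) (2 * B0 / \<delta>)"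
  show thesis
  proof (rule that[of C])
    show "C \<ge> 0" using K M0 by (simp add: C_def max.coboundedI1)
    fix x y assume x: "x \<in> \<Omega>" and y: "y \<in> \<Omega>"
    let ?n = "norm (x - y)"
    show "\<bar>G x - G y\<bar> \<le> C * ?n"
    proof (cases "?n < \<delta>")
      case True
      then obtain v where v: "v \<in> V" "detour \<Omega> v x y" using \<delta>(3) x y by blast
      have 1: "\<bar>G x - G (x + ?n *\<^sub>R v)\<bar> \<le> K * (?n * norm v)"
        using seg[of x "x + ?n *\<^sub>R v"] v by (simp add: detour_def)
      have 2: "\<bar>G (x + ?n *\<^sub>R v) - G (y + ?n *\<^sub>R v)\<bar> \<le> K * ?n"
        using seg[of "x + ?n *\<^sub>R v" "y + ?n *\<^sub>R v"] v by (simp add: detour_def)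
      have 3: "\<bar>G y - G (y + ?n *\<^sub>R v)\<bar> \<le> K * (?n * norm v)"
        using seg[of y "y + ?n *\<^sub>R v"] v by (simp add: detour_def)
      have "K * (?n * norm v) \<le> K * (?n * M)" using K M[OF v(1)] by (intro mult_left_mono) auto
      then have "\<bar>G x - G y\<bar> \<le> 2 * (K * (?n * M)) + K * ?n" using 1 2 3 by linarith
      also have "\<dots> = K * (2 * M + 1) * ?n" by (simp add: algebra_simps)
      also have "\<dots> \<le> C * ?n" by (intro mult_right_mono) (auto simp: C_def)
      finally show ?thesis .
    next
      case False
      have "\<bar>G x - G y\<bar> \<le> 2 * B0" using B0[OF x] B0[OF y] by linarith
      also have "\<dots> \<le> 2 * B0 / \<delta> * ?n"
      proof -
        have "0 \<le> 2 * B0" using B0[OF x] by linarith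
        then have "2 * B0 * \<delta> \<le> 2 * B0 * ?n" using False by (intro mult_left_mono) auto
        then show ?thesis using \<delta>(1) by (simp add: field_simps)
      qed
      also have "\<dots> \<le> C * ?n" by (intro mult_right_mono) (auto simp: C_def)
      finally show ?thesis .
    qed
  qed
qed

section \<open>Integrability of the Riesz kernel\<close>

text \<open>
  On the dyadic shell \<open>R 2\<^bsup>-n-1\<^esup> < |z| \<le> R 2\<^bsup>-n\<^esup>\<close> the kernel is comparable to its value at the outer radius; the
  integrals over the corresponding balls form a geometric series with ratio \<open>2\<^bsup>-(a+d)\<^esup>\<close>.
\<close>

lemma riesz_kernel_finite:
  fixes a R :: real
  assumes a: "a + real CARD('d) > 0" and R: "R > 0"
  shows "(\<integral>\<^sup>+ z. ennreal (norm z powr a) * indicator (cball 0 R) z \<partial>(lborel :: (real ^ 'd) measure)) < \<infinity>"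
proof -
  let ?d = "real CARD('d)"
  define \<rho> where "\<rho> n = R * 2 powr (- real n)" for n
  have \<rho>: "\<rho> n > 0" for n using R by (simp add: \<rho>_def)
  \<comment> \<open>the factor \<open>2 powr \<bar>a\<bar>\<close> accounts for the variation of the kernel over a shell, for either sign of \<open>a\<close>\<close>
  let ?T = "\<lambda>n (z :: real ^ 'd). ennreal (2 powr \<bar>a\<bar> * \<rho> n powr a) * indicator (cball 0 (\<rho> n)) z"
  have mT: "?T n \<in> borel_measurable lborel" for n
    by (intro borel_measurable_times_ennreal borel_measurable_const borel_measurable_indicator) simp
  have pt: "ennreal (norm z powr a) * indicator (cball 0 R) z \<le> (\<Sum>n. ?T n z)" for z :: "real ^ 'd"
  proof (cases "z \<noteq> 0 \<and> norm z \<le> R")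
    case True
    define q where "q = log 2 (R / norm z)"
    define n where "n = nat \<lfloor>q\<rfloor>"
    have "R / norm z \<ge> 1" using True by (simp add: field_simps)
    then have q0: "q \<ge> 0" by (simp add: q_def)
    then have n: "real n \<le> q" "q \<le> real n + 1" unfolding n_def by linarith+
    have "2 powr q = R / norm z" using True R by (simp add: q_def)
    then have nz: "norm z = R * 2 powr (- q)" using True R by (simp add: powr_minus field_simps)
    have "norm z \<le> \<rho> n" unfolding nz \<rho>_def using n R by (intro mult_left_mono powr_mono) auto
    have "norm z powr a = \<rho> n powr a * 2 powr (- (q - real n) * a)"
      unfolding nz \<rho>_def using R by (simp add: powr_mult powr_powr flip: powr_add) (simp add: algebra_simps)
    also have "\<dots> \<le> \<rho> n powr a * 2 powr \<bar>a\<bar>"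
    proof (intro mult_left_mono powr_mono)
      have "- (q - real n) * a \<le> \<bar>(q - real n) * a\<bar>" by linarith
      also have "\<dots> \<le> 1 * \<bar>a\<bar>" unfolding abs_mult using n by (intro mult_right_mono) auto
      finally show "- (q - real n) * a \<le> \<bar>a\<bar>" by simp
    qed auto
    finally have "ennreal (norm z powr a) * indicator (cball 0 R) z \<le> ?T n z"
      using True \<open>norm z \<le> \<rho> n\<close> by (simp add: ennreal_leI mult.commute)
    also have "\<dots> \<le> (\<Sum>n. ?T n z)"
    proof -
      define f where "f m = ?T m z" for m
      have "f n \<le> suminf f" using sum_le_suminf[of f "{n}"] by simp
      then show ?thesis by (simp only: f_def[abs_def])
    qed
    finally show ?thesis .
  next
    case False
    then show ?thesis by (cases "z = 0") auto
  qed
  have "(\<integral>\<^sup>+ z. ennreal (norm z powr a) * indicator (cball 0 R) z \<partial>(lborel :: (real ^ 'd) measure)) \<le> (\<integral>\<^sup>+ z. (\<Sum>n. ?T n z) \<partial>lborel)"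
    by (rule nn_integral_mono) (rule pt)
  also have "\<dots> = (\<Sum>n. \<integral>\<^sup>+ z. ?T n z \<partial>lborel)" 
    by (rule nn_integral_suminf[OF mT])
  also have "\<dots> = (\<Sum>n. ennreal (2 powr \<bar>a\<bar> * unit_ball_vol ?d * R powr (a + ?d) * (2 powr (- (a + ?d))) ^ n))"
  proof (rule suminf_cong)
    fix n
    have "(\<integral>\<^sup>+ z. ?T n z \<partial>lborel) = ennreal (2 powr \<bar>a\<bar> * \<rho> n powr a) * emeasure lborel (cball (0 :: real ^ 'd) (\<rho> n))"
      by (rule nn_integral_cmult_indicator) simp
    also have "\<dots> = ennreal (2 powr \<bar>a\<bar> * \<rho> n powr a) * ennreal (unit_ball_vol ?d * \<rho> n powr ?d)"
      using \<rho>[of n] by (simp add: emeasure_cball powr_realpow)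
    also have "\<dots> = ennreal ((2 powr \<bar>a\<bar> * \<rho> n powr a) * (unit_ball_vol ?d * \<rho> n powr ?d))"
      by (rule ennreal_mult'[symmetric]) simp
    also have "(2 powr \<bar>a\<bar> * \<rho> n powr a) * (unit_ball_vol ?d * \<rho> n powr ?d) = 2 powr \<bar>a\<bar> * unit_ball_vol ?d * \<rho> n powr (a + ?d)"
      by (simp add: powr_add)
    also have "\<rho> n powr (a + ?d) = R powr (a + ?d) * (2 powr (- (a + ?d))) ^ n"
    proof -
      have "(2 powr (- (a + ?d))) ^ n = (2 powr (- (a + ?d))) powr real n" by (simp add: powr_realpow)
      also have "\<dots> = (2 powr (- real n)) powr (a + ?d)" by (simp only: powr_powr) (simp add: algebra_simps)
      finally show ?thesis using R by (simp add: \<rho>_def powr_mult)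
    qed
    finally show "(\<integral>\<^sup>+ z. ?T n z \<partial>lborel) = ennreal (2 powr \<bar>a\<bar> * unit_ball_vol ?d * R powr (a + ?d) * (2 powr (- (a + ?d))) ^ n)"
      by (simp add: mult.assoc)
  qed
  also have "\<dots> < \<infinity>"
  proof -
    have "2 powr (- (a + ?d)) < (1 :: real)" using a by (subst powr_less_one) auto
    then have "summable (\<lambda>n. (2 powr (- (a + ?d)) :: real) ^ n)" by (intro summable_geometric) simp
    then have sm: "summable (\<lambda>n. 2 powr \<bar>a\<bar> * unit_ball_vol ?d * R powr (a + ?d) * (2 powr (- (a + ?d))) ^ n)"
      by (rule summable_mult)
    have nn: "0 \<le> 2 powr \<bar>a\<bar> * unit_ball_vol ?d * R powr (a + ?d) * (2 powr (- (a + ?d))) ^ n" for n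
      by (intro mult_nonneg_nonneg zero_le_power powr_ge_zero unit_ball_vol_nonneg) simp
    show ?thesis unfolding suminf_ennreal2[OF nn sm] by (simp only: ennreal_less_top infinity_ennreal_def)
  qed
  finally show ?thesis .
qed

section \<open>Translation estimates for weakly differentiable functions\<close>

lemma AE_lborel_shift:
  fixes z :: "'a::euclidean_space"
  assumes "AE x in lborel. P x"
  shows "AE x in lborel. P (x + z)"
proof -
  obtain N where N: "{x \<in> space lborel. \<not> P x} \<subseteq> N" "emeasure lborel N = 0" "N \<in> sets lborel"
    using assms by (rule AE_E)
  have "AE x in distr lborel borel (\<lambda>x. x + z). x \<notin> N"
    unfolding distr_lborel_shift using N by (intro AE_not_in null_setsI) auto
  then have "AE x in lborel. x + z \<notin> N" by (subst (asm) AE_distr_iff) (use N in auto)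
  then show ?thesis by eventually_elim (use N in auto)
qed

lemma nn_integral_le_of_AE_limit:
  fixes u :: "nat \<Rightarrow> 'a \<Rightarrow> ennreal"
  assumes m: "\<And>n. u n \<in> borel_measurable M" and lim: "AE x in M. (\<lambda>n. u n x) \<longlonglongrightarrow> v x"
    and B: "\<And>n. (\<integral>\<^sup>+ x. u n x \<partial>M) \<le> B"
  shows "(\<integral>\<^sup>+ x. v x \<partial>M) \<le> B"
proof -
  have "(\<integral>\<^sup>+ x. v x \<partial>M) = (\<integral>\<^sup>+ x. liminf (\<lambda>n. u n x) \<partial>M)"
    by (rule nn_integral_cong_AE) (use lim in eventually_elim, simp add: lim_imp_Liminf)
  also have "\<dots> \<le> liminf (\<lambda>n. \<integral>\<^sup>+ x. u n x \<partial>M)" by (rule nn_integral_liminf[OF m])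
  also have "\<dots> \<le> liminf (\<lambda>n. B)" by (rule Liminf_mono) (use B in simp)
  finally show ?thesis by (simp add: Liminf_const)
qed

text \<open>
  Write the difference as the integral of the derivative along the segment, apply the Cauchy-Schwarz
  inequality, and exchange the integrals: for fixed \<open>t\<close> the integral over \<open>x\<close> is translation invariant.
\<close>

lemma smooth_translation_estimate:
  fixes F :: "real ^ 'd \<Rightarrow> real"
  assumes F: "smooth F" and K: "compact K" "compact K'"
    and seg: "\<And>x t. x \<in> K \<Longrightarrow> 0 \<le> t \<Longrightarrow> t \<le> 1 \<Longrightarrow> x + t *\<^sub>R z \<in> K'"
  shows "(\<integral>\<^sup>+ x. ennreal ((F (x + z) - F x)\<^sup>2) * indicator K x \<partial>lborel)
    \<le> ennreal ((norm z)\<^sup>2) * (\<Sum>i\<in>UNIV. \<integral>\<^sup>+ x. ennreal (\<bar>partial_deriv i F x\<bar>\<^sup>2) * indicator K' x \<partial>lborel)"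
proof -
  define G where "G y = (\<chi> i. partial_deriv i F y)" for y
  have cp: "continuous_on UNIV (partial_deriv i F)" for i using smooth_continuous smooth_partial_deriv F by blast
  then have cG: "continuous_on UNIV G" unfolding G_def by (intro continuous_on_vec_lambda)
  have [measurable]: "G \<in> borel_measurable borel" "\<And>i. partial_deriv i F \<in> borel_measurable borel" "F \<in> borel_measurable borel"
    using cG cp smooth_continuous[OF F] borel_measurable_continuous_onI by blast+
  have [measurable]: "K \<in> sets borel" "K' \<in> sets borel" using K by (auto intro: borel_compact)
  have pt: "ennreal ((F (x + z) - F x)\<^sup>2) \<le> (\<integral>\<^sup>+ t. ennreal ((norm z)\<^sup>2) * (ennreal ((norm (G (x + t *\<^sub>R z)))\<^sup>2) * indicator {0..1} t) \<partial>lborel)" for x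
  proof -
    define f' where "f' t = z \<bullet> G (x + t *\<^sub>R z)" for t
    have cf': "continuous_on S f'" for S
      unfolding f'_def by (intro continuous_intros continuous_on_compose2[OF cG]) auto
    have mf'[measurable]: "f' \<in> borel_measurable borel" using cf' by (rule borel_measurable_continuous_onI)
    have df: "((\<lambda>t. F (x + t *\<^sub>R z)) has_vector_derivative f' t) (at t within S)" for t S
    proof -
      have "((\<lambda>t. x + t *\<^sub>R z) has_derivative (\<lambda>h. h *\<^sub>R z)) (at t)" by (auto intro!: derivative_eq_intros)
      from diff_chain_at[OF this has_derivative_partial_sum[OF smooth_differentiable[OF F]]]
      have "((\<lambda>t. F (x + t *\<^sub>R z)) has_derivative (\<lambda>h. h *\<^sub>R f' t)) (at t)"
        by (simp add: o_def f'_def G_def inner_vec_def sum_distrib_left mult.assoc)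
      then show ?thesis unfolding has_vector_derivative_def by (rule has_derivative_at_withinI)
    qed
    have ftc: "(\<integral>t. indicator {0..1} t *\<^sub>R f' t \<partial>lborel) = F (x + 1 *\<^sub>R z) - F (x + 0 *\<^sub>R z)"
      by (rule integral_FTC_Icc) (use df cf' in auto)
    have int: "integrable lborel (\<lambda>t. indicator {0..1} t *\<^sub>R f' t)"
      by (rule borel_integrable_compact) (use cf' in auto)
    have "ennreal \<bar>F (x + z) - F x\<bar> = ennreal (norm (\<integral>t. indicator {0..1} t *\<^sub>R f' t \<partial>lborel))" using ftc by simp
    also have "\<dots> \<le> (\<integral>\<^sup>+ t. norm (indicator {0..1} t *\<^sub>R f' t) \<partial>lborel)" by (rule integral_norm_bound_ennreal[OF int])
    also have "\<dots> \<le> (\<integral>\<^sup>+ t. (ennreal (norm z * norm (G (x + t *\<^sub>R z))) * indicator {0..1} t) * indicator {0..1} t \<partial>lborel)"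
      by (intro nn_integral_mono) (auto simp: indicator_def f'_def intro!: ennreal_leI Cauchy_Schwarz_ineq2)
    finally have "(ennreal \<bar>F (x + z) - F x\<bar>)\<^sup>2 \<le> (\<integral>\<^sup>+ t. (ennreal (norm z * norm (G (x + t *\<^sub>R z))) * indicator {0..1} t) * indicator {0..1} t \<partial>lborel)\<^sup>2"
      by (rule power_mono) simp
    also have "\<dots> \<le> (\<integral>\<^sup>+ t. (ennreal (norm z * norm (G (x + t *\<^sub>R z))) * indicator {0..1} t)\<^sup>2 \<partial>lborel) * (\<integral>\<^sup>+ t. (indicator {0..1::real} t)\<^sup>2 \<partial>lborel)"
      by (rule Cauchy_Schwarz_nn_integral) measurable
    also have "(\<integral>\<^sup>+ t. (indicator {0..1::real} t :: ennreal)\<^sup>2 \<partial>lborel) = 1"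
    proof -
      have "(\<integral>\<^sup>+ t. (indicator {0..1::real} t :: ennreal)\<^sup>2 \<partial>lborel) = (\<integral>\<^sup>+ t. indicator {0..1::real} t \<partial>lborel)"
        by (intro nn_integral_cong) (auto simp: indicator_def)
      then show ?thesis by simp
    qed
    also have "(\<lambda>t. (ennreal (norm z * norm (G (x + t *\<^sub>R z))) * indicator {0..1} t)\<^sup>2) =
        (\<lambda>t. ennreal ((norm z)\<^sup>2) * (ennreal ((norm (G (x + t *\<^sub>R z)))\<^sup>2) * indicator {0..1} t))"
      by (auto simp: fun_eq_iff indicator_def ennreal_power power_mult_distrib ennreal_mult)
    finally show ?thesis by (simp add: ennreal_power)
  qed
  have "(\<integral>\<^sup>+ x. ennreal ((F (x + z) - F x)\<^sup>2) * indicator K x \<partial>lborel)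
     \<le> (\<integral>\<^sup>+ x. \<integral>\<^sup>+ t. ennreal ((norm z)\<^sup>2) * (ennreal ((norm (G (x + t *\<^sub>R z)))\<^sup>2) * indicator K' (x + t *\<^sub>R z) * indicator {0..1} t) \<partial>lborel \<partial>lborel)"
  proof (rule nn_integral_mono)
    fix x
    show "ennreal ((F (x + z) - F x)\<^sup>2) * indicator K x \<le> (\<integral>\<^sup>+ t. ennreal ((norm z)\<^sup>2) * (ennreal ((norm (G (x + t *\<^sub>R z)))\<^sup>2) * indicator K' (x + t *\<^sub>R z) * indicator {0..1} t) \<partial>lborel)"
    proof (cases "x \<in> K")
      case True
      have "(\<integral>\<^sup>+ t. ennreal ((norm z)\<^sup>2) * (ennreal ((norm (G (x + t *\<^sub>R z)))\<^sup>2) * indicator {0..1} t) \<partial>lborel)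
          = (\<integral>\<^sup>+ t. ennreal ((norm z)\<^sup>2) * (ennreal ((norm (G (x + t *\<^sub>R z)))\<^sup>2) * indicator K' (x + t *\<^sub>R z) * indicator {0..1} t) \<partial>lborel)"
        by (intro nn_integral_cong) (use seg[OF True] in \<open>auto simp: indicator_def\<close>)
      then show ?thesis using pt[of x] True by simp
    qed simp
  qed
  also have "\<dots> = (\<integral>\<^sup>+ t. \<integral>\<^sup>+ x. ennreal ((norm z)\<^sup>2) * (ennreal ((norm (G (x + t *\<^sub>R z)))\<^sup>2) * indicator K' (x + t *\<^sub>R z) * indicator {0..1} t) \<partial>lborel \<partial>lborel)"
    by (rule lborel_pair.Fubini') measurable
  also have "\<dots> = (\<integral>\<^sup>+ t. (ennreal ((norm z)\<^sup>2) * (\<integral>\<^sup>+ x. ennreal ((norm (G x))\<^sup>2) * indicator K' x \<partial>lborel)) * indicator {0..1::real} t \<partial>lborel)"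
  proof (rule nn_integral_cong)
    fix t :: real
    have "(\<integral>\<^sup>+ x. ennreal ((norm z)\<^sup>2) * (ennreal ((norm (G (x + t *\<^sub>R z)))\<^sup>2) * indicator K' (x + t *\<^sub>R z) * indicator {0..1} t) \<partial>lborel)
        = (\<integral>\<^sup>+ x. ennreal ((norm z)\<^sup>2) * (ennreal ((norm (G x))\<^sup>2) * indicator K' x * indicator {0..1} t) \<partial>lborel)"
      by (rule nn_integral_lborel_shift[of "\<lambda>x. ennreal ((norm z)\<^sup>2) * (ennreal ((norm (G x))\<^sup>2) * indicator K' x * indicator {0..1} t)"]) measurable
    also have "\<dots> = ennreal ((norm z)\<^sup>2) * (\<integral>\<^sup>+ x. ennreal ((norm (G x))\<^sup>2) * indicator K' x * indicator {0..1} t \<partial>lborel)"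
      by (rule nn_integral_cmult) measurable
    also have "(\<integral>\<^sup>+ x. ennreal ((norm (G x))\<^sup>2) * indicator K' x * indicator {0..1} t \<partial>lborel)
        = (\<integral>\<^sup>+ x. ennreal ((norm (G x))\<^sup>2) * indicator K' x \<partial>lborel) * indicator {0..1} t"
      by (rule nn_integral_multc) measurable
    also have "ennreal ((norm z)\<^sup>2) * \<dots> = (ennreal ((norm z)\<^sup>2) * (\<integral>\<^sup>+ x. ennreal ((norm (G x))\<^sup>2) * indicator K' x \<partial>lborel)) * indicator {0..1} t"
      by (rule mult.assoc[symmetric])
    finally show "(\<integral>\<^sup>+ x. ennreal ((norm z)\<^sup>2) * (ennreal ((norm (G (x + t *\<^sub>R z)))\<^sup>2) * indicator K' (x + t *\<^sub>R z) * indicator {0..1} t) \<partial>lborel)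
      = (ennreal ((norm z)\<^sup>2) * (\<integral>\<^sup>+ x. ennreal ((norm (G x))\<^sup>2) * indicator K' x \<partial>lborel)) * indicator {0..1} t" .
  qed
  also have "\<dots> = ennreal ((norm z)\<^sup>2) * (\<integral>\<^sup>+ x. ennreal ((norm (G x))\<^sup>2) * indicator K' x \<partial>lborel)"
    by (subst nn_integral_cmult_indicator) auto
  also have "(\<integral>\<^sup>+ x. ennreal ((norm (G x))\<^sup>2) * indicator K' x \<partial>lborel) = (\<integral>\<^sup>+ x. (\<Sum>i\<in>UNIV. ennreal (\<bar>partial_deriv i F x\<bar>\<^sup>2) * indicator K' x) \<partial>lborel)"
  proof (rule nn_integral_cong)
    fix x
    have "(norm (G x))\<^sup>2 = (\<Sum>i\<in>UNIV. \<bar>partial_deriv i F x\<bar>\<^sup>2)"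
      unfolding power2_norm_eq_inner by (simp add: inner_vec_def G_def power2_eq_square)
    then show "ennreal ((norm (G x))\<^sup>2) * indicator K' x = (\<Sum>i\<in>UNIV. ennreal (\<bar>partial_deriv i F x\<bar>\<^sup>2) * indicator K' x)"
      by (simp add: sum_distrib_right[symmetric])
  qed
  also have "\<dots> = (\<Sum>i\<in>UNIV. \<integral>\<^sup>+ x. ennreal (\<bar>partial_deriv i F x\<bar>\<^sup>2) * indicator K' x \<partial>lborel)"
    by (rule nn_integral_sum) measurable
  finally show ?thesis .
qed

lemma open_segment_region:
  fixes \<Omega> :: "'a::euclidean_space set"
  assumes "open \<Omega>"
  shows "open {x. closed_segment x (x + z) \<subseteq> \<Omega>}"
  unfolding open_contains_ball
proof
  fix x assume "x \<in> {x. closed_segment x (x + z) \<subseteq> \<Omega>}"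
  then have "closed_segment x (x + z) \<subseteq> \<Omega>" by simp
  then obtain e where e: "e > 0" "(\<Union>p\<in>closed_segment x (x + z). cball p e) \<subseteq> \<Omega>"
    using compact_subset_open_imp_cball_epsilon_subset[OF compact_segment assms] by blast
  have "closed_segment y (y + z) \<subseteq> \<Omega>" if y: "y \<in> ball x e" for y
  proof
    fix q assume "q \<in> closed_segment y (y + z)"
    then have "q - (y - x) \<in> closed_segment x (x + z)"
      using closed_segment_translation_eq[of "y - x" "q - (y - x)" x "x + z"] by (simp add: algebra_simps)
    moreover have "q \<in> cball (q - (y - x)) e" using y by (simp add: dist_norm norm_minus_commute)
    ultimately show "q \<in> \<Omega>" using e(2) by blast
  qed
  then show "\<exists>e>0. ball x e \<subseteq> {x. closed_segment x (x + z) \<subseteq> \<Omega>}" using e(1) by blast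
qed

text \<open>
  Fatou's lemma, twice: along an almost everywhere convergent subsequence of smooth approximations on a compact
  set of base points, and along an exhaustion of the open set of base points whose segment lies in \<open>\<Omega>\<close>. The Borel
  representative \<open>h0\<close> makes translates and double integrals measurable.
\<close>

lemma weak_translation_estimate:
  fixes h h0 :: "real ^ 'd \<Rightarrow> real"
  assumes S: "open \<Omega>" and hi: "\<And>i. has_weak_deriv \<Omega> (count (mset [i])) h (hi i)"
    and h0[measurable]: "h0 \<in> borel_measurable borel" and ae: "AE x in lebesgue_on \<Omega>. h x = h0 x"
  shows "(\<integral>\<^sup>+ x. ennreal ((h0 (x + z) - h0 x)\<^sup>2) * indicator {x. closed_segment x (x + z) \<subseteq> \<Omega>} x \<partial>lborel)
    \<le> ennreal ((norm z)\<^sup>2) * (\<Sum>i\<in>UNIV. L2_norm_sq \<Omega> (hi i))" (is "?I {x. ?S x} \<le> ?B")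
proof -
  have lh: "locally_integrable_on h \<Omega>" using hi by (simp add: has_weak_deriv_def)
  define g where "g js = (case js of [] \<Rightarrow> h | i # _ \<Rightarrow> hi i)" for js
  have g: "has_weak_deriv \<Omega> (count (mset js)) h (g js)" if "length js \<le> 1" for js
  proof (cases js)
    case Nil
    then show ?thesis unfolding has_weak_deriv_list using lh by (simp add: g_def)
  next
    case (Cons i ks)
    then show ?thesis using that hi[of i] by (simp add: g_def)
  qed
  have L2: "L2_norm_sq \<Omega> u = (\<integral>\<^sup>+ x. ennreal (\<bar>u x\<bar>\<^sup>2) * indicator \<Omega> x \<partial>lebesgue)" for u
    unfolding L2_norm_sq_def using S by (subst nn_integral_restrict_space) auto
  have ae': "AE x in lebesgue. x \<in> \<Omega> \<longrightarrow> h x = h0 x" using ae S by (simp add: AE_restrict_space_iff)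
  have compact_case: "?I K \<le> ?B" if K: "compact K" "K \<subseteq> {x. ?S x}" for K
  proof -
    define K' where "K' = (\<lambda>(x, t). x + t *\<^sub>R z) ` (K \<times> {0..1})"
    have K': "compact K'" unfolding K'_def
      by (intro compact_continuous_image compact_Times K(1) compact_Icc) (auto simp: split_def intro!: continuous_intros)
    have seg: "x + t *\<^sub>R z \<in> K'" if "x \<in> K" "0 \<le> t" "t \<le> 1" for x t using that by (force simp: K'_def)
    have K'\<Omega>: "K' \<subseteq> \<Omega>"
    proof
      fix y assume "y \<in> K'"
      then obtain x t where xt: "x \<in> K" "0 \<le> t" "t \<le> 1" "y = x + t *\<^sub>R z" by (auto simp: K'_def)
      then have "y \<in> closed_segment x (x + z)" unfolding closed_segment_def by (auto intro!: exI[of _ t] simp: algebra_simps)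
      then show "y \<in> \<Omega>" using K(2) xt(1) by blast
    qed
    have [measurable]: "K \<in> sets borel" "K' \<in> sets borel" using K K' by (auto intro: borel_compact)
    obtain F :: "nat \<Rightarrow> real ^ 'd \<Rightarrow> real" where F: "\<And>n. smooth (F n)"
      and F0: "(\<lambda>n. \<integral>\<^sup>+ x. ennreal \<bar>F n x - h x\<bar> * indicator K' x \<partial>lebesgue) \<longlonglongrightarrow> 0"
      and "\<And>js. length js \<le> 1 \<Longrightarrow> (\<lambda>n. \<integral>\<^sup>+ x. ennreal \<bar>pd js (F n) x - g js x\<bar> * indicator K' x \<partial>lebesgue) \<longlonglongrightarrow> 0"
      and Fg: "\<And>js n. length js \<le> 1 \<Longrightarrow> (\<integral>\<^sup>+ x. ennreal (\<bar>pd js (F n) x\<bar>\<^sup>2) * indicator K' x \<partial>lebesgue)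
        \<le> (\<integral>\<^sup>+ x. ennreal (\<bar>g js x\<bar>\<^sup>2) * indicator \<Omega> x \<partial>lebesgue)"
      by (rule smooth_approximation[where k = 1 and g = g, OF S K' K'\<Omega> lh g], assumption) (rule that; fast)
    have [measurable]: "F n \<in> borel_measurable borel" for n
      using smooth_continuous[OF F] by (rule borel_measurable_continuous_onI)
    define u where "u n x = indicator K' x *\<^sub>R (F n x - h0 x)" for n x
    have aeK: "AE x in lebesgue. x \<in> K' \<longrightarrow> h x = h0 x" using ae' by eventually_elim (use K'\<Omega> in blast)
    have un: "(\<integral>\<^sup>+ x. ennreal (norm (u n x)) \<partial>lborel) = (\<integral>\<^sup>+ x. ennreal \<bar>F n x - h x\<bar> * indicator K' x \<partial>lebesgue)" for n
      unfolding nn_integral_completion[symmetric, of lborel "\<lambda>x. ennreal (norm (u n x))"]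
      by (rule nn_integral_cong_AE) (use aeK in eventually_elim, auto simp: u_def indicator_def)
    have um[measurable]: "u n \<in> borel_measurable borel" for n unfolding u_def by measurable
    have ui: "integrable lborel (u n)" for n
    proof -
      have "integrable lebesgue (\<lambda>x. indicator K' x *\<^sub>R F n x - indicator K' x *\<^sub>R h x)"
        using smooth_locally_integrable[OF F[of n], of \<Omega>] lh K' K'\<Omega>
        by (intro Bochner_Integration.integrable_diff) (auto simp: locally_integrable_on_def set_integrable_def)
      then have "integrable lebesgue (u n)"
      proof (rule integrable_cong_AE_imp)
        show "u n \<in> borel_measurable lebesgue" by (rule measurable_completion) simp
        show "AE x in lebesgue. indicator K' x *\<^sub>R F n x - indicator K' x *\<^sub>R h x = u n x"
          using aeK by eventually_elim (auto simp: u_def indicator_def)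
      qed
      then show ?thesis by (subst (asm) integrable_completion) auto
    qed
    have "(\<lambda>n. ennreal (\<integral>x. norm (u n x) \<partial>lborel)) \<longlonglongrightarrow> ennreal 0"
      using F0 unfolding un[symmetric] by (subst (asm) nn_integral_eq_integral) (use ui in auto)
    then have "(\<lambda>n. \<integral>x. norm (u n x) \<partial>lborel) \<longlonglongrightarrow> 0"
      by (rule tendsto_ennrealD) auto
    from tendsto_L1_AE_subseq[OF ui this] obtain r where r: "AE x in lborel. (\<lambda>n. u (r n) x) \<longlonglongrightarrow> 0" by blast
    show ?thesis
    proof (rule nn_integral_le_of_AE_limit[where u = "\<lambda>n x. ennreal ((F (r n) (x + z) - F (r n) x)\<^sup>2) * indicator K x"])
      show "AE x in lborel. (\<lambda>n. ennreal ((F (r n) (x + z) - F (r n) x)\<^sup>2) * indicator K x) \<longlonglongrightarrow> ennreal ((h0 (x + z) - h0 x)\<^sup>2) * indicator K x"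
        using r AE_lborel_shift[OF r, of z]
      proof eventually_elim
        case (elim x)
        show ?case
        proof (cases "x \<in> K")
          case True
          have "x \<in> K'" "x + z \<in> K'" using seg[OF True, of 0] seg[OF True, of 1] by auto
          then have a: "(\<lambda>n. F (r n) x - h0 x) \<longlonglongrightarrow> 0" and b: "(\<lambda>n. F (r n) (x + z) - h0 (x + z)) \<longlonglongrightarrow> 0"
            using elim by (auto simp: u_def)
          have "(\<lambda>n. F (r n) x) \<longlonglongrightarrow> h0 x" "(\<lambda>n. F (r n) (x + z)) \<longlonglongrightarrow> h0 (x + z)"
            using LIM_zero_cancel[OF a] LIM_zero_cancel[OF b] .
          then have "(\<lambda>n. ennreal ((F (r n) (x + z) - F (r n) x)\<^sup>2)) \<longlonglongrightarrow> ennreal ((h0 (x + z) - h0 x)\<^sup>2)"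
            by (intro tendsto_ennrealI tendsto_intros)
          then show ?thesis using True by simp
        qed simp
      qed
      fix n
      have "(\<integral>\<^sup>+ x. ennreal ((F (r n) (x + z) - F (r n) x)\<^sup>2) * indicator K x \<partial>lborel)
        \<le> ennreal ((norm z)\<^sup>2) * (\<Sum>i\<in>UNIV. \<integral>\<^sup>+ x. ennreal (\<bar>partial_deriv i (F (r n)) x\<bar>\<^sup>2) * indicator K' x \<partial>lborel)"
        by (rule smooth_translation_estimate[OF F K(1) K' seg])
      also have "\<dots> \<le> ?B"
      proof (intro mult_left_mono sum_mono)
        fix i
        show "(\<integral>\<^sup>+ x. ennreal (\<bar>partial_deriv i (F (r n)) x\<bar>\<^sup>2) * indicator K' x \<partial>lborel) \<le> L2_norm_sq \<Omega> (hi i)"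
          using Fg[of "[i]" "r n"] by (simp add: L2 g_def nn_integral_completion)
      qed simp
      finally show "(\<integral>\<^sup>+ x. ennreal ((F (r n) (x + z) - F (r n) x)\<^sup>2) * indicator K x \<partial>lborel) \<le> ?B" .
    qed measurable
  qed
  define R where "R = {x. ?S x}"
  have "open R" unfolding R_def by (rule open_segment_region[OF S])
  then obtain C :: "nat \<Rightarrow> (real ^ 'd) set" where C: "\<And>n. compact (C n)" "\<And>n. C n \<subseteq> R"
      and ex: "\<And>K. compact K \<Longrightarrow> K \<subseteq> R \<Longrightarrow> \<exists>N. \<forall>n\<ge>N. K \<subseteq> C n"
    using open_Union_compact_subsets by metis
  show ?thesis
  proof (rule nn_integral_le_of_AE_limit[where u = "\<lambda>n x. ennreal ((h0 (x + z) - h0 x)\<^sup>2) * indicator (C n) x"])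
    show "?I (C n) \<le> ?B" for n by (rule compact_case[OF C[unfolded R_def]])
    have [measurable]: "C n \<in> sets borel" for n by (rule borel_compact[OF C(1)])
    show "(\<lambda>x. ennreal ((h0 (x + z) - h0 x)\<^sup>2) * indicator (C n) x) \<in> borel_measurable lborel" for n by measurable
    show "AE x in lborel. (\<lambda>n. ennreal ((h0 (x + z) - h0 x)\<^sup>2) * indicator (C n) x) \<longlonglongrightarrow> ennreal ((h0 (x + z) - h0 x)\<^sup>2) * indicator {x. ?S x} x"
    proof (rule AE_I2)
      fix x
      show "(\<lambda>n. ennreal ((h0 (x + z) - h0 x)\<^sup>2) * indicator (C n) x) \<longlonglongrightarrow> ennreal ((h0 (x + z) - h0 x)\<^sup>2) * indicator {x. ?S x} x"
      proof (cases "?S x")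
        case True
        obtain N where "\<And>n. n \<ge> N \<Longrightarrow> x \<in> C n" using ex[of "{x}"] True by (auto simp: R_def)
        then have "eventually (\<lambda>n. ennreal ((h0 (x + z) - h0 x)\<^sup>2) * indicator (C n) x = ennreal ((h0 (x + z) - h0 x)\<^sup>2)) sequentially"
          unfolding eventually_sequentially by (intro exI[of _ N]) auto
        then show ?thesis using True by (simp add: tendsto_eventually)
      next
        case False
        then have "x \<notin> C n" for n using C(2)[of n] by (auto simp: R_def)
        then show ?thesis using False by simp
      qed
    qed
  qed
qed

lemma sum3_sq_le: "(a + b + c)\<^sup>2 \<le> 3 * (a\<^sup>2 + b\<^sup>2 + c\<^sup>2)" for a b c :: real
proof -
  have "0 \<le> (a - b)\<^sup>2 + (a - c)\<^sup>2 + (b - c)\<^sup>2" by simp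
  then show ?thesis by (simp add: power2_eq_square algebra_simps)
qed

text \<open>
  For short \<open>z\<close> the difference is split along a detour into differences over three segments in \<open>\<Omega>\<close>. Their
  directions depend only on \<open>z\<close> and on one of finitely many \<open>v\<close>, so each is covered by the estimate for a
  single segment after a translation. For long \<open>z\<close> the \<open>L\<^sup>2\<close>-norm is enough.
\<close>

lemma domain_translation_estimate:
  fixes \<Omega> :: "(real ^ 'd) set"
  assumes \<Omega>: "bounded_lipschitz_domain \<Omega>"
  shows "\<exists>C\<ge>0. \<forall>h hi h0 z. (\<forall>i. has_weak_deriv \<Omega> (count (mset [i])) h (hi i)) \<longrightarrow> h0 \<in> borel_measurable borel \<longrightarrow>
       (AE x in lebesgue_on \<Omega>. h x = h0 x) \<longrightarrow>
       (\<integral>\<^sup>+ x. ennreal ((h0 (x + z) - h0 x)\<^sup>2) * indicator \<Omega> x * indicator \<Omega> (x + z) \<partial>lborel)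
        \<le> ennreal (C * (norm z)\<^sup>2) * (L2_norm_sq \<Omega> h + (\<Sum>i\<in>UNIV. L2_norm_sq \<Omega> (hi i)))"
proof -
  have S: "open \<Omega>" using \<Omega> by (auto simp: bounded_lipschitz_domain_def domain_set_def)
  obtain \<delta> V where \<delta>: "\<delta> > 0" and V: "finite V"
    and path: "\<And>x y. x \<in> \<Omega> \<Longrightarrow> y \<in> \<Omega> \<Longrightarrow> norm (x - y) < \<delta> \<Longrightarrow> \<exists>v\<in>V. detour \<Omega> v x y"
    using uniform_detours[OF \<Omega>] by blast
  define c where "c v = 3 * (2 * (norm v)\<^sup>2 + 1)" for v :: "real ^ 'd"
  define C1 where "C1 = (\<Sum>v\<in>V. c v)"
  define C where "C = max C1 (4 / \<delta>\<^sup>2)"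
  have c0: "c v \<ge> 0" for v by (simp add: c_def)
  have C0: "C \<ge> 0" "C1 \<ge> 0" using c0 by (auto simp: C_def C1_def sum_nonneg max.coboundedI1)
  have "(\<integral>\<^sup>+ x. ennreal ((h0 (x + z) - h0 x)\<^sup>2) * indicator \<Omega> x * indicator \<Omega> (x + z) \<partial>lborel)
      \<le> ennreal (C * (norm z)\<^sup>2) * (L2_norm_sq \<Omega> h + (\<Sum>i\<in>UNIV. L2_norm_sq \<Omega> (hi i)))"
    if hi: "\<And>i. has_weak_deriv \<Omega> (count (mset [i])) h (hi i)" and m[measurable]: "h0 \<in> borel_measurable borel"
      and ae: "AE x in lebesgue_on \<Omega>. h x = h0 x" for h hi h0 and z :: "real ^ 'd"
  proof -
    define N where "N = (\<Sum>i\<in>UNIV. L2_norm_sq \<Omega> (hi i))"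
    define H where "H = L2_norm_sq \<Omega> h"
    define T where "T w x = ennreal ((h0 (x + w) - h0 x)\<^sup>2) * indicator {x. closed_segment x (x + w) \<subseteq> \<Omega>} x" for w x
    have om[measurable]: "{x. closed_segment x (x + w) \<subseteq> \<Omega>} \<in> sets borel" for w
      by (rule borel_open[OF open_segment_region[OF S]])
    have [measurable]: "\<Omega> \<in> sets borel" using S by simp
    have Tm[measurable]: "T w \<in> borel_measurable borel" for w unfolding T_def by measurable
    have T: "(\<integral>\<^sup>+ x. T w x \<partial>lborel) \<le> ennreal ((norm w)\<^sup>2) * N" for w
      unfolding T_def N_def by (rule weak_translation_estimate[OF S hi m ae])
    let ?J = "\<lambda>x. ennreal ((h0 (x + z) - h0 x)\<^sup>2) * indicator \<Omega> x * indicator \<Omega> (x + z)"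
    show ?thesis
    proof (cases "norm z < \<delta>")
      case True
      let ?w = "\<lambda>v. norm z *\<^sub>R v"
      let ?E = "\<lambda>v x. 3 * (T (?w v) x + T z (x + ?w v) + T (?w v) (x + z))"
      have pt: "?J x \<le> (\<Sum>v\<in>V. ?E v x)" for x
      proof (cases "x \<in> \<Omega> \<and> x + z \<in> \<Omega>")
        case xz: True
        then obtain v where v: "v \<in> V" "detour \<Omega> v x (x + z)" using path[of x "x + z"] True by auto
        have ind: "closed_segment x (x + ?w v) \<subseteq> \<Omega>" "closed_segment (x + ?w v) (x + ?w v + z) \<subseteq> \<Omega>"
          "closed_segment (x + z) (x + z + ?w v) \<subseteq> \<Omega>"
          using v(2) by (auto simp: detour_def algebra_simps)
        let ?a = "h0 (x + ?w v) - h0 x" and ?b = "h0 (x + ?w v + z) - h0 (x + ?w v)" and ?c = "h0 (x + z + ?w v) - h0 (x + z)"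
        have "h0 (x + z) - h0 x = ?a + ?b + - ?c" by (simp add: algebra_simps)
        then have "(h0 (x + z) - h0 x)\<^sup>2 = (?a + ?b + - ?c)\<^sup>2" by (rule arg_cong)
        also have "\<dots> \<le> 3 * (?a\<^sup>2 + ?b\<^sup>2 + (- ?c)\<^sup>2)" by (rule sum3_sq_le)
        finally have sq: "(h0 (x + z) - h0 x)\<^sup>2 \<le> 3 * (?a\<^sup>2 + ?b\<^sup>2 + ?c\<^sup>2)" by (simp only: power2_minus)
        have "?J x = ennreal ((h0 (x + z) - h0 x)\<^sup>2)" using xz by simp
        also have "\<dots> \<le> ennreal (3 * (?a\<^sup>2 + ?b\<^sup>2 + ?c\<^sup>2))" by (rule ennreal_leI[OF sq])
        also have "\<dots> = ?E v x" using ind by (simp add: T_def ennreal_mult)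
        also have "\<dots> \<le> (\<Sum>v\<in>V. ?E v x)" by (rule member_le_sum[OF v(1) _ V]) simp
        finally show ?thesis .
      qed auto
      have "(\<integral>\<^sup>+ x. ?J x \<partial>lborel) \<le> (\<integral>\<^sup>+ x. (\<Sum>v\<in>V. ?E v x) \<partial>lborel)" by (rule nn_integral_mono) (rule pt)
      also have "\<dots> = (\<Sum>v\<in>V. \<integral>\<^sup>+ x. ?E v x \<partial>lborel)" by (rule nn_integral_sum) measurable
      also have "\<dots> \<le> (\<Sum>v\<in>V. ennreal (c v * (norm z)\<^sup>2) * N)"
      proof (rule sum_mono)
        fix v
        have "(\<integral>\<^sup>+ x. ?E v x \<partial>lborel) = 3 * ((\<integral>\<^sup>+ x. T (?w v) x \<partial>lborel) + (\<integral>\<^sup>+ x. T z (x + ?w v) \<partial>lborel) + (\<integral>\<^sup>+ x. T (?w v) (x + z) \<partial>lborel))"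
          by (simp add: nn_integral_cmult nn_integral_add)
        also have "\<dots> = 3 * ((\<integral>\<^sup>+ x. T (?w v) x \<partial>lborel) + (\<integral>\<^sup>+ x. T z x \<partial>lborel) + (\<integral>\<^sup>+ x. T (?w v) x \<partial>lborel))"
          by (simp add: nn_integral_lborel_shift[OF Tm])
        also have "\<dots> \<le> 3 * (ennreal ((norm (?w v))\<^sup>2) * N + ennreal ((norm z)\<^sup>2) * N + ennreal ((norm (?w v))\<^sup>2) * N)"
          by (intro mult_left_mono add_mono T) simp
        also have "\<dots> = 3 * (ennreal ((norm (?w v))\<^sup>2) + ennreal ((norm z)\<^sup>2) + ennreal ((norm (?w v))\<^sup>2)) * N"
          by (simp only: distrib_right mult.assoc)
        also have "3 * (ennreal ((norm (?w v))\<^sup>2) + ennreal ((norm z)\<^sup>2) + ennreal ((norm (?w v))\<^sup>2)) = ennreal 3 * ennreal ((norm (?w v))\<^sup>2 + (norm z)\<^sup>2 + (norm (?w v))\<^sup>2)"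
          by (simp only: ennreal_plus zero_le_power2 add_nonneg_nonneg ennreal_numeral)
        also have "\<dots> = ennreal (3 * ((norm (?w v))\<^sup>2 + (norm z)\<^sup>2 + (norm (?w v))\<^sup>2))"
          by (rule ennreal_mult[symmetric]) simp_all
        also have "3 * ((norm (?w v))\<^sup>2 + (norm z)\<^sup>2 + (norm (?w v))\<^sup>2) = c v * (norm z)\<^sup>2"
          by (simp add: c_def power_mult_distrib algebra_simps)
        finally show "(\<integral>\<^sup>+ x. ?E v x \<partial>lborel) \<le> ennreal (c v * (norm z)\<^sup>2) * N" .
      qed
      also have "\<dots> = ennreal (C1 * (norm z)\<^sup>2) * N"
        by (simp add: sum_distrib_right[symmetric] sum_ennreal c0 C1_def)
      also have "\<dots> \<le> ennreal (C * (norm z)\<^sup>2) * (H + N)"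
        by (intro mult_mono ennreal_leI mult_right_mono) (auto simp: C_def)
      finally show ?thesis by (simp add: H_def N_def)
    next
      case False
      have H: "H = (\<integral>\<^sup>+ x. ennreal ((h0 x)\<^sup>2) * indicator \<Omega> x \<partial>lborel)"
      proof -
        have "H = (\<integral>\<^sup>+ x. ennreal ((h0 x)\<^sup>2) \<partial>lebesgue_on \<Omega>)"
          unfolding H_def L2_norm_sq_def by (rule nn_integral_cong_AE) (use ae in eventually_elim, simp)
        also have "\<dots> = (\<integral>\<^sup>+ x. ennreal ((h0 x)\<^sup>2) * indicator \<Omega> x \<partial>lebesgue)"
          using S by (subst nn_integral_restrict_space) auto
        finally show ?thesis by (simp add: nn_integral_completion)
      qed
      let ?q = "\<lambda>x. ennreal ((h0 x)\<^sup>2) * indicator \<Omega> x"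
      have "(\<integral>\<^sup>+ x. ?J x \<partial>lborel) \<le> (\<integral>\<^sup>+ x. 2 * (?q (x + z) + ?q x) \<partial>lborel)"
      proof (rule nn_integral_mono)
        fix x
        have "(h0 (x + z) - h0 x)\<^sup>2 \<le> 2 * ((h0 (x + z))\<^sup>2 + (h0 x)\<^sup>2)"
          using zero_le_power2[of "h0 (x + z) + h0 x"] by (simp add: power2_eq_square algebra_simps)
        then have "ennreal ((h0 (x + z) - h0 x)\<^sup>2) \<le> ennreal (2 * ((h0 (x + z))\<^sup>2 + (h0 x)\<^sup>2))" by (rule ennreal_leI)
        also have "\<dots> = 2 * (ennreal ((h0 (x + z))\<^sup>2) + ennreal ((h0 x)\<^sup>2))" by (simp add: ennreal_mult)
        finally show "?J x \<le> 2 * (?q (x + z) + ?q x)"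
          by (cases "x \<in> \<Omega> \<and> x + z \<in> \<Omega>") auto
      qed
      also have "\<dots> = 2 * ((\<integral>\<^sup>+ x. ?q (x + z) \<partial>lborel) + (\<integral>\<^sup>+ x. ?q x \<partial>lborel))"
        by (simp add: nn_integral_cmult nn_integral_add)
      also have "(\<integral>\<^sup>+ x. ?q (x + z) \<partial>lborel) = (\<integral>\<^sup>+ x. ?q x \<partial>lborel)"
        by (rule nn_integral_lborel_shift[of ?q]) measurable
      also have "2 * ((\<integral>\<^sup>+ x. ?q x \<partial>lborel) + (\<integral>\<^sup>+ x. ?q x \<partial>lborel)) = ennreal 4 * H"
        unfolding H by (simp add: mult_2[symmetric] mult.assoc[symmetric])
      also have "\<dots> \<le> ennreal (C * (norm z)\<^sup>2) * (H + N)"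
      proof (intro mult_mono ennreal_leI)
        have "\<delta>\<^sup>2 \<le> (norm z)\<^sup>2" using False \<delta> by (intro power_mono) auto
        then have "4 \<le> 4 / \<delta>\<^sup>2 * (norm z)\<^sup>2" using \<delta> by (simp add: field_simps)
        also have "\<dots> \<le> C * (norm z)\<^sup>2" by (intro mult_right_mono) (auto simp: C_def)
        finally show "4 \<le> C * (norm z)\<^sup>2" .
      qed auto
      finally show ?thesis by (simp add: H_def N_def)
    qed
  qed
  with C0(1) show ?thesis by (intro exI[of _ C] conjI allI impI) simp_all
qed

section \<open>Gagliardo seminorms\<close>

lemma gagliardo_sq_cong:
  assumes "AE x in lebesgue_on \<Omega>. g x = h x"
  shows "gagliardo_sq \<Omega> r g = gagliardo_sq \<Omega> r h"
  unfolding gagliardo_sq_def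
proof (rule nn_integral_cong_AE, use assms in eventually_elim)
  case (elim x)
  show ?case
    by (rule nn_integral_cong_AE) (use assms in eventually_elim, simp add: elim)
qed

lemma L2_norm_sq_cong:
  assumes "AE x in lebesgue_on \<Omega>. g x = h x"
  shows "L2_norm_sq \<Omega> g = L2_norm_sq \<Omega> h"
  unfolding L2_norm_sq_def by (rule nn_integral_cong_AE) (use assms in eventually_elim, simp)

lemma nn_integral_lebesgue_on_lborel:
  assumes "open \<Omega>"
  shows "(\<integral>\<^sup>+ x. f x \<partial>lebesgue_on \<Omega>) = (\<integral>\<^sup>+ x. f x * indicator \<Omega> x \<partial>lborel)"
  using assms by (subst nn_integral_restrict_space) (auto simp: nn_integral_completion)

lemma borel_representative:
  fixes h :: "real ^ 'd \<Rightarrow> real"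
  assumes S: "open \<Omega>" and h: "h \<in> borel_measurable (lebesgue_on \<Omega>)"
  obtains h0 where "h0 \<in> borel_measurable borel" "AE x in lebesgue_on \<Omega>. h x = h0 x"
proof -
  have "(\<lambda>x. if x \<in> \<Omega> then h x else 0) \<in> borel_measurable (completion lborel)"
    using h S by (simp add: borel_measurable_if)
  from completion_ex_borel_measurable_real[OF this]
  obtain h0 where h0: "h0 \<in> borel_measurable lborel" "AE x in lborel. (if x \<in> \<Omega> then h x else 0) = h0 x" by blast
  have "AE x in lebesgue. x \<in> \<Omega> \<longrightarrow> h x = h0 x"
    using AE_completion[OF h0(2)] by eventually_elim auto
  then have "AE x in lebesgue_on \<Omega>. h x = h0 x" using S by (simp add: AE_restrict_space_iff)
  then show ?thesis using that[of h0] h0(1) by simp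
qed

lemma kernel_integral_bound:
  fixes \<Omega> :: "(real ^ 'd) set"
  assumes S: "open \<Omega>" and R: "\<And>x y. x \<in> \<Omega> \<Longrightarrow> y \<in> \<Omega> \<Longrightarrow> norm (x - y) \<le> R" and x: "x \<in> \<Omega>"
  shows "(\<integral>\<^sup>+ y. ennreal (norm (x - y) powr a) \<partial>lebesgue_on \<Omega>) \<le> (\<integral>\<^sup>+ z. ennreal (norm z powr a) * indicator (cball 0 R) z \<partial>(lborel :: (real ^ 'd) measure))"
proof -
  have "(\<integral>\<^sup>+ y. ennreal (norm (x - y) powr a) \<partial>lebesgue_on \<Omega>) = (\<integral>\<^sup>+ y. ennreal (norm (x - y) powr a) * indicator \<Omega> y \<partial>lborel)"
    by (rule nn_integral_lebesgue_on_lborel[OF S])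
  also have "\<dots> \<le> (\<integral>\<^sup>+ y. ennreal (norm (x - y) powr a) * indicator (cball 0 R) (x - y) \<partial>lborel)"
  proof (rule nn_integral_mono)
    fix y
    show "ennreal (norm (x - y) powr a) * indicator \<Omega> y \<le> ennreal (norm (x - y) powr a) * indicator (cball 0 R) (x - y)"
      using R[OF x, of y] by (cases "y \<in> \<Omega>") auto
  qed
  also have "\<dots> = (\<integral>\<^sup>+ z. ennreal (norm z powr a) * indicator (cball 0 R) z \<partial>(lborel :: (real ^ 'd) measure))"
  proof -
    have "(\<lambda>z :: real ^ 'd. ennreal (norm z powr a) * indicator (cball 0 R) z) \<in> borel_measurable borel"
      by (intro borel_measurable_times_ennreal borel_measurable_indicator) simp_all
    from nn_integral_lborel_reflect[OF this, of x] show ?thesis .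
  qed
  finally show ?thesis .
qed

lemma sq_div_powr:
  fixes n p :: real
  assumes "n \<ge> 0"
  shows "n\<^sup>2 / n powr p = n powr (2 - p)"
proof (cases "n = 0")
  case False
  then have "n\<^sup>2 = n powr 2" using assms by (simp add: powr_numeral)
  then show ?thesis by (simp add: powr_diff)
qed simp

lemma bounded_diameter_bound:
  fixes \<Omega> :: "'a::real_normed_vector set"
  assumes "bounded \<Omega>"
  obtains R where "R > 0" "\<And>x y. x \<in> \<Omega> \<Longrightarrow> y \<in> \<Omega> \<Longrightarrow> norm (x - y) \<le> R"
proof -
  obtain B where B: "\<And>x. x \<in> \<Omega> \<Longrightarrow> norm x \<le> B" using assms by (auto simp: bounded_iff)
  have "norm (x - y) \<le> 2 * \<bar>B\<bar> + 1" if "x \<in> \<Omega>" "y \<in> \<Omega>" for x y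
    using norm_triangle_ineq4[of x y] B[OF that(1)] B[OF that(2)] by linarith
  then show thesis using that[of "2 * \<bar>B\<bar> + 1"] by simp
qed

text \<open>
  Substituting \<open>y = x + z\<close> and integrating over \<open>x\<close> first, the seminorm is at most
  \<open>\<integral> C |z|\<^sup>2 |z|\<^bsup>-d-2r\<^esup> dz\<close> over a ball, and this integral is finite because \<open>r < 1\<close>.
\<close>

proposition gagliardo_embedding:
  fixes \<Omega> :: "(real ^ 'd) set"
  assumes \<Omega>: "bounded_lipschitz_domain \<Omega>" and r: "0 < r" "r < 1"
  shows "\<exists>C\<ge>0. \<forall>h hi. (\<forall>i. has_weak_deriv \<Omega> (count (mset [i])) h (hi i)) \<longrightarrow>
       gagliardo_sq \<Omega> r h \<le> ennreal C * (L2_norm_sq \<Omega> h + (\<Sum>i\<in>UNIV. L2_norm_sq \<Omega> (hi i)))"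
proof -
  have S: "open \<Omega>" and bd: "bounded \<Omega>" using \<Omega> by (auto simp: bounded_lipschitz_domain_def domain_set_def)
  obtain C where C: "C \<ge> 0" and est0: "\<forall>h hi h0 z. (\<forall>i. has_weak_deriv \<Omega> (count (mset [i])) h (hi i)) \<longrightarrow> h0 \<in> borel_measurable borel \<longrightarrow>
       (AE x in lebesgue_on \<Omega>. h x = h0 x) \<longrightarrow>
       (\<integral>\<^sup>+ x. ennreal ((h0 (x + z) - h0 x)\<^sup>2) * indicator \<Omega> x * indicator \<Omega> (x + z) \<partial>lborel)
        \<le> ennreal (C * (norm z)\<^sup>2) * (L2_norm_sq \<Omega> h + (\<Sum>i\<in>UNIV. L2_norm_sq \<Omega> (hi i)))"
    using domain_translation_estimate[OF \<Omega>] by (elim exE conjE)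
  note est = est0[rule_format]
  define p where "p = real CARD('d) + 2 * r"
  obtain R where R: "R > 0" "\<And>x y. x \<in> \<Omega> \<Longrightarrow> y \<in> \<Omega> \<Longrightarrow> norm (x - y) \<le> R"
    using bounded_diameter_bound[OF bd] by blast
  define I where "I = (\<integral>\<^sup>+ z. ennreal (norm z powr (2 - p)) * indicator (cball 0 R) z \<partial>(lborel :: (real ^ 'd) measure))"
  have I: "I < \<infinity>" unfolding I_def by (rule riesz_kernel_finite) (use r R in \<open>auto simp: p_def\<close>)
  define C' where "C' = C * enn2real I"
  have C': "C' \<ge> 0" using C by (simp add: C'_def)
  have "gagliardo_sq \<Omega> r h \<le> ennreal C' * (L2_norm_sq \<Omega> h + (\<Sum>i\<in>UNIV. L2_norm_sq \<Omega> (hi i)))"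
    if hi: "\<And>i. has_weak_deriv \<Omega> (count (mset [i])) h (hi i)" for h hi
  proof -
    define N where "N = L2_norm_sq \<Omega> h + (\<Sum>i\<in>UNIV. L2_norm_sq \<Omega> (hi i))"
    have "h \<in> borel_measurable (lebesgue_on \<Omega>)"
      using hi by (intro locally_integrable_measurable[OF S]) (simp add: has_weak_deriv_def)
    then obtain h0 where m[measurable]: "h0 \<in> borel_measurable borel" and ae: "AE x in lebesgue_on \<Omega>. h x = h0 x"
      using borel_representative[OF S] by metis
    have [measurable]: "\<Omega> \<in> sets borel" using S by simp
    let ?k = "\<lambda>z :: real ^ 'd. ennreal (1 / norm z powr p)"
    let ?J = "\<lambda>z x. ennreal ((h0 (x + z) - h0 x)\<^sup>2) * indicator \<Omega> x * indicator \<Omega> (x + z)"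
    have "gagliardo_sq \<Omega> r h = gagliardo_sq \<Omega> r h0" by (rule gagliardo_sq_cong[OF ae])
    also have "\<dots> = (\<integral>\<^sup>+ x. (\<integral>\<^sup>+ y. ennreal (\<bar>h0 x - h0 y\<bar>\<^sup>2 / norm (x - y) powr p) * indicator \<Omega> y \<partial>lborel) * indicator \<Omega> x \<partial>lborel)"
      unfolding gagliardo_sq_def p_def nn_integral_lebesgue_on_lborel[OF S] ..
    also have "\<dots> = (\<integral>\<^sup>+ x. \<integral>\<^sup>+ z. ?k z * ?J z x \<partial>lborel \<partial>lborel)"
    proof (rule nn_integral_cong)
      fix x
      have "(\<integral>\<^sup>+ y. ennreal (\<bar>h0 x - h0 y\<bar>\<^sup>2 / norm (x - y) powr p) * indicator \<Omega> y \<partial>lborel)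
          = (\<integral>\<^sup>+ z. ennreal (\<bar>h0 x - h0 (z + x)\<bar>\<^sup>2 / norm (x - (z + x)) powr p) * indicator \<Omega> (z + x) \<partial>lborel)"
        by (rule nn_integral_lborel_shift[symmetric, of "\<lambda>y. ennreal (\<bar>h0 x - h0 y\<bar>\<^sup>2 / norm (x - y) powr p) * indicator \<Omega> y"]) measurable
      then have "(\<integral>\<^sup>+ y. ennreal (\<bar>h0 x - h0 y\<bar>\<^sup>2 / norm (x - y) powr p) * indicator \<Omega> y \<partial>lborel) * indicator \<Omega> x
          = (\<integral>\<^sup>+ z. (ennreal (\<bar>h0 x - h0 (z + x)\<bar>\<^sup>2 / norm (x - (z + x)) powr p) * indicator \<Omega> (z + x)) * indicator \<Omega> x \<partial>lborel)"
        by (simp only:) (rule nn_integral_multc[symmetric], measurable)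
      also have "\<dots> = (\<integral>\<^sup>+ z. ?k z * ?J z x \<partial>lborel)"
      proof (rule nn_integral_cong)
        fix z
        have "ennreal (\<bar>h0 x - h0 (z + x)\<bar>\<^sup>2 / norm (x - (z + x)) powr p) = ?k z * ennreal ((h0 (x + z) - h0 x)\<^sup>2)"
          by (subst ennreal_mult[symmetric]) (auto simp: add.commute power2_commute)
        then show "(ennreal (\<bar>h0 x - h0 (z + x)\<bar>\<^sup>2 / norm (x - (z + x)) powr p) * indicator \<Omega> (z + x)) * indicator \<Omega> x = ?k z * ?J z x"
          by (simp only: mult_ac add.commute)
      qed
      finally show "(\<integral>\<^sup>+ y. ennreal (\<bar>h0 x - h0 y\<bar>\<^sup>2 / norm (x - y) powr p) * indicator \<Omega> y \<partial>lborel) * indicator \<Omega> x = (\<integral>\<^sup>+ z. ?k z * ?J z x \<partial>lborel)" .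
    qed
    also have "\<dots> = (\<integral>\<^sup>+ z. \<integral>\<^sup>+ x. ?k z * ?J z x \<partial>lborel \<partial>lborel)"
      by (rule lborel_pair.Fubini') measurable
    also have "\<dots> \<le> (\<integral>\<^sup>+ z. (ennreal C * N) * (ennreal (norm z powr (2 - p)) * indicator (cball 0 R) z) \<partial>(lborel :: (real ^ 'd) measure))"
    proof (rule nn_integral_mono)
      fix z :: "real ^ 'd"
      have eq: "(\<integral>\<^sup>+ x. ?k z * ?J z x \<partial>lborel) = ?k z * (\<integral>\<^sup>+ x. ?J z x \<partial>lborel)"
        by (rule nn_integral_cmult) measurable
      show "(\<integral>\<^sup>+ x. ?k z * ?J z x \<partial>lborel) \<le> (ennreal C * N) * (ennreal (norm z powr (2 - p)) * indicator (cball 0 R) z)"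
      proof (cases "norm z \<le> R")
        case True
        have "(\<integral>\<^sup>+ x. ?k z * ?J z x \<partial>lborel) \<le> ?k z * (ennreal (C * (norm z)\<^sup>2) * N)"
          unfolding eq N_def by (rule mult_left_mono[OF est[OF hi m ae]]) simp
        also have "\<dots> = ennreal (1 / norm z powr p * (C * (norm z)\<^sup>2)) * N"
          using C by (simp add: mult.assoc[symmetric] ennreal_mult[symmetric])
        also have "1 / norm z powr p * (C * (norm z)\<^sup>2) = C * norm z powr (2 - p)"
        proof -
          have "1 / norm z powr p * (C * (norm z)\<^sup>2) = C * ((norm z)\<^sup>2 / norm z powr p)" by simp
          then show ?thesis by (simp only: sq_div_powr[OF norm_ge_zero])
        qed
        also have "ennreal (C * norm z powr (2 - p)) * N = (ennreal C * N) * ennreal (norm z powr (2 - p))"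
          using C by (simp add: ennreal_mult mult_ac)
        finally show ?thesis using True by simp
      next
        case False
        have "?J z x = 0" for x
          using R(2)[of x "x + z"] False by (auto simp: indicator_def)
        then show ?thesis by (simp only: mult_zero_right nn_integral_0_iff_AE) simp
      qed
    qed
    also have "\<dots> = (ennreal C * N) * I"
      unfolding I_def
      by (rule nn_integral_cmult, intro borel_measurable_times_ennreal borel_measurable_indicator) simp_all
    also have "\<dots> = ennreal C' * N"
      using C I by (simp add: C'_def ennreal_mult mult_ac)
    finally show ?thesis by (simp add: N_def)
  qed
  with C' show ?thesis by (intro exI[of _ C'] conjI allI impI) simp_all
qed

section \<open>Finite sums\<close>

lemma L2_norm_sq_sum_le:
  assumes I: "finite I" and m: "\<And>i. i \<in> I \<Longrightarrow> u i \<in> borel_measurable (lebesgue_on \<Omega>)"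
  shows "L2_norm_sq \<Omega> (\<lambda>x. \<Sum>i\<in>I. u i x) \<le> ennreal (card I) * (\<Sum>i\<in>I. L2_norm_sq \<Omega> (u i))"
proof -
  have "L2_norm_sq \<Omega> (\<lambda>x. \<Sum>i\<in>I. u i x) \<le> (\<integral>\<^sup>+ x. ennreal (card I) * (\<Sum>i\<in>I. ennreal (\<bar>u i x\<bar>\<^sup>2)) \<partial>lebesgue_on \<Omega>)"
    unfolding L2_norm_sq_def
  proof (rule nn_integral_mono)
    fix x
    have "\<bar>\<Sum>i\<in>I. u i x\<bar>\<^sup>2 \<le> card I * (\<Sum>i\<in>I. \<bar>u i x\<bar>\<^sup>2)"
      using sum_squared_le_sum_of_squares[of "\<lambda>i. u i x" I] I by (cases "I = {}") (auto simp: mult.commute)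
    then have "ennreal (\<bar>\<Sum>i\<in>I. u i x\<bar>\<^sup>2) \<le> ennreal (card I * (\<Sum>i\<in>I. \<bar>u i x\<bar>\<^sup>2))" by (rule ennreal_leI)
    also have "\<dots> = ennreal (card I) * ennreal (\<Sum>i\<in>I. \<bar>u i x\<bar>\<^sup>2)" by (rule ennreal_mult) (auto intro: sum_nonneg)
    also have "ennreal (\<Sum>i\<in>I. \<bar>u i x\<bar>\<^sup>2) = (\<Sum>i\<in>I. ennreal (\<bar>u i x\<bar>\<^sup>2))" by (rule sum_ennreal[symmetric]) simp
    finally show "ennreal (\<bar>\<Sum>i\<in>I. u i x\<bar>\<^sup>2) \<le> ennreal (card I) * (\<Sum>i\<in>I. ennreal (\<bar>u i x\<bar>\<^sup>2))" .
  qed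
  also have "\<dots> = ennreal (card I) * (\<integral>\<^sup>+ x. (\<Sum>i\<in>I. ennreal (\<bar>u i x\<bar>\<^sup>2)) \<partial>lebesgue_on \<Omega>)"
    by (rule nn_integral_cmult) (use m in measurable)
  also have "(\<integral>\<^sup>+ x. (\<Sum>i\<in>I. ennreal (\<bar>u i x\<bar>\<^sup>2)) \<partial>lebesgue_on \<Omega>) = (\<Sum>i\<in>I. L2_norm_sq \<Omega> (u i))"
    unfolding L2_norm_sq_def by (rule nn_integral_sum) (use m in measurable)
  finally show ?thesis .
qed

lemma gagliardo_sq_lborel:
  assumes "open \<Omega>"
  shows "gagliardo_sq \<Omega> r (u :: real ^ 'd \<Rightarrow> real) = (\<integral>\<^sup>+ x. (\<integral>\<^sup>+ y. ennreal (\<bar>u x - u y\<bar>\<^sup>2 / norm (x - y) powr (real CARD('d) + 2 * r)) * indicator \<Omega> y \<partial>lborel) * indicator \<Omega> x \<partial>lborel)"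
  unfolding gagliardo_sq_def nn_integral_lebesgue_on_lborel[OF assms] ..

lemma gagliardo_sq_sum_le_borel:
  fixes u :: "'i \<Rightarrow> real ^ 'd \<Rightarrow> real"
  assumes S: "open \<Omega>" and I: "finite I" and m[measurable]: "\<And>i. u i \<in> borel_measurable borel"
  shows "gagliardo_sq \<Omega> r (\<lambda>x. \<Sum>i\<in>I. u i x) \<le> ennreal (card I) * (\<Sum>i\<in>I. gagliardo_sq \<Omega> r (u i))"
proof -
  have [measurable]: "\<Omega> \<in> sets borel" using S by simp
  define p where "p = real CARD('d) + 2 * r"
  let ?k = "\<lambda>i x y. ennreal (\<bar>u i x - u i y\<bar>\<^sup>2 / norm (x - y) powr p) * indicator \<Omega> y"
  have pt: "ennreal (\<bar>(\<Sum>i\<in>I. u i x) - (\<Sum>i\<in>I. u i y)\<bar>\<^sup>2 / norm (x - y) powr p) * indicator \<Omega> y \<le> ennreal (card I) * (\<Sum>i\<in>I. ?k i x y)" for x y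
  proof -
    have "\<bar>(\<Sum>i\<in>I. u i x) - (\<Sum>i\<in>I. u i y)\<bar>\<^sup>2 = (\<Sum>i\<in>I. u i x - u i y)\<^sup>2" by (simp add: sum_subtractf)
    also have "\<dots> \<le> card I * (\<Sum>i\<in>I. \<bar>u i x - u i y\<bar>\<^sup>2)"
      using sum_squared_le_sum_of_squares[of "\<lambda>i. u i x - u i y" I] I by (cases "I = {}") (auto simp: mult.commute)
    finally have "\<bar>(\<Sum>i\<in>I. u i x) - (\<Sum>i\<in>I. u i y)\<bar>\<^sup>2 / norm (x - y) powr p \<le> card I * (\<Sum>i\<in>I. \<bar>u i x - u i y\<bar>\<^sup>2) / norm (x - y) powr p"
      by (rule divide_right_mono) simp
    also have "\<dots> = card I * (\<Sum>i\<in>I. \<bar>u i x - u i y\<bar>\<^sup>2 / norm (x - y) powr p)"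
      unfolding sum_divide_distrib[symmetric] by simp
    finally have "ennreal (\<bar>(\<Sum>i\<in>I. u i x) - (\<Sum>i\<in>I. u i y)\<bar>\<^sup>2 / norm (x - y) powr p) \<le> ennreal (card I * (\<Sum>i\<in>I. \<bar>u i x - u i y\<bar>\<^sup>2 / norm (x - y) powr p))"
      by (rule ennreal_leI)
    also have "\<dots> = ennreal (card I) * ennreal (\<Sum>i\<in>I. \<bar>u i x - u i y\<bar>\<^sup>2 / norm (x - y) powr p)"
      by (rule ennreal_mult) (auto intro: sum_nonneg)
    also have "ennreal (\<Sum>i\<in>I. \<bar>u i x - u i y\<bar>\<^sup>2 / norm (x - y) powr p) = (\<Sum>i\<in>I. ennreal (\<bar>u i x - u i y\<bar>\<^sup>2 / norm (x - y) powr p))"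
      by (rule sum_ennreal[symmetric]) simp
    finally show ?thesis by (cases "y \<in> \<Omega>") auto
  qed
  have "gagliardo_sq \<Omega> r (\<lambda>x. \<Sum>i\<in>I. u i x) \<le> (\<integral>\<^sup>+ x. (\<integral>\<^sup>+ y. ennreal (card I) * (\<Sum>i\<in>I. ?k i x y) \<partial>lborel) * indicator \<Omega> x \<partial>lborel)"
    unfolding gagliardo_sq_lborel[OF S] p_def[symmetric] by (intro nn_integral_mono mult_right_mono pt) simp
  also have "\<dots> = (\<integral>\<^sup>+ x. ennreal (card I) * (\<Sum>i\<in>I. (\<integral>\<^sup>+ y. ?k i x y \<partial>lborel) * indicator \<Omega> x) \<partial>lborel)"
  proof (rule nn_integral_cong)
    fix x
    have "(\<integral>\<^sup>+ y. ennreal (card I) * (\<Sum>i\<in>I. ?k i x y) \<partial>lborel) = ennreal (card I) * (\<integral>\<^sup>+ y. (\<Sum>i\<in>I. ?k i x y) \<partial>lborel)"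
      by (rule nn_integral_cmult) measurable
    also have "(\<integral>\<^sup>+ y. (\<Sum>i\<in>I. ?k i x y) \<partial>lborel) = (\<Sum>i\<in>I. \<integral>\<^sup>+ y. ?k i x y \<partial>lborel)"
      by (rule nn_integral_sum) measurable
    finally show "(\<integral>\<^sup>+ y. ennreal (card I) * (\<Sum>i\<in>I. ?k i x y) \<partial>lborel) * indicator \<Omega> x
        = ennreal (card I) * (\<Sum>i\<in>I. (\<integral>\<^sup>+ y. ?k i x y \<partial>lborel) * indicator \<Omega> x)"
      by (simp only: sum_distrib_right mult.assoc)
  qed
  also have "\<dots> = ennreal (card I) * (\<integral>\<^sup>+ x. (\<Sum>i\<in>I. (\<integral>\<^sup>+ y. ?k i x y \<partial>lborel) * indicator \<Omega> x) \<partial>lborel)"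
    by (rule nn_integral_cmult) measurable
  also have "(\<integral>\<^sup>+ x. (\<Sum>i\<in>I. (\<integral>\<^sup>+ y. ?k i x y \<partial>lborel) * indicator \<Omega> x) \<partial>lborel) = (\<Sum>i\<in>I. \<integral>\<^sup>+ x. (\<integral>\<^sup>+ y. ?k i x y \<partial>lborel) * indicator \<Omega> x \<partial>lborel)"
    by (rule nn_integral_sum) measurable
  also have "\<dots> = (\<Sum>i\<in>I. gagliardo_sq \<Omega> r (u i))" unfolding gagliardo_sq_lborel[OF S] p_def ..
  finally show ?thesis .
qed

text \<open>
  Borel representatives are used because additivity of the outer integral requires the inner one to be measurable
  as a function of \<open>x\<close>.
\<close>

lemma gagliardo_sq_sum_le:
  fixes u :: "'i \<Rightarrow> real ^ 'd \<Rightarrow> real"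
  assumes S: "open \<Omega>" and I: "finite I" and m: "\<And>i. i \<in> I \<Longrightarrow> u i \<in> borel_measurable (lebesgue_on \<Omega>)"
  shows "gagliardo_sq \<Omega> r (\<lambda>x. \<Sum>i\<in>I. u i x) \<le> ennreal (card I) * (\<Sum>i\<in>I. gagliardo_sq \<Omega> r (u i))"
proof -
  have "\<forall>i. \<exists>v. v \<in> borel_measurable borel \<and> (i \<in> I \<longrightarrow> (AE x in lebesgue_on \<Omega>. u i x = v x))"
  proof
    fix i
    show "\<exists>v. v \<in> borel_measurable borel \<and> (i \<in> I \<longrightarrow> (AE x in lebesgue_on \<Omega>. u i x = v x))"
    proof (cases "i \<in> I")
      case True
      then show ?thesis using borel_representative[OF S m[OF True]] by metis
    next
      case False
      then show ?thesis by (intro exI[of _ "\<lambda>x. 0"]) auto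
    qed
  qed
  from choice[OF this] obtain v where v: "\<And>i. v i \<in> borel_measurable borel" "\<And>i. i \<in> I \<Longrightarrow> AE x in lebesgue_on \<Omega>. u i x = v i x"
    by blast
  have "AE x in lebesgue_on \<Omega>. \<forall>i\<in>I. u i x = v i x" using v(2) I by (simp add: AE_finite_all)
  then have "AE x in lebesgue_on \<Omega>. (\<Sum>i\<in>I. u i x) = (\<Sum>i\<in>I. v i x)" by eventually_elim simp
  then have "gagliardo_sq \<Omega> r (\<lambda>x. \<Sum>i\<in>I. u i x) = gagliardo_sq \<Omega> r (\<lambda>x. \<Sum>i\<in>I. v i x)" by (rule gagliardo_sq_cong)
  also have "\<dots> \<le> ennreal (card I) * (\<Sum>i\<in>I. gagliardo_sq \<Omega> r (v i))" by (rule gagliardo_sq_sum_le_borel[OF S I v(1)])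
  also have "(\<Sum>i\<in>I. gagliardo_sq \<Omega> r (v i)) = (\<Sum>i\<in>I. gagliardo_sq \<Omega> r (u i))"
    by (intro sum.cong refl gagliardo_sq_cong[symmetric] v(2))
  finally show ?thesis .
qed

section \<open>Composition with a controlled map\<close>

lemma L2_norm_sq_compose_le:
  assumes A: "controlled_map X Y A c" and P: "\<And>x. x \<in> X \<Longrightarrow> \<bar>P x\<bar> \<le> B"
    and g: "g \<in> borel_measurable (lebesgue_on Y)"
  shows "L2_norm_sq X (\<lambda>x. P x * g (A x)) \<le> ennreal (B\<^sup>2 * c) * L2_norm_sq Y g"
proof -
  have c: "c \<ge> 0" and le: "\<And>u. u \<in> borel_measurable (lebesgue_on Y) \<Longrightarrow> (\<integral>\<^sup>+ x. u (A x) \<partial>lebesgue_on X) \<le> ennreal c * (\<integral>\<^sup>+ y. u y \<partial>lebesgue_on Y)"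
    using A by (auto simp: controlled_map_def)
  have "L2_norm_sq X (\<lambda>x. P x * g (A x)) \<le> (\<integral>\<^sup>+ x. ennreal (B\<^sup>2) * ennreal (\<bar>g (A x)\<bar>\<^sup>2) \<partial>lebesgue_on X)"
    unfolding L2_norm_sq_def
  proof (rule nn_integral_mono)
    fix x assume "x \<in> space (lebesgue_on X)"
    then have "\<bar>P x\<bar>\<^sup>2 \<le> B\<^sup>2" using P[of x] by (intro power_mono) auto
    then have "\<bar>P x * g (A x)\<bar>\<^sup>2 \<le> B\<^sup>2 * \<bar>g (A x)\<bar>\<^sup>2"
      by (simp add: power_mult_distrib mult_right_mono)
    then have "ennreal (\<bar>P x * g (A x)\<bar>\<^sup>2) \<le> ennreal (B\<^sup>2 * \<bar>g (A x)\<bar>\<^sup>2)" by (rule ennreal_leI)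
    then show "ennreal (\<bar>P x * g (A x)\<bar>\<^sup>2) \<le> ennreal (B\<^sup>2) * ennreal (\<bar>g (A x)\<bar>\<^sup>2)" by (simp add: ennreal_mult)
  qed
  also have "\<dots> \<le> ennreal c * (\<integral>\<^sup>+ y. ennreal (B\<^sup>2) * ennreal (\<bar>g y\<bar>\<^sup>2) \<partial>lebesgue_on Y)"
    by (rule le) (use g in measurable)
  also have "(\<integral>\<^sup>+ y. ennreal (B\<^sup>2) * ennreal (\<bar>g y\<bar>\<^sup>2) \<partial>lebesgue_on Y) = ennreal (B\<^sup>2) * L2_norm_sq Y g"
    unfolding L2_norm_sq_def by (rule nn_integral_cmult) (use g in measurable)
  finally show ?thesis using c by (simp add: ennreal_mult mult_ac)
qed

lemma borel_measurable_lebesgue_on: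
  "f \<in> borel_measurable borel \<Longrightarrow> f \<in> borel_measurable (lebesgue_on \<Omega>)"
  by (intro measurable_restrict_space1 measurable_completion) simp

text \<open>
  The pointwise form of the estimate for the composition, with \<open>n = |x - y|\<close>, \<open>N = |A x - A y|\<close>, \<open>D = g (A x) - g (A y)\<close>,
  \<open>a = g (A x)\<close>, \<open>b = P y\<close> and \<open>q = P x - P y\<close>.
\<close>

lemma gagliardo_quotient_le:
  fixes n N p La D a b q l :: real
  assumes n: "n \<ge> 0" and N: "0 \<le> N" "N \<le> La * n" "N = 0 \<Longrightarrow> D = 0" and La: "La > 0" and p: "p > 0"
    and b: "\<bar>b\<bar> \<le> B" and q: "\<bar>q\<bar> \<le> l * n"
  shows "\<bar>b * D + a * q\<bar>\<^sup>2 / n powr p \<le> 2 * B\<^sup>2 * La powr p * (D\<^sup>2 / N powr p) + 2 * l\<^sup>2 * a\<^sup>2 * n powr (2 - p)"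
proof -
  have "\<bar>b * D + a * q\<bar>\<^sup>2 \<le> 2 * (b * D)\<^sup>2 + 2 * (a * q)\<^sup>2"
    using zero_le_power2[of "b * D - a * q"] by (simp add: power2_eq_square algebra_simps)
  also have "\<dots> \<le> 2 * (B\<^sup>2 * D\<^sup>2) + 2 * (a\<^sup>2 * (l * n)\<^sup>2)"
  proof -
    have "\<bar>b\<bar>\<^sup>2 \<le> B\<^sup>2" "\<bar>q\<bar>\<^sup>2 \<le> (l * n)\<^sup>2" using b q by (intro power_mono; simp)+
    then show ?thesis unfolding power_mult_distrib[of b] power_mult_distrib[of a]
      by (intro add_mono mult_left_mono mult_right_mono) auto
  qed
  finally have "\<bar>b * D + a * q\<bar>\<^sup>2 / n powr p \<le> (2 * (B\<^sup>2 * D\<^sup>2) + 2 * (a\<^sup>2 * (l * n)\<^sup>2)) / n powr p"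
    by (rule divide_right_mono) simp
  also have "\<dots> = 2 * B\<^sup>2 * (D\<^sup>2 / n powr p) + 2 * l\<^sup>2 * a\<^sup>2 * (n\<^sup>2 / n powr p)"
    by (simp add: add_divide_distrib power_mult_distrib mult_ac)
  also have "n\<^sup>2 / n powr p = n powr (2 - p)" by (rule sq_div_powr[OF n])
  also have "D\<^sup>2 / n powr p \<le> La powr p * (D\<^sup>2 / N powr p)"
  proof (cases "N = 0")
    case False
    then have Np: "N > 0" using N by simp
    then have np: "n > 0" using N(2) La n by (metis less_le mult_zero_right not_less)
    have "N powr p \<le> (La * n) powr p" using N p by (intro powr_mono2) auto
    also have "\<dots> = La powr p * n powr p" using La n by (simp add: powr_mult)
    finally have "D\<^sup>2 * N powr p \<le> D\<^sup>2 * (La powr p * n powr p)" by (rule mult_left_mono) simp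
    then show ?thesis using Np np by (simp add: field_simps)
  qed (use N in simp)
  finally show ?thesis by (simp add: mult.assoc mult_left_mono)
qed

text \<open>
  In \<open>P x g(A x) - P y g(A y) = P y (g(A x) - g(A y)) + g(A x) (P x - P y)\<close> the first term is compared with the seminorm
  of \<open>g\<close> because \<open>|A x - A y| \<le> La |x - y|\<close>; the second gains a factor \<open>|x - y|\<close>, which makes the kernel
  integrable in \<open>y\<close>.
\<close>

proposition gagliardo_compose:
  fixes A :: "real ^ 'd \<Rightarrow> real ^ 'd"
  assumes A: "controlled_map X Y A c" and bd: "bounded X"
    and La: "La > 0" "\<And>x y. x \<in> X \<Longrightarrow> y \<in> X \<Longrightarrow> norm (A x - A y) \<le> La * norm (x - y)"
    and P: "\<And>x. x \<in> X \<Longrightarrow> \<bar>P x\<bar> \<le> B" and LP: "\<And>x y. x \<in> X \<Longrightarrow> y \<in> X \<Longrightarrow> \<bar>P x - P y\<bar> \<le> l * norm (x - y)"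
    and r: "0 < r" "r < 1"
  shows "\<exists>C\<ge>0. \<forall>g\<in>borel_measurable (lebesgue_on Y).
    gagliardo_sq X r (\<lambda>x. P x * g (A x)) \<le> ennreal C * (gagliardo_sq Y r g + L2_norm_sq Y g)"
proof -
  have o: "open X" "open Y" and mA: "A \<in> measurable (lebesgue_on X) (lebesgue_on Y)" and c: "c \<ge> 0"
    and le: "\<And>u. u \<in> borel_measurable (lebesgue_on Y) \<Longrightarrow> (\<integral>\<^sup>+ x. u (A x) \<partial>lebesgue_on X) \<le> ennreal c * (\<integral>\<^sup>+ y. u y \<partial>lebesgue_on Y)"
    using A by (auto simp: controlled_map_def)
  define p where "p = real CARD('d) + 2 * r"
  have p: "p > 0" using r by (simp add: p_def)
  obtain R where R: "R > 0" "\<And>x y. x \<in> X \<Longrightarrow> y \<in> X \<Longrightarrow> norm (x - y) \<le> R" using bounded_diameter_bound[OF bd] by blast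
  define I where "I = (\<integral>\<^sup>+ z. ennreal (norm z powr (2 - p)) * indicator (cball 0 R) z \<partial>(lborel :: (real ^ 'd) measure))"
  have I: "I < \<infinity>" unfolding I_def by (rule riesz_kernel_finite) (use r R in \<open>auto simp: p_def\<close>)
  define k1 where "k1 = 2 * B\<^sup>2 * La powr p"
  define k2 where "k2 = 2 * l\<^sup>2"
  have k: "k1 \<ge> 0" "k2 \<ge> 0" by (auto simp: k1_def k2_def)
  \<comment> \<open>the change of variables is used in both variables for the first term, in one for the second\<close>
  define C where "C = k1 * c * c + k2 * enn2real I * c"
  have C: "C \<ge> 0" using k c by (simp add: C_def)
  have borel_case: "gagliardo_sq X r (\<lambda>x. P x * g (A x)) \<le> ennreal C * (gagliardo_sq Y r g + L2_norm_sq Y g)"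
    if g[measurable]: "g \<in> borel_measurable borel" for g
  proof -
    have [measurable]: "Y \<in> sets borel" using o by simp
    define \<Phi> where "\<Phi> u v = ennreal (\<bar>g u - g v\<bar>\<^sup>2 / norm (u - v) powr p)" for u v
    define \<Psi> where "\<Psi> u = (\<integral>\<^sup>+ v. \<Phi> u v \<partial>lebesgue_on Y)" for u
    have m\<Phi>: "\<Phi> u \<in> borel_measurable borel" for u unfolding \<Phi>_def by measurable
    have m\<Psi>: "\<Psi> \<in> borel_measurable borel"
      unfolding \<Psi>_def nn_integral_lebesgue_on_lborel[OF o(2)] \<Phi>_def by measurable
    have inner: "(\<integral>\<^sup>+ y. ennreal (\<bar>P x * g (A x) - P y * g (A y)\<bar>\<^sup>2 / norm (x - y) powr p) \<partial>lebesgue_on X)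
        \<le> ennreal (k1 * c) * \<Psi> (A x) + ennreal (k2 * enn2real I) * ennreal (\<bar>g (A x)\<bar>\<^sup>2)" if x: "x \<in> X" for x
    proof -
      have m1: "(\<lambda>y. \<Phi> (A x) (A y)) \<in> borel_measurable (lebesgue_on X)"
        by (rule measurable_compose[OF mA borel_measurable_lebesgue_on[OF m\<Phi>]])
      have m2: "(\<lambda>y. ennreal (norm (x - y) powr (2 - p))) \<in> borel_measurable (lebesgue_on X)"
        by (rule borel_measurable_lebesgue_on) measurable
      have "(\<integral>\<^sup>+ y. ennreal (\<bar>P x * g (A x) - P y * g (A y)\<bar>\<^sup>2 / norm (x - y) powr p) \<partial>lebesgue_on X)
        \<le> (\<integral>\<^sup>+ y. ennreal k1 * \<Phi> (A x) (A y) + ennreal (k2 * (g (A x))\<^sup>2) * ennreal (norm (x - y) powr (2 - p)) \<partial>lebesgue_on X)"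
      proof (rule nn_integral_mono)
        fix y assume "y \<in> space (lebesgue_on X)"
        then have y: "y \<in> X" by simp
        have "P x * g (A x) - P y * g (A y) = P y * (g (A x) - g (A y)) + g (A x) * (P x - P y)" by (simp add: algebra_simps)
        then have "\<bar>P x * g (A x) - P y * g (A y)\<bar>\<^sup>2 / norm (x - y) powr p
            = \<bar>P y * (g (A x) - g (A y)) + g (A x) * (P x - P y)\<bar>\<^sup>2 / norm (x - y) powr p" by (simp only:)
        also have "\<dots> \<le> 2 * B\<^sup>2 * La powr p * ((g (A x) - g (A y))\<^sup>2 / norm (A x - A y) powr p) + 2 * l\<^sup>2 * (g (A x))\<^sup>2 * norm (x - y) powr (2 - p)"
          by (rule gagliardo_quotient_le) (use La(2)[OF x y] La(1) p P[OF y] LP[OF x y] in auto)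
        finally have "ennreal (\<bar>P x * g (A x) - P y * g (A y)\<bar>\<^sup>2 / norm (x - y) powr p)
            \<le> ennreal (k1 * (\<bar>g (A x) - g (A y)\<bar>\<^sup>2 / norm (A x - A y) powr p) + k2 * (g (A x))\<^sup>2 * norm (x - y) powr (2 - p))"
          by (intro ennreal_leI) (simp add: k1_def k2_def)
        also have "\<dots> = ennreal (k1 * (\<bar>g (A x) - g (A y)\<bar>\<^sup>2 / norm (A x - A y) powr p)) + ennreal (k2 * (g (A x))\<^sup>2 * norm (x - y) powr (2 - p))"
          using k by (intro ennreal_plus) auto
        also have "ennreal (k1 * (\<bar>g (A x) - g (A y)\<bar>\<^sup>2 / norm (A x - A y) powr p)) = ennreal k1 * \<Phi> (A x) (A y)"
          unfolding \<Phi>_def using k by (intro ennreal_mult) auto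
        also have "ennreal (k2 * (g (A x))\<^sup>2 * norm (x - y) powr (2 - p)) = ennreal (k2 * (g (A x))\<^sup>2) * ennreal (norm (x - y) powr (2 - p))"
          using k by (intro ennreal_mult) auto
        finally show "ennreal (\<bar>P x * g (A x) - P y * g (A y)\<bar>\<^sup>2 / norm (x - y) powr p)
            \<le> ennreal k1 * \<Phi> (A x) (A y) + ennreal (k2 * (g (A x))\<^sup>2) * ennreal (norm (x - y) powr (2 - p))" .
      qed
      also have "\<dots> = ennreal k1 * (\<integral>\<^sup>+ y. \<Phi> (A x) (A y) \<partial>lebesgue_on X) + ennreal (k2 * (g (A x))\<^sup>2) * (\<integral>\<^sup>+ y. ennreal (norm (x - y) powr (2 - p)) \<partial>lebesgue_on X)"
        using m1 m2 by (simp add: nn_integral_add nn_integral_cmult)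
      also have "\<dots> \<le> ennreal k1 * (ennreal c * \<Psi> (A x)) + ennreal (k2 * (g (A x))\<^sup>2) * I"
      proof (intro add_mono mult_left_mono)
        show "(\<integral>\<^sup>+ y. \<Phi> (A x) (A y) \<partial>lebesgue_on X) \<le> ennreal c * \<Psi> (A x)"
          unfolding \<Psi>_def by (rule le[OF borel_measurable_lebesgue_on[OF m\<Phi>]])
        show "(\<integral>\<^sup>+ y. ennreal (norm (x - y) powr (2 - p)) \<partial>lebesgue_on X) \<le> I"
          unfolding I_def by (rule kernel_integral_bound[OF o(1) R(2) x])
      qed auto
      also have "\<dots> = ennreal (k1 * c) * \<Psi> (A x) + ennreal (k2 * enn2real I) * ennreal (\<bar>g (A x)\<bar>\<^sup>2)"
        using I k c by (simp add: ennreal_mult mult_ac)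
      finally show ?thesis .
    qed
    have "gagliardo_sq X r (\<lambda>x. P x * g (A x)) \<le> (\<integral>\<^sup>+ x. ennreal (k1 * c) * \<Psi> (A x) + ennreal (k2 * enn2real I) * ennreal (\<bar>g (A x)\<bar>\<^sup>2) \<partial>lebesgue_on X)"
      unfolding gagliardo_sq_def p_def[symmetric] by (rule nn_integral_mono) (use inner in simp)
    also have "\<dots> \<le> ennreal c * (\<integral>\<^sup>+ u. ennreal (k1 * c) * \<Psi> u + ennreal (k2 * enn2real I) * ennreal (\<bar>g u\<bar>\<^sup>2) \<partial>lebesgue_on Y)"
      by (rule le, rule borel_measurable_lebesgue_on) (use m\<Psi> in measurable)
    also have "(\<integral>\<^sup>+ u. ennreal (k1 * c) * \<Psi> u + ennreal (k2 * enn2real I) * ennreal (\<bar>g u\<bar>\<^sup>2) \<partial>lebesgue_on Y)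
        = ennreal (k1 * c) * (\<integral>\<^sup>+ u. \<Psi> u \<partial>lebesgue_on Y) + ennreal (k2 * enn2real I) * (\<integral>\<^sup>+ u. ennreal (\<bar>g u\<bar>\<^sup>2) \<partial>lebesgue_on Y)"
    proof -
      have "\<Psi> \<in> borel_measurable (lebesgue_on Y)" by (rule borel_measurable_lebesgue_on[OF m\<Psi>])
      moreover have "(\<lambda>u. ennreal (\<bar>g u\<bar>\<^sup>2)) \<in> borel_measurable (lebesgue_on Y)" by (rule borel_measurable_lebesgue_on) measurable
      ultimately show ?thesis by (simp add: nn_integral_add nn_integral_cmult)
    qed
    also have "(\<integral>\<^sup>+ u. \<Psi> u \<partial>lebesgue_on Y) = gagliardo_sq Y r g"
      unfolding gagliardo_sq_def \<Psi>_def \<Phi>_def p_def ..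
    also have "(\<integral>\<^sup>+ u. ennreal (\<bar>g u\<bar>\<^sup>2) \<partial>lebesgue_on Y) = L2_norm_sq Y g" by (simp add: L2_norm_sq_def)
    also have "ennreal c * (ennreal (k1 * c) * gagliardo_sq Y r g + ennreal (k2 * enn2real I) * L2_norm_sq Y g)
        = ennreal (k1 * c * c) * gagliardo_sq Y r g + ennreal (k2 * enn2real I * c) * L2_norm_sq Y g"
      using k c by (simp add: ennreal_mult distrib_left mult_ac)
    also have "\<dots> \<le> ennreal C * gagliardo_sq Y r g + ennreal C * L2_norm_sq Y g"
      using k c by (intro add_mono mult_right_mono ennreal_leI) (auto simp: C_def)
    finally show ?thesis by (simp add: distrib_left)
  qed
  have "gagliardo_sq X r (\<lambda>x. P x * g (A x)) \<le> ennreal C * (gagliardo_sq Y r g + L2_norm_sq Y g)"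
    if g: "g \<in> borel_measurable (lebesgue_on Y)" for g
  proof -
    obtain g0 where g0: "g0 \<in> borel_measurable borel" "AE y in lebesgue_on Y. g y = g0 y"
      using borel_representative[OF o(2) g] by metis
    have "AE x in lebesgue_on X. P x * g (A x) = P x * g0 (A x)"
      using controlled_map_AE[OF A g0(2)] by eventually_elim simp
    then have eq: "gagliardo_sq X r (\<lambda>x. P x * g (A x)) = gagliardo_sq X r (\<lambda>x. P x * g0 (A x))"
      by (rule gagliardo_sq_cong)
    show ?thesis
      unfolding eq gagliardo_sq_cong[OF g0(2)] L2_norm_sq_cong[OF g0(2)] by (rule borel_case[OF g0(1)])
  qed
  with C show ?thesis by blast
qed

section \<open>Domination up to a constant\<close>

text \<open>
  Boundedness of an operator on \<open>F\<close>, with the constants hidden: the estimates of the finitely many terms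
  can then be combined without tracking them.
\<close>

definition dominated :: "'f set \<Rightarrow> ('f \<Rightarrow> ennreal) \<Rightarrow> ('f \<Rightarrow> ennreal) \<Rightarrow> bool" where
  "dominated F \<phi> E \<longleftrightarrow> (\<exists>C\<ge>0. \<forall>f\<in>F. \<phi> f \<le> ennreal C * E f)"

lemma dominatedI: "0 \<le> C \<Longrightarrow> (\<And>f. f \<in> F \<Longrightarrow> \<phi> f \<le> ennreal C * E f) \<Longrightarrow> dominated F \<phi> E"
  by (auto simp: dominated_def)

lemma dominated_le: "(\<And>f. f \<in> F \<Longrightarrow> \<phi> f \<le> E f) \<Longrightarrow> dominated F \<phi> E"
  by (rule dominatedI[of 1]) auto

lemma dominated_trans:
  assumes "dominated F \<phi> \<psi>" "dominated F \<psi> E"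
  shows "dominated F \<phi> E"
proof -
  obtain C D where C: "C \<ge> 0" "\<And>f. f \<in> F \<Longrightarrow> \<phi> f \<le> ennreal C * \<psi> f"
    and D: "D \<ge> 0" "\<And>f. f \<in> F \<Longrightarrow> \<psi> f \<le> ennreal D * E f"
    using assms by (auto simp: dominated_def)
  show ?thesis
  proof (rule dominatedI[of "C * D"])
    fix f assume f: "f \<in> F"
    have "\<phi> f \<le> ennreal C * \<psi> f" by (rule C(2)[OF f])
    also have "\<dots> \<le> ennreal C * (ennreal D * E f)" by (rule mult_left_mono[OF D(2)[OF f]]) simp
    finally show "\<phi> f \<le> ennreal (C * D) * E f" using C D by (simp add: ennreal_mult mult.assoc)
  qed (use C D in simp)
qed

lemma dominated_add:
  assumes "dominated F \<phi> E" "dominated F \<psi> E"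
  shows "dominated F (\<lambda>f. \<phi> f + \<psi> f) E"
proof -
  obtain C D where C: "C \<ge> 0" "\<And>f. f \<in> F \<Longrightarrow> \<phi> f \<le> ennreal C * E f"
    and D: "D \<ge> 0" "\<And>f. f \<in> F \<Longrightarrow> \<psi> f \<le> ennreal D * E f"
    using assms by (auto simp: dominated_def)
  show ?thesis
  proof (rule dominatedI[of "C + D"])
    fix f assume f: "f \<in> F"
    have "\<phi> f + \<psi> f \<le> ennreal C * E f + ennreal D * E f" by (intro add_mono C(2) D(2) f)
    then show "\<phi> f + \<psi> f \<le> ennreal (C + D) * E f" using C D by (simp add: distrib_right)
  qed (use C D in simp)
qed

lemma dominated_sum:
  assumes "finite I" "\<And>i. i \<in> I \<Longrightarrow> dominated F (\<phi> i) E"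
  shows "dominated F (\<lambda>f. \<Sum>i\<in>I. \<phi> i f) E"
  using assms
proof (induction I rule: finite_induct)
  case empty
  show ?case by (rule dominatedI[of 0]) auto
next
  case (insert i I)
  have "dominated F (\<lambda>f. \<phi> i f + (\<Sum>i\<in>I. \<phi> i f)) E" using insert by (intro dominated_add) auto
  then show ?case using insert by simp
qed

section \<open>The Koopman operator\<close>

lemma diffeomorphism_controlled:
  fixes A :: "real ^ 'd \<Rightarrow> real ^ 'd"
  assumes XY: "open X" "open Y" and A: "C1_diffeomorphism X Y A"
    and d: "(INF x\<in>X. \<bar>det (jacobian A (at x))\<bar>) > 0"
    and bA: "\<And>i l. bounded (partial_deriv i (\<lambda>x. A x $ l) ` X)"
  obtains c where "controlled_map X Y A c"
proof -
  have bij: "bij_betw A X Y" and CA: "Ck_on 1 X A" and CB: "Ck_on 1 Y (inv_into X A)"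
    using A by (auto simp: C1_diffeomorphism_def)
  define B where "B = inv_into X A"
  define c0 where "c0 = (INF x\<in>X. \<bar>det (jacobian A (at x))\<bar>)"
  have c0: "c0 > 0" using d by (simp add: c0_def)
  have dA: "A differentiable (at x)" if "x \<in> X" for x using CA XY that by (auto intro: differentiable_on_open_at)
  have dB: "B differentiable (at y)" if "y \<in> Y" for y using CB XY that by (auto simp: B_def intro: differentiable_on_open_at)
  have "\<forall>i l. \<exists>M. \<forall>x\<in>X. \<bar>partial_deriv i (\<lambda>x. A x $ l) x\<bar> \<le> M" using bA by (auto simp: bounded_iff)
  then obtain M where M: "\<And>i l x. x \<in> X \<Longrightarrow> \<bar>partial_deriv i (\<lambda>x. A x $ l) x\<bar> \<le> M i l" by metis
  define M' where "M' = 1 + (\<Sum>i\<in>UNIV. \<Sum>l\<in>UNIV. \<bar>M i l\<bar>)"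
  have MM: "M i l \<le> M'" for i l
  proof -
    have "M i l \<le> \<bar>M i l\<bar>" by simp
    also have "\<dots> \<le> (\<Sum>l\<in>UNIV. \<bar>M i l\<bar>)" by (rule member_le_sum) auto
    also have "\<dots> \<le> (\<Sum>i\<in>UNIV. \<Sum>l\<in>UNIV. \<bar>M i l\<bar>)" by (rule member_le_sum) (auto intro: sum_nonneg)
    finally show ?thesis by (simp add: M'_def)
  qed
  have M'1: "M' \<ge> 1" by (simp add: M'_def sum_nonneg)
  let ?L = "CARD('d) * (real (card {p. p permutes (UNIV :: 'd set)}) * M' ^ CARD('d) / c0)"
  define L where "L = ?L + 1"
  have "?L \<ge> 0" using M'1 c0 by simp
  then have L0: "L > 0" by (simp add: L_def)
  have onB: "onorm (frechet_derivative B (at y)) \<le> L" if y: "y \<in> Y" for y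
  proof -
    have BX: "B y \<in> X" using bij y unfolding B_def by (metis bij_betw_def inv_into_into)
    have AB: "A (B y) = y" if "y \<in> Y" for y using bij that unfolding B_def by (metis bij_betw_def f_inv_into_f)
    have fA: "(A has_derivative frechet_derivative A (at (B y))) (at (B y))" using dA[OF BX] frechet_derivative_works by blast
    have fB: "(B has_derivative frechet_derivative B (at y)) (at y)" using dB[OF y] frechet_derivative_works by blast
    have "onorm (frechet_derivative B (at y)) \<le> ?L"
    proof (rule inverse_derivative_bound[OF XY(2) y AB fA fB c0 _ M'1])
      have "c0 \<le> \<bar>det (jacobian A (at (B y)))\<bar>"
        unfolding c0_def by (rule cINF_lower[OF _ BX]) (auto intro!: bdd_belowI[of _ 0])
      then show "c0 \<le> \<bar>det (matrix (frechet_derivative A (at (B y))))\<bar>" by (simp add: jacobian_def)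
      fix i j
      have "partial_deriv j (\<lambda>x. A x $ i) (B y) = frechet_derivative A (at (B y)) (axis j 1) $ i"
        by (rule partial_deriv_eq) (rule bounded_linear.has_derivative[OF bounded_linear_vec_nth fA])
      then show "\<bar>frechet_derivative A (at (B y)) (axis j 1) $ i\<bar> \<le> M'"
        using M[OF BX, of j i] MM[of j i] by simp
    qed
    then show ?thesis by (simp add: L_def)
  qed
  have hB: "(inv_into X A has_derivative frechet_derivative B (at y)) (at y)" if "y \<in> Y" for y
    using dB[OF that] frechet_derivative_works unfolding B_def by blast
  have diffB: "inv_into X A differentiable_on Y" using CB by simp
  have "controlled_map X Y A (L ^ DIM(real ^ 'd))"
    unfolding controlled_map_def
  proof (intro conjI ballI)
    show "A ` X \<subseteq> Y" using bij by (simp add: bij_betw_def)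
    show "continuous_on X A" using CA by (simp add: differentiable_imp_continuous_on)
    show "A \<in> measurable (lebesgue_on X) (lebesgue_on Y)" by (rule diffeomorphism_measurable(1)[OF XY bij diffB])
    show "(\<integral>\<^sup>+ x. u (A x) \<partial>lebesgue_on X) \<le> ennreal (L ^ DIM(real ^ 'd)) * (\<integral>\<^sup>+ y. u y \<partial>lebesgue_on Y)"
      if "u \<in> borel_measurable (lebesgue_on Y)" for u
      by (rule nn_integral_diffeomorphism_le[OF XY bij hB L0 onB that])
  qed (use XY L0 in auto)
  then show thesis by (rule that)
qed

text \<open>
  The vector-valued form of the Lipschitz estimate.
\<close>

lemma lipschitz_components:
  fixes A :: "real ^ 'd \<Rightarrow> real ^ 'd"
  assumes X: "bounded_lipschitz_domain X" and A: "\<And>l. Ckb True 1 X (\<lambda>x. A x $ l)"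
  obtains L where "L > 0" "\<And>x y. x \<in> X \<Longrightarrow> y \<in> X \<Longrightarrow> norm (A x - A y) \<le> L * norm (x - y)"
proof -
  have "\<forall>l. \<exists>C\<ge>0. \<forall>x\<in>X. \<forall>y\<in>X. \<bar>A x $ l - A y $ l\<bar> \<le> C * norm (x - y)"
    using Ckb_1_lipschitz[OF X A] by metis
  then obtain C where C: "\<And>l. C l \<ge> 0" "\<And>l x y. x \<in> X \<Longrightarrow> y \<in> X \<Longrightarrow> \<bar>A x $ l - A y $ l\<bar> \<le> C l * norm (x - y)"
    by metis
  show thesis
  proof (rule that[of "(\<Sum>l\<in>UNIV. C l) + 1"])
    have "(\<Sum>l\<in>UNIV. C l) \<ge> 0" using C(1) by (simp add: sum_nonneg)
    then show "(\<Sum>l\<in>UNIV. C l) + 1 > 0" by simp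
    fix x y assume xy: "x \<in> X" "y \<in> X"
    have "norm (A x - A y) \<le> (\<Sum>l\<in>UNIV. \<bar>(A x - A y) $ l\<bar>)" by (rule norm_le_l1_cart)
    also have "\<dots> \<le> (\<Sum>l\<in>UNIV. C l * norm (x - y))" using C(2)[OF xy] by (intro sum_mono) simp
    also have "\<dots> = (\<Sum>l\<in>UNIV. C l) * norm (x - y)" by (simp add: sum_distrib_right)
    also have "\<dots> \<le> ((\<Sum>l\<in>UNIV. C l) + 1) * norm (x - y)" by (intro mult_right_mono) auto
    finally show "norm (A x - A y) \<le> ((\<Sum>l\<in>UNIV. C l) + 1) * norm (x - y)" .
  qed
qed

definition weak_pd :: "(real ^ 'd) set \<Rightarrow> (real ^ 'd \<Rightarrow> real) \<Rightarrow> 'd list \<Rightarrow> real ^ 'd \<Rightarrow> real" where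
  "weak_pd \<Omega> f is = weak_deriv \<Omega> (count (mset is)) f"

lemma mi_order_count: "mi_order (count (mset is)) = length is"
  by (metis length_canon mset_canon size_mset)

lemma weak_deriv_has_weak_deriv: "\<exists>g. has_weak_deriv \<Omega> \<alpha> f g \<Longrightarrow> has_weak_deriv \<Omega> \<alpha> f (weak_deriv \<Omega> \<alpha> f)"
  using someI_ex[of "has_weak_deriv \<Omega> \<alpha> f"] by (simp add: weak_deriv_def)

lemma sobolev_weak_pd:
  assumes "f \<in> sobolev_space \<Omega> \<sigma>" "length is \<le> nat \<lfloor>\<sigma>\<rfloor>"
  shows "has_weak_deriv \<Omega> (count (mset is)) f (weak_pd \<Omega> f is)"
  unfolding weak_pd_def using assms by (intro weak_deriv_has_weak_deriv) (auto simp: sobolev_space_def mi_order_count)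

lemma finite_mi_order_eq: "finite {\<alpha> :: 'd::finite \<Rightarrow> nat. mi_order \<alpha> = k}"
  by (rule finite_subset[OF _ finite_mi_order_le[of k]]) auto

lemma L2_dominated_by_sobolev:
  assumes "length is \<le> nat \<lfloor>\<sigma>\<rfloor>"
  shows "L2_norm_sq \<Omega> (weak_pd \<Omega> f is) \<le> sobolev_norm_sq \<Omega> \<sigma> f"
proof -
  have "L2_norm_sq \<Omega> (weak_deriv \<Omega> (count (mset is)) f) \<le> (\<Sum>\<alpha> | mi_order \<alpha> \<le> nat \<lfloor>\<sigma>\<rfloor>. L2_norm_sq \<Omega> (weak_deriv \<Omega> \<alpha> f))"
    using assms by (intro member_le_sum finite_mi_order_le) (auto simp: mi_order_count)
  then show ?thesis unfolding weak_pd_def sobolev_norm_sq_def by (rule order_trans) simp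
qed

lemma gagliardo_dominated_by_sobolev:
  assumes "length is = nat \<lfloor>\<sigma>\<rfloor>" "0 < frac \<sigma>"
  shows "gagliardo_sq \<Omega> (frac \<sigma>) (weak_pd \<Omega> f is) \<le> sobolev_norm_sq \<Omega> \<sigma> f"
proof -
  have "gagliardo_sq \<Omega> (frac \<sigma>) (weak_deriv \<Omega> (count (mset is)) f) \<le> (\<Sum>\<alpha> | mi_order \<alpha> = nat \<lfloor>\<sigma>\<rfloor>. gagliardo_sq \<Omega> (frac \<sigma>) (weak_deriv \<Omega> \<alpha> f))"
    using assms by (intro member_le_sum finite_mi_order_eq) (auto simp: mi_order_count)
  moreover have "indicator {0<..<1} (frac \<sigma>) = (1 :: ennreal)" using assms(2) frac_lt_1[of \<sigma>] by simp
  ultimately show ?thesis unfolding weak_pd_def sobolev_norm_sq_def by (simp add: add_increasing)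
qed

text \<open>
  Every term of the chain rule is dominated by the norm of \<open>f\<close> in \<open>H\<^sup>\<sigma>(Y)\<close>, in \<open>L\<^sup>2\<close> and, for fractional \<open>\<sigma>\<close>, in the
  Gagliardo seminorm. Derivatives of \<open>f\<close> of order less than \<open>k\<close> enter the seminorm through the
  embedding of \<open>H\<^sup>1\<close> into \<open>H\<^sup>r\<close>.
\<close>

theorem koopman_sobolev_bound:
  fixes A :: "real ^ 'd \<Rightarrow> real ^ 'd"
  assumes X: "bounded_lipschitz_domain X" and Y: "bounded_lipschitz_domain Y"
    and A: "controlled_map X Y A c" and dA: "A differentiable_on X" and CA: "\<And>l. Ckb True m X (\<lambda>x. A x $ l)"
    and \<sigma>: "0 \<le> \<sigma>" "\<sigma> \<le> real m"
  shows "\<exists>C\<ge>0. \<forall>f\<in>sobolev_space Y \<sigma>.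
    (\<forall>\<alpha>. mi_order \<alpha> \<le> nat \<lfloor>\<sigma>\<rfloor> \<longrightarrow> (\<exists>g. has_weak_deriv X \<alpha> (\<lambda>x. f (A x)) g)) \<and>
    sobolev_norm_sq X \<sigma> (\<lambda>x. f (A x)) \<le> ennreal C * sobolev_norm_sq Y \<sigma> f"
proof -
  have oX: "open X" "bounded X" and oY: "open Y" using X Y by (auto simp: bounded_lipschitz_domain_def domain_set_def)
  define k where "k = nat \<lfloor>\<sigma>\<rfloor>"
  have km: "k \<le> m" using \<sigma> unfolding k_def by linarith
  \<comment> \<open>for fractional \<open>\<sigma>\<close> one order of differentiability of \<open>A\<close> is left over; it makes \<open>A\<close> and the coefficients Lipschitz\<close>
  have km1: "Suc k \<le> m" if "0 < frac \<sigma>"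
  proof -
    have "\<sigma> = real k + frac \<sigma>" using \<sigma>(1) by (simp add: k_def frac_def)
    then have "real k < real m" using that \<sigma>(2) by linarith
    then show ?thesis by simp
  qed
  let ?F = "sobolev_space Y \<sigma>" and ?E = "sobolev_norm_sq Y \<sigma>" and ?w = "weak_pd Y"
  have w: "has_weak_deriv Y (count (mset is)) f (?w f is)" if "f \<in> ?F" "length is \<le> k" for f "is"
    using sobolev_weak_pd[OF that(1)] that(2) by (simp add: k_def)
  have wm: "?w f is \<in> borel_measurable (lebesgue_on Y)" if "f \<in> ?F" "length is \<le> k" for f "is"
    using w[OF that] by (intro locally_integrable_measurable[OF oY]) (simp add: has_weak_deriv_def)
  have dL2: "dominated ?F (\<lambda>f. L2_norm_sq Y (?w f is)) ?E" if "length is \<le> k" for "is"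
    by (rule dominated_le) (rule L2_dominated_by_sobolev, use that in \<open>simp add: k_def\<close>)
  have dG: "dominated ?F (\<lambda>f. gagliardo_sq Y (frac \<sigma>) (?w f is)) ?E" if len: "length is \<le> k" and r: "0 < frac \<sigma>" for "is"
  proof (cases "length is = k")
    case True
    then show ?thesis by (intro dominated_le gagliardo_dominated_by_sobolev) (use r in \<open>auto simp: k_def\<close>)
  next
    case False
    then have len1: "length (i # is) \<le> k" for i using len by simp
    obtain C where C: "C \<ge> 0" "\<forall>h hi. (\<forall>i. has_weak_deriv Y (count (mset [i])) h (hi i)) \<longrightarrow>
       gagliardo_sq Y (frac \<sigma>) h \<le> ennreal C * (L2_norm_sq Y h + (\<Sum>i\<in>UNIV. L2_norm_sq Y (hi i)))"
      using gagliardo_embedding[OF Y r frac_lt_1] by blast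
    have "dominated ?F (\<lambda>f. gagliardo_sq Y (frac \<sigma>) (?w f is)) (\<lambda>f. L2_norm_sq Y (?w f is) + (\<Sum>i\<in>UNIV. L2_norm_sq Y (?w f (i # is))))"
    proof (rule dominatedI[OF C(1)])
      fix f assume f: "f \<in> ?F"
      have "has_weak_deriv Y (count (mset [i])) (?w f is) (?w f (i # is))" for i
        by (rule has_weak_deriv_step[OF w[OF f len] w[OF f len1]])
      then show "gagliardo_sq Y (frac \<sigma>) (?w f is) \<le> ennreal C * (L2_norm_sq Y (?w f is) + (\<Sum>i\<in>UNIV. L2_norm_sq Y (?w f (i # is))))"
        using C(2)[rule_format, of "?w f is" "\<lambda>i. ?w f (i # is)"] by blast
    qed
    moreover have "dominated ?F (\<lambda>f. L2_norm_sq Y (?w f is) + (\<Sum>i\<in>UNIV. L2_norm_sq Y (?w f (i # is)))) ?E"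
      by (intro dominated_add dominated_sum dL2 len len1) auto
    ultimately show ?thesis by (rule dominated_trans)
  qed
  have key: "\<exists>G. (\<forall>f\<in>?F. has_weak_deriv X \<alpha> (\<lambda>x. f (A x)) (G f)) \<and> dominated ?F (\<lambda>f. L2_norm_sq X (G f)) ?E \<and>
      (0 < frac \<sigma> \<longrightarrow> dominated ?F (\<lambda>f. gagliardo_sq X (frac \<sigma>) (G f)) ?E)"
    if \<alpha>: "mi_order \<alpha> \<le> k" for \<alpha>
  proof -
    define js where "js = canon \<alpha>"
    define n where "n = length js"
    have js: "count (mset js) = \<alpha>" using canon_perm[of js \<alpha>] by (simp add: js_def)
    have nk: "n \<le> k" using \<alpha> by (simp add: n_def js_def length_canon)
    have "length js \<le> m" using nk km by (simp add: n_def)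
    from weak_chain_rule[OF A dA CA this, folded n_def, unfolded js] obtain P
      where P: "\<And>is. length is \<le> n \<Longrightarrow> Ckb True (m - n) X (P is)"
        and chain: "\<And>f g. (\<forall>is\<in>lists_upto n. has_weak_deriv Y (count (mset is)) f (g is)) \<Longrightarrow>
          has_weak_deriv X \<alpha> (\<lambda>x. f (A x)) (\<lambda>x. \<Sum>is\<in>lists_upto n. P is x * g is (A x))"
      by (auto simp only: mem_Collect_eq)
    define G where "G f x = (\<Sum>is\<in>lists_upto n. P is x * ?w f is (A x))" for f x
    have hG: "has_weak_deriv X \<alpha> (\<lambda>x. f (A x)) (G f)" if "f \<in> ?F" for f
      unfolding G_def[abs_def] by (rule chain) (use w[OF that] nk in auto)
    have cA: "A \<in> measurable (lebesgue_on X) (lebesgue_on Y)" using A by (simp add: controlled_map_def)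
    have mterm: "(\<lambda>x. P is x * ?w f is (A x)) \<in> borel_measurable (lebesgue_on X)" if f: "f \<in> ?F" and len: "length is \<le> n" for f "is"
    proof -
      have "P is \<in> borel_measurable (lebesgue_on X)"
        using Ckb_continuous[OF P[OF len]] oX(1) by (intro continuous_imp_measurable_on_sets_lebesgue) auto
      moreover have "(\<lambda>x. ?w f is (A x)) \<in> borel_measurable (lebesgue_on X)"
        using len nk by (intro measurable_compose[OF cA] wm f) auto
      ultimately show ?thesis by (rule borel_measurable_times)
    qed
    have bP: "\<exists>B. \<forall>x\<in>X. \<bar>P is x\<bar> \<le> B" if "length is \<le> n" for "is"
      using Ckb_bounded[OF P[OF that]] by (auto simp: bounded_iff)
    have "dominated ?F (\<lambda>f. L2_norm_sq X (G f)) (\<lambda>f. \<Sum>is\<in>lists_upto n. L2_norm_sq X (\<lambda>x. P is x * ?w f is (A x)))"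
      unfolding G_def[abs_def]
      by (rule dominatedI[of "real (card (lists_upto n :: 'd list set))"]) (auto intro!: L2_norm_sq_sum_le mterm)
    moreover have "dominated ?F (\<lambda>f. \<Sum>is\<in>lists_upto n. L2_norm_sq X (\<lambda>x. P is x * ?w f is (A x))) ?E"
    proof (rule dominated_sum)
      fix "is" :: "'d list" assume "is \<in> lists_upto n"
      then have len: "length is \<le> n" "length is \<le> k" using nk by auto
      obtain B where B: "\<And>x. x \<in> X \<Longrightarrow> \<bar>P is x\<bar> \<le> B" using bP[OF len(1)] by blast
      have "0 \<le> B\<^sup>2 * c" using A by (simp add: controlled_map_def)
      then have "dominated ?F (\<lambda>f. L2_norm_sq X (\<lambda>x. P is x * ?w f is (A x))) (\<lambda>f. L2_norm_sq Y (?w f is))"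
        by (rule dominatedI) (rule L2_norm_sq_compose_le[OF A B wm[OF _ len(2)]])
      then show "dominated ?F (\<lambda>f. L2_norm_sq X (\<lambda>x. P is x * ?w f is (A x))) ?E"
        using dL2[OF len(2)] by (rule dominated_trans)
    qed simp
    ultimately have d1: "dominated ?F (\<lambda>f. L2_norm_sq X (G f)) ?E" by (rule dominated_trans)
    have d2: "dominated ?F (\<lambda>f. gagliardo_sq X (frac \<sigma>) (G f)) ?E" if r: "0 < frac \<sigma>"
    proof -
      have "1 \<le> m" using km1[OF r] by simp
      then have "Ckb True 1 X (\<lambda>x. A x $ l)" for l by (rule Ckb_mono[OF CA])
      then obtain La where La: "La > 0" "\<And>x y. x \<in> X \<Longrightarrow> y \<in> X \<Longrightarrow> norm (A x - A y) \<le> La * norm (x - y)"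
        using lipschitz_components[OF X] by blast
      have "dominated ?F (\<lambda>f. gagliardo_sq X (frac \<sigma>) (G f)) (\<lambda>f. \<Sum>is\<in>lists_upto n. gagliardo_sq X (frac \<sigma>) (\<lambda>x. P is x * ?w f is (A x)))"
        unfolding G_def[abs_def]
        by (rule dominatedI[of "real (card (lists_upto n :: 'd list set))"]) (auto intro!: gagliardo_sq_sum_le mterm oX)
      moreover have "dominated ?F (\<lambda>f. \<Sum>is\<in>lists_upto n. gagliardo_sq X (frac \<sigma>) (\<lambda>x. P is x * ?w f is (A x))) ?E"
      proof (rule dominated_sum)
        fix "is" :: "'d list" assume "is \<in> lists_upto n"
        then have len: "length is \<le> n" "length is \<le> k" using nk by auto
        obtain B where B: "\<And>x. x \<in> X \<Longrightarrow> \<bar>P is x\<bar> \<le> B" using bP[OF len(1)] by blast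
        have "1 \<le> m - n" using km1[OF r] nk by simp
        then have "Ckb True 1 X (P is)" by (rule Ckb_mono[OF P[OF len(1)]])
        then obtain l where l: "\<And>x y. x \<in> X \<Longrightarrow> y \<in> X \<Longrightarrow> \<bar>P is x - P is y\<bar> \<le> l * norm (x - y)"
          using Ckb_1_lipschitz[OF X] by blast
        obtain C where C: "C \<ge> 0" "\<forall>g\<in>borel_measurable (lebesgue_on Y).
            gagliardo_sq X (frac \<sigma>) (\<lambda>x. P is x * g (A x)) \<le> ennreal C * (gagliardo_sq Y (frac \<sigma>) g + L2_norm_sq Y g)"
          using gagliardo_compose[OF A oX(2) La B l r frac_lt_1] by blast
        have "dominated ?F (\<lambda>f. gagliardo_sq X (frac \<sigma>) (\<lambda>x. P is x * ?w f is (A x))) (\<lambda>f. gagliardo_sq Y (frac \<sigma>) (?w f is) + L2_norm_sq Y (?w f is))"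
          by (rule dominatedI[OF C(1)]) (use C(2) wm[OF _ len(2)] in blast)
        moreover have "dominated ?F (\<lambda>f. gagliardo_sq Y (frac \<sigma>) (?w f is) + L2_norm_sq Y (?w f is)) ?E"
          by (intro dominated_add dG dL2 len r)
        ultimately show "dominated ?F (\<lambda>f. gagliardo_sq X (frac \<sigma>) (\<lambda>x. P is x * ?w f is (A x))) ?E" by (rule dominated_trans)
      qed simp
      ultimately show ?thesis by (rule dominated_trans)
    qed
    show ?thesis using hG d1 d2 by blast
  qed
  have ex: "\<exists>g. has_weak_deriv X \<alpha> (\<lambda>x. f (A x)) g" if "f \<in> ?F" "mi_order \<alpha> \<le> k" for f \<alpha>
    using key[OF that(2)] that(1) by blast
  have dom: "dominated ?F (\<lambda>f. L2_norm_sq X (weak_deriv X \<alpha> (\<lambda>x. f (A x)))) ?E \<and>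
      (0 < frac \<sigma> \<longrightarrow> dominated ?F (\<lambda>f. gagliardo_sq X (frac \<sigma>) (weak_deriv X \<alpha> (\<lambda>x. f (A x)))) ?E)"
    if \<alpha>: "mi_order \<alpha> \<le> k" for \<alpha>
  proof -
    obtain G where G: "\<And>f. f \<in> ?F \<Longrightarrow> has_weak_deriv X \<alpha> (\<lambda>x. f (A x)) (G f)"
      "dominated ?F (\<lambda>f. L2_norm_sq X (G f)) ?E" "0 < frac \<sigma> \<longrightarrow> dominated ?F (\<lambda>f. gagliardo_sq X (frac \<sigma>) (G f)) ?E"
      using key[OF \<alpha>] by blast
    have ae: "AE x in lebesgue_on X. weak_deriv X \<alpha> (\<lambda>x. f (A x)) x = G f x" if "f \<in> ?F" for f
      by (rule weak_deriv_unique[OF oX(1) weak_deriv_has_weak_deriv[OF ex[OF that \<alpha>]] G(1)[OF that]])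
    show ?thesis
    proof (intro conjI impI)
      show "dominated ?F (\<lambda>f. L2_norm_sq X (weak_deriv X \<alpha> (\<lambda>x. f (A x)))) ?E"
        using G(2) unfolding dominated_def by (simp add: L2_norm_sq_cong[OF ae])
      show "dominated ?F (\<lambda>f. gagliardo_sq X (frac \<sigma>) (weak_deriv X \<alpha> (\<lambda>x. f (A x)))) ?E" if "0 < frac \<sigma>"
        using G(3) that unfolding dominated_def by (simp add: gagliardo_sq_cong[OF ae])
    qed
  qed
  have "dominated ?F (\<lambda>f. sobolev_norm_sq X \<sigma> (\<lambda>x. f (A x))) ?E"
  proof (cases "0 < frac \<sigma>")
    case True
    then have ind: "indicator {0<..<1} (frac \<sigma>) = (1 :: ennreal)" using frac_lt_1[of \<sigma>] by simp
    show ?thesis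
      unfolding sobolev_norm_sq_def[of X] ind mult_1 k_def[symmetric]
      by (intro dominated_add dominated_sum finite_mi_order_le finite_mi_order_eq) (use dom True in auto)
  next
    case False
    then have ind: "indicator {0<..<1} (frac \<sigma>) = (0 :: ennreal)" by simp
    show ?thesis
      unfolding sobolev_norm_sq_def[of X] ind mult_zero_left add_0_right k_def[symmetric]
      by (intro dominated_sum finite_mi_order_le) (use dom in auto)
  qed
  then show ?thesis using ex unfolding dominated_def k_def by blast
qed

theorem theorem4p2:
  fixes \<Omega>X \<Omega>Y :: "(real ^ 'd) set"
    and A :: "real ^ 'd \<Rightarrow> real ^ 'd"
    and m :: nat and \<sigma> :: real
  assumes "bounded_lipschitz_domain \<Omega>X"
    and "bounded_lipschitz_domain \<Omega>Y"
    and "C1_diffeomorphism \<Omega>X \<Omega>Y A"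
    and "(INF x\<in>\<Omega>X. \<bar>det (jacobian A (at x))\<bar>) > 0"
    and "real m > real CARD('d) / 2"
    and "Cb_on m \<Omega>X A"
    and "0 \<le> \<sigma>" and "\<sigma> \<le> real m"
  shows
    "(\<forall>f \<in> sobolev_space \<Omega>Y \<sigma>. koopman A f \<in> sobolev_space \<Omega>X \<sigma>) \<and>
     (\<forall>f \<in> sobolev_space \<Omega>Y \<sigma>. \<forall>g \<in> sobolev_space \<Omega>Y \<sigma>.
        (AE y in lebesgue_on \<Omega>Y. f y = g y) \<longrightarrow>
        (AE x in lebesgue_on \<Omega>X. koopman A f x = koopman A g x)) \<and>
     (\<forall>f \<in> sobolev_space \<Omega>Y \<sigma>. \<forall>g \<in> sobolev_space \<Omega>Y \<sigma>. \<forall>a b.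
        koopman A (\<lambda>y. a * f y + b * g y) = (\<lambda>x. a * koopman A f x + b * koopman A g x)) \<and>
     (\<exists>C. \<forall>f \<in> sobolev_space \<Omega>Y \<sigma>.
        sobolev_norm \<Omega>X \<sigma> (koopman A f) \<le> C * sobolev_norm \<Omega>Y \<sigma> f)"
proof -
  have o: "open \<Omega>X" "open \<Omega>Y" using assms(1,2) by (auto simp: bounded_lipschitz_domain_def domain_set_def)
  have m: "1 \<le> m" using assms(5) by (cases m) auto
  have CA: "Ckb True m \<Omega>X (\<lambda>x. A x $ l)" for l by (rule Cb_on_imp_Ckb[OF o(1) assms(6)])
  have dA: "A differentiable_on \<Omega>X" using assms(3) by (simp add: C1_diffeomorphism_def)
  have "bounded (partial_deriv i (\<lambda>x. A x $ l) ` \<Omega>X)" for i l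
    using Ckb_mono[OF CA m, of l] by simp
  then obtain c where A: "controlled_map \<Omega>X \<Omega>Y A c"
    using diffeomorphism_controlled[OF o assms(3,4)] by blast
  obtain C where C: "C \<ge> 0" "\<forall>f\<in>sobolev_space \<Omega>Y \<sigma>.
    (\<forall>\<alpha>. mi_order \<alpha> \<le> nat \<lfloor>\<sigma>\<rfloor> \<longrightarrow> (\<exists>g. has_weak_deriv \<Omega>X \<alpha> (\<lambda>x. f (A x)) g)) \<and>
    sobolev_norm_sq \<Omega>X \<sigma> (\<lambda>x. f (A x)) \<le> ennreal C * sobolev_norm_sq \<Omega>Y \<sigma> f"
    using koopman_sobolev_bound[OF assms(1,2) A dA CA assms(7,8)] by blast
  have K: "koopman A f = (\<lambda>x. f (A x))" for f by (simp add: koopman_def o_def)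
  have fin: "sobolev_norm_sq \<Omega>Y \<sigma> f < \<infinity>" if "f \<in> sobolev_space \<Omega>Y \<sigma>" for f
    using that by (simp add: sobolev_space_def)
  show ?thesis
  proof (intro conjI ballI allI impI)
    fix f assume f: "f \<in> sobolev_space \<Omega>Y \<sigma>"
    have "sobolev_norm_sq \<Omega>X \<sigma> (\<lambda>x. f (A x)) \<le> ennreal C * sobolev_norm_sq \<Omega>Y \<sigma> f" using C(2) f by blast
    also have "\<dots> < \<infinity>" using fin[OF f] by (simp add: ennreal_mult_less_top)
    finally show "koopman A f \<in> sobolev_space \<Omega>X \<sigma>"
      using C(2) f unfolding K by (simp add: sobolev_space_def)
  next
    fix f g :: "real ^ 'd \<Rightarrow> real" assume "AE y in lebesgue_on \<Omega>Y. f y = g y"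
    then show "AE x in lebesgue_on \<Omega>X. koopman A f x = koopman A g x"
      unfolding K by (rule controlled_map_AE[OF A])
  next
    show "koopman A (\<lambda>y. a * f y + b * g y) = (\<lambda>x. a * koopman A f x + b * koopman A g x)" for f g :: "real ^ 'd \<Rightarrow> real" and a b
      by (simp add: K)
  next
    show "\<exists>C. \<forall>f \<in> sobolev_space \<Omega>Y \<sigma>. sobolev_norm \<Omega>X \<sigma> (koopman A f) \<le> C * sobolev_norm \<Omega>Y \<sigma> f"
    proof (intro exI[of _ "sqrt C"] ballI)
      fix f assume f: "f \<in> sobolev_space \<Omega>Y \<sigma>"
      have "enn2real (sobolev_norm_sq \<Omega>X \<sigma> (\<lambda>x. f (A x))) \<le> enn2real (ennreal C * sobolev_norm_sq \<Omega>Y \<sigma> f)"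
        using C(2) f fin[OF f] by (intro enn2real_mono) (auto simp: ennreal_mult_less_top)
      also have "\<dots> = C * enn2real (sobolev_norm_sq \<Omega>Y \<sigma> f)" using C(1) by (simp add: enn2real_mult)
      finally have "sqrt (enn2real (sobolev_norm_sq \<Omega>X \<sigma> (\<lambda>x. f (A x)))) \<le> sqrt (C * enn2real (sobolev_norm_sq \<Omega>Y \<sigma> f))"
        by (rule real_sqrt_le_mono)
      then show "sobolev_norm \<Omega>X \<sigma> (koopman A f) \<le> sqrt C * sobolev_norm \<Omega>Y \<sigma> f"
        by (simp add: sobolev_norm_def K real_sqrt_mult)
    qed
  qed
qed

end
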